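(* Let $\{\varphi_l(\cdot-k):1\le l\le L,\ k\in\mathbb{Z}^d\}\subset L^2(\mathbb{R}^d)$ be a frame for its closed linear span $V_0$, with frame bounds $C_1$ and $C_2$, and let $V_0\subset V_1$, where $V_j=\{f:f(A^{-j}\cdot)\in V_0\}$. Assume that the block filter matrix $H(\xi)$ (see context) is unitary for a.e. $\xi$, and let $f^n_l$ be the associated wavelet frame packets. Then $\{f^n_l(\cdot-k):n\ge 0,\ 1\le l\le L,\ k\in\mathbb{Z}^d\}$ is a frame for the space $\overline{\bigcup_{j\ge0}V_j}$ with the same frame bounds. More generally, let $S\subset\mathbb{N}_0\times\mathbb{Z}$ be such that $\{I_{n,j}:(n,j)\in S\}$ is a partition of $\mathbb{N}_0$, where $I_{n,j}=\{r\in\mathbb{N}_0:a^jn\le r\le a^j(n+1)-1\}$. Then the collection of functions $\{a^{j/2}f^n_l(A^j\cdot-k):1\le l\le L,\ (n,j)\in S,\ k\in\mathbb{Z}^d\}$ is a frame for $\overline{\bigcup_{j\ge0}V_j}$ with the same bounds $C_1$ and $C_2$.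
   Context: $\mathbb{N}_0=\{0,1,2,\dots\}$. A family $\{A_i:i\in I\}$ is a partition of $\mathbb{N}_0$ if $A_i\subset\mathbb{N}_0$, the $A_i$ are pairwise disjoint, and $\bigcup_iA_i=\mathbb{N}_0$. A countable family $\{x_k\}$ in a separable Hilbert space $\mathcal{H}$ is a frame for $\mathcal{H}$ if there exist constants $0<C_1\le C_2<\infty$ such that $C_1\|x\|^2\le\sum_k|\langle x,x_k\rangle|^2\le C_2\|x\|^2$ for all $x\in\mathcal{H}$. The largest $C_1$ and the smallest $C_2$ for which this holds are called the frame bounds. A dilation matrix for $\mathbb{R}^d$ is a $d\times d$ matrix $A$ with $A(\mathbb{Z}^d)\subset\mathbb{Z}^d$ all of whose eigenvalues have modulus $>1$; fix one and put $B=A^t$, $a=|\det A|=|\det B|$. A set of digits for $B$ is a subset of $\mathbb{Z}^d$ containing exactly one element of each of the $a$ cosets of $B\mathbb{Z}^d$ in $\mathbb{Z}^d$; fix one, $K_B=\{\beta_0,\dots,\beta_{a-1}\}$. The Fourier transform is $\hat f(\xi)=\int_{\mathbb{R}^d}f(x)e^{-i\langle\xi,x\rangle}dx$. Filters: sequences $\{h^r_{ljk}\}_{k}\in l^2(\mathbb{Z}^d)$, $0\le r\le a-1$, $1\le l,j\le L$, are given, with $h^r_{lj}(\xi)=\sum_{k\in\mathbb{Z}^d}a^{-1/2}h^r_{ljk}e^{-i\langle\xi,k\rangle}$, $H_r(\xi)=(h^r_{lj}(\xi))_{1\le l,j\le L}$, and the $aL\times aL$ block matrix $H(\xi)=\bigl(H_r(\xi+2\pi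 B^{-1}\beta_s)\bigr)_{0\le r,s\le a-1}$ ($(r,s)$-th block as indicated). The sequences for $r=0$ satisfy $\varphi_l(x)=\sum_{j=1}^L\sum_{k}h^0_{ljk}a^{1/2}\varphi_j(Ax-k)$, i.e. $\hat\varphi_l(\xi)=\sum_j h^0_{lj}(B^{-1}\xi)\hat\varphi_j(B^{-1}\xi)$. Wavelet frame packets: $f^0_l=\varphi_l$, and for $0\le s\le a-1$, $r\ge0$, $1\le l\le L$, $$f^{s+ar}_l(x)=\sum_{j=1}^L\sum_{k\in\mathbb{Z}^d}h^s_{ljk}a^{1/2}f^r_j(Ax-k),\quad\text{i.e.}\quad (f^{s+ar}_l)^\wedge(\xi)=\sum_{j=1}^Lh^s_{lj}(B^{-1}\xi)(f^r_j)^\wedge(B^{-1}\xi),$$ which defines $f^n_l$ for all $n\ge0$.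
   Formalization: "Same bounds" means the frame inequalities hold with the same C1, C2, and an optimal C2 stays optimal; optimality of C1 is not claimed, as it can fail. Blocks I_{n,j} of the partition must be nonempty (so j≥0), since empty blocks with j<0 would break the claim. *)

theory Defs
  imports "HOL-Analysis.Analysis" "HOL-Library.Disjoint_Sets"
begin

section \<open>Square integrable functions\<close>

text \<open>Elements of \<open>L\<^sup>2(M)\<close> are represented by functions, not by classes modulo null sets;
  \<open>L2_norm\<close> is accordingly a seminorm. The inner product is linear in the first argument.\<close>

definition L2 :: "'x measure \<Rightarrow> ('x \<Rightarrow> complex) set" where
  "L2 M = {f \<in> borel_measurable M. integrable M (\<lambda>x. (cmod (f x))\<^sup>2)}"

definition L2_inner :: "'x measure \<Rightarrow> ('x \<Rightarrow> complex) \<Rightarrow> ('x \<Rightarrow> complex) \<Rightarrow> complex" where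
  "L2_inner M f g = (LINT x|M. f x * cnj (g x))"

definition L2_norm :: "'x measure \<Rightarrow> ('x \<Rightarrow> complex) \<Rightarrow> real" where
  "L2_norm M f = sqrt (LINT x|M. (cmod (f x))\<^sup>2)"

text \<open>Unconditional convergence of a series in \<open>L\<^sup>2(M)\<close>. As with \<^const>\<open>suminf\<close>, the value
  \<open>L2_sum\<close> is meaningful only if the series converges, and is then determined up to a null set.\<close>

definition has_L2_sum ::
    "'x measure \<Rightarrow> ('i \<Rightarrow> 'x \<Rightarrow> complex) \<Rightarrow> 'i set \<Rightarrow> ('x \<Rightarrow> complex) \<Rightarrow> bool" where
  "has_L2_sum M F I g \<longleftrightarrow> (\<forall>i\<in>I. F i \<in> L2 M) \<and> g \<in> L2 M \<and>
     ((\<lambda>X. L2_norm M (\<lambda>x. g x - (\<Sum>i\<in>X. F i x))) \<longlongrightarrow> 0) (finite_subsets_at_top I)"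

definition L2_sum :: "'x measure \<Rightarrow> ('i \<Rightarrow> 'x \<Rightarrow> complex) \<Rightarrow> 'i set \<Rightarrow> 'x \<Rightarrow> complex" where
  "L2_sum M F I = (SOME g. has_L2_sum M F I g)"

definition lin_span :: "('x \<Rightarrow> complex) set \<Rightarrow> ('x \<Rightarrow> complex) set" where
  "lin_span U = {(\<lambda>x. \<Sum>u\<in>F. c u * u x) | F c. finite F \<and> F \<subseteq> U}"

definition L2_closure :: "'x measure \<Rightarrow> ('x \<Rightarrow> complex) set \<Rightarrow> ('x \<Rightarrow> complex) set" where
  "L2_closure M U = {f \<in> L2 M. \<forall>e>0. \<exists>g\<in>U. L2_norm M (\<lambda>x. f x - g x) < e}"

section \<open>Frames\<close>

text \<open>\<open>frame_with_bounds\<close> only asks that \<open>C1\<close> and \<open>C2\<close> are admissible constants; they need not be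
  the optimal ones. Families are indexed, so repeated elements count with multiplicity.\<close>

definition frame_with_bounds ::
    "'x measure \<Rightarrow> ('x \<Rightarrow> complex) set \<Rightarrow> ('i \<Rightarrow> 'x \<Rightarrow> complex) \<Rightarrow> 'i set \<Rightarrow> real \<Rightarrow> real \<Rightarrow> bool" where
  "frame_with_bounds M V u I C1 C2 \<longleftrightarrow>
     (\<forall>i\<in>I. u i \<in> V) \<and> 0 < C1 \<and> C1 \<le> C2 \<and>
     (\<forall>f\<in>V. (\<lambda>i. (cmod (L2_inner M f (u i)))\<^sup>2) summable_on I \<and>
        C1 * (L2_norm M f)\<^sup>2 \<le> (\<Sum>\<^sub>\<infinity>i\<in>I. (cmod (L2_inner M f (u i)))\<^sup>2) \<and>
        (\<Sum>\<^sub>\<infinity>i\<in>I. (cmod (L2_inner M f (u i)))\<^sup>2) \<le> C2 * (L2_norm M f)\<^sup>2)"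

definition upper_frame_bound ::
    "'x measure \<Rightarrow> ('x \<Rightarrow> complex) set \<Rightarrow> ('i \<Rightarrow> 'x \<Rightarrow> complex) \<Rightarrow> 'i set \<Rightarrow> real \<Rightarrow> bool" where
  "upper_frame_bound M V u I C \<longleftrightarrow>
     (\<forall>f\<in>V. (\<lambda>i. (cmod (L2_inner M f (u i)))\<^sup>2) summable_on I \<and>
        (\<Sum>\<^sub>\<infinity>i\<in>I. (cmod (L2_inner M f (u i)))\<^sup>2) \<le> C * (L2_norm M f)\<^sup>2)"

definition least_upper_frame_bound ::
    "'x measure \<Rightarrow> ('x \<Rightarrow> complex) set \<Rightarrow> ('i \<Rightarrow> 'x \<Rightarrow> complex) \<Rightarrow> 'i set \<Rightarrow> real \<Rightarrow> bool" where
  "least_upper_frame_bound M V u I C \<longleftrightarrow>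
     upper_frame_bound M V u I C \<and> (\<forall>C'. upper_frame_bound M V u I C' \<longrightarrow> C \<le> C')"

section \<open>Dilation matrices and digits\<close>

definition zvec :: "int^'d \<Rightarrow> real^'d" where
  "zvec k = (\<chi> i. real_of_int (k $ i))"

definition dilation_matrix :: "real^'d^'d \<Rightarrow> bool" where
  "dilation_matrix A \<longleftrightarrow> (\<forall>k. A *v zvec k \<in> range zvec) \<and>
     (\<forall>(z::complex) v. v \<noteq> 0 \<longrightarrow> (\<chi> i j. complex_of_real (A $ i $ j)) *v v = z *s v \<longrightarrow> 1 < cmod z)"

text \<open>Powers with respect to the matrix product; the library's \<open>^\<close> acts entrywise on \<open>real^'d^'d\<close>.\<close>

definition matpow :: "real^'d^'d \<Rightarrow> int \<Rightarrow> real^'d^'d" where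
  "matpow A j = (if 0 \<le> j then (((**) A) ^^ nat j) (mat 1)
                 else (((**) (matrix_inv A)) ^^ nat (- j)) (mat 1))"

definition digit_set :: "real^'d^'d \<Rightarrow> (int^'d) set \<Rightarrow> bool" where
  "digit_set B K \<longleftrightarrow> (\<forall>k. \<exists>!b. b \<in> K \<and> (\<exists>m. zvec k - zvec b = B *v zvec m))"

section \<open>Filters\<close>

text \<open>The \<open>2\<pi>\<int>\<^sup>d\<close>-periodic function with Fourier series \<open>\<Sum>\<^sub>k c\<^sub>k e\<^bsup>-i\<langle>\<xi>,k\<rangle>\<^esup>\<close>, for square summable \<open>c\<close>;
  it is determined up to a null set.\<close>

definition fourier_series :: "(int^'d \<Rightarrow> complex) \<Rightarrow> real^'d \<Rightarrow> complex" where
  "fourier_series c = (SOME m. (\<forall>\<xi> k. m (\<xi> + (2 * pi) *\<^sub>R zvec k) = m \<xi>) \<and>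
     has_L2_sum (lebesgue_on (cbox 0 (\<chi> i. 2 * pi)))
       (\<lambda>k \<xi>. c k * exp (- \<i> * of_real (\<xi> \<bullet> zvec k))) UNIV m)"

definition filter_symbol ::
    "nat \<Rightarrow> (nat \<Rightarrow> 'l \<Rightarrow> 'l \<Rightarrow> int^'d \<Rightarrow> complex) \<Rightarrow> nat \<Rightarrow> 'l \<Rightarrow> 'l \<Rightarrow> real^'d \<Rightarrow> complex" where
  "filter_symbol a h r l j = fourier_series (\<lambda>k. h r l j k / sqrt (real a))"

text \<open>The \<open>aL \<times> aL\<close> block matrix \<open>H(\<xi>)\<close>: rows are indexed by \<open>(r,l)\<close>, columns by \<open>(s,j)\<close>, with
  \<open>0 \<le> r,s < a\<close>; the digits are enumerated by \<open>\<beta>\<close>.\<close>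

definition filter_matrix ::
    "real^'d^'d \<Rightarrow> nat \<Rightarrow> (nat \<Rightarrow> int^'d) \<Rightarrow> (nat \<Rightarrow> 'l \<Rightarrow> 'l \<Rightarrow> int^'d \<Rightarrow> complex) \<Rightarrow> real^'d \<Rightarrow>
     nat \<times> 'l \<Rightarrow> nat \<times> 'l \<Rightarrow> complex" where
  "filter_matrix B a \<beta> h \<xi> = (\<lambda>(r, l) (s, j).
     filter_symbol a h r l j (\<xi> + (2 * pi) *\<^sub>R (matrix_inv B *v zvec (\<beta> s))))"

definition unitary_matrix_on :: "'i set \<Rightarrow> ('i \<Rightarrow> 'i \<Rightarrow> complex) \<Rightarrow> bool" where
  "unitary_matrix_on I U \<longleftrightarrow> (\<forall>p\<in>I. \<forall>q\<in>I.
     (\<Sum>t\<in>I. U p t * cnj (U q t)) = (if p = q then 1 else 0) \<and>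
     (\<Sum>t\<in>I. cnj (U t p) * U t q) = (if p = q then 1 else 0))"

section \<open>Wavelet frame packets\<close>

definition refinable ::
    "real^'d^'d \<Rightarrow> nat \<Rightarrow> (nat \<Rightarrow> 'l::finite \<Rightarrow> 'l \<Rightarrow> int^'d \<Rightarrow> complex) \<Rightarrow>
     ('l \<Rightarrow> real^'d \<Rightarrow> complex) \<Rightarrow> bool" where
  "refinable A a h \<phi> \<longleftrightarrow> (\<forall>l. has_L2_sum lebesgue
     (\<lambda>(j, k) x. h 0 l j k * sqrt (real a) * \<phi> j (A *v x - zvec k)) UNIV (\<phi> l))"

definition wavelet_frame_packets ::
    "real^'d^'d \<Rightarrow> nat \<Rightarrow> (nat \<Rightarrow> 'l::finite \<Rightarrow> 'l \<Rightarrow> int^'d \<Rightarrow> complex) \<Rightarrow>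
     ('l \<Rightarrow> real^'d \<Rightarrow> complex) \<Rightarrow> (nat \<Rightarrow> 'l \<Rightarrow> real^'d \<Rightarrow> complex) \<Rightarrow> bool" where
  "wavelet_frame_packets A a h \<phi> f \<longleftrightarrow> f 0 = \<phi> \<and>
     (\<forall>s<a. \<forall>r l. AE x in lebesgue. f (s + a * r) l x =
        L2_sum lebesgue (\<lambda>(j, k) x. h s l j k * sqrt (real a) * f r j (A *v x - zvec k)) UNIV x)"

definition V_space ::
    "real^'d^'d \<Rightarrow> ('l \<Rightarrow> real^'d \<Rightarrow> complex) \<Rightarrow> int \<Rightarrow> (real^'d \<Rightarrow> complex) set" where
  "V_space A \<phi> j = {f. (\<lambda>x. f (matpow A (- j) *v x)) \<in>
     L2_closure lebesgue (lin_span (range (\<lambda>(l, k) x. \<phi> l (x - zvec k))))}"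

definition packet_block :: "nat \<Rightarrow> nat \<times> int \<Rightarrow> nat set" where
  "packet_block a = (\<lambda>(n, j). {r. real a powi j * real n \<le> real r \<and>
                                  real r \<le> real a powi j * (real n + 1) - 1})"

text \<open>The members of a partition are required to be nonempty. For the blocks above this forces
  \<open>j \<ge> 0\<close>: for \<open>j < 0\<close> the block \<open>packet_block a (n, j)\<close> is empty.\<close>

definition partition_family :: "('i \<Rightarrow> 'x set) \<Rightarrow> 'i set \<Rightarrow> bool" where
  "partition_family P S \<longleftrightarrow>
     (\<forall>i\<in>S. P i \<noteq> {}) \<and> disjoint_family_on P S \<and> (\<Union>i\<in>S. P i) = UNIV"

end

theory Submission
  imports Defs "HOL-Computational_Algebra.Fundamental_Theorem_Algebra"
begin

text \<open>Everything is moved to the time domain. Unitarity of the block matrix, averaged over the digit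
  translates and integrated over the torus, says that the matrix
  \<open>U ((s, l, m), (j, k)) = h\<^sup>s (l, j, k - A m)\<close> has orthonormal columns. Expanding the packets of
  index \<open>s + a r\<close> in the dilated packets of index \<open>r\<close>, this gives for every \<open>F \<in> L\<^sup>2\<close> the identity
  \<open>E (r, j + 1) = (\<Sum>s<a. E (s + a r, j))\<close>, where \<open>E (n, j)\<close> is the sum of the squared inner products
  of \<open>F\<close> with the functions \<open>a\<^bsup>j/2\<^esup> f\<^sup>n (A\<^sup>j x - k)\<close>. Hence \<open>E (n, j)\<close> is the sum of \<open>E (r, 0)\<close> over the
  block of \<open>(n, j)\<close>, and \<open>E (0, J)\<close> is controlled on \<open>V\<^sub>J\<close> by the frame bounds of the translates,
  which pass to the closure of the union of the \<open>V\<^sub>J\<close>. The upper bound holds on all of \<open>L\<^sup>2\<close> by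
  duality; it also makes the series defining the packets converge.\<close>

subsection \<open>Square integrable functions\<close>

text \<open>Two circularities shape the argument. The packet of index \<open>s + a * r\<close> is a
  series whose convergence rests on a Bessel bound for index \<open>r\<close>, while that bound
  rests on the energy identity for smaller indices. An induction along \<open>n div a\<close> breaks
  the circle, and without loss in the constant: \<open>E (s + a r, 0)\<close> is one nonnegative
  term of a sum equal to \<open>E (r, 1)\<close>, so the same \<open>C2\<close> is handed on.
  Secondly, the frame inequality is given on \<open>V\<^sub>0\<close> only. Its upper half bounds an
  operator as well as the adjoint, hence extends to \<open>L\<^sup>2\<close>; its lower half fails
  off \<open>V\<^sub>0\<close> in general. It is therefore carried to \<open>V\<^sub>J\<close> by
  dilation and then to the closure by continuity of the energy, which the upper half supplies. An
  arbitrary partition is compared with \<open>E (0, J)\<close> from both sides: finitely many blocks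
  lie in \<open>{..<a ^ J}\<close> for large \<open>J\<close>, and for each \<open>J\<close>
  finitely many blocks cover \<open>{..<a ^ J}\<close>.\<close>

lemma L2_measurable: "f \<in> L2 M \<Longrightarrow> f \<in> borel_measurable M"
  by (simp add: L2_def)

lemma L2_integrable: "f \<in> L2 M \<Longrightarrow> integrable M (\<lambda>x. (cmod (f x))\<^sup>2)"
  by (simp add: L2_def)

lemma L2_comparison:
  assumes "g \<in> borel_measurable M" "integrable M u" "\<And>x. (cmod (g x))\<^sup>2 \<le> u x"
  shows "g \<in> L2 M"
proof -
  have "integrable M (\<lambda>x. (cmod (g x))\<^sup>2)"
    using assms(1) by (intro Bochner_Integration.integrable_bound[OF assms(2)])
      (auto intro!: AE_I2 order_trans[OF assms(3)])
  then show ?thesis using assms(1) by (simp add: L2_def)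
qed

lemma L2_zero: "(\<lambda>x. 0) \<in> L2 M"
  by (simp add: L2_def)

lemma L2_cmult:
  assumes "f \<in> L2 M"
  shows "(\<lambda>x. c * f x) \<in> L2 M"
  using assms unfolding L2_def by (auto simp: norm_mult power_mult_distrib)

lemma L2_add:
  assumes f: "f \<in> L2 M" and g: "g \<in> L2 M"
  shows "(\<lambda>x. f x + g x) \<in> L2 M"
proof (rule L2_comparison)
  show "integrable M (\<lambda>x. 2 * (cmod (f x))\<^sup>2 + 2 * (cmod (g x))\<^sup>2)"
    using f g by (simp add: L2_def)
  show "(cmod (f x + g x))\<^sup>2 \<le> 2 * (cmod (f x))\<^sup>2 + 2 * (cmod (g x))\<^sup>2" for x
  proof -
    have "(cmod (f x + g x))\<^sup>2 \<le> (cmod (f x) + cmod (g x))\<^sup>2"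
      by (simp add: norm_triangle_ineq power_mono)
    also have "\<dots> \<le> 2 * (cmod (f x))\<^sup>2 + 2 * (cmod (g x))\<^sup>2"
      using sum_squares_bound[of "cmod (f x)" "cmod (g x)"] by (simp add: power2_sum)
    finally show ?thesis .
  qed
qed (use f g in \<open>auto dest!: L2_measurable\<close>)

lemma L2_diff:
  assumes f: "f \<in> L2 M" and g: "g \<in> L2 M"
  shows "(\<lambda>x. f x - g x) \<in> L2 M"
  using L2_add[OF f L2_cmult[OF g, of "-1"]] by simp

lemma L2_finite_sum:
  assumes "\<And>i. i \<in> X \<Longrightarrow> F i \<in> L2 M"
  shows "(\<lambda>x. \<Sum>i\<in>X. F i x) \<in> L2 M"
  using assms by (induction X rule: infinite_finite_induct) (auto intro: L2_add L2_zero)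

lemma L2_lincomb:
  assumes "\<And>i. i \<in> X \<Longrightarrow> F i \<in> L2 M"
  shows "(\<lambda>x. \<Sum>i\<in>X. c i * F i x) \<in> L2 M"
  by (intro L2_finite_sum L2_cmult assms)

lemma L2_cong_AE:
  assumes "f \<in> L2 M" "g \<in> borel_measurable M" "AE x in M. f x = g x"
  shows "g \<in> L2 M"
proof -
  have "integrable M (\<lambda>x. (cmod (g x))\<^sup>2)"
    using assms(3)
    by (intro integrable_cong_AE_imp[OF L2_integrable[OF assms(1)]])
       (use assms(2) in auto)
  then show ?thesis using assms(2) by (simp add: L2_def)
qed

lemma integrable_L2_mult:
  assumes f: "f \<in> L2 M" and g: "g \<in> L2 M"
  shows "integrable M (\<lambda>x. f x * cnj (g x))"
proof (rule Bochner_Integration.integrable_bound)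
  show "integrable M (\<lambda>x. (cmod (f x))\<^sup>2 + (cmod (g x))\<^sup>2)"
    using f g by (simp add: L2_def)
  have "cmod (f x * cnj (g x)) \<le> (cmod (f x))\<^sup>2 + (cmod (g x))\<^sup>2" for x
  proof -
    have "2 * (cmod (f x) * cmod (g x)) \<le> (cmod (f x))\<^sup>2 + (cmod (g x))\<^sup>2"
      using sum_squares_bound[of "cmod (f x)" "cmod (g x)"] by simp
    moreover have "0 \<le> cmod (f x) * cmod (g x)" by simp
    ultimately show ?thesis unfolding norm_mult complex_mod_cnj by linarith
  qed
  then show "AE x in M. cmod (f x * cnj (g x)) \<le> norm ((cmod (f x))\<^sup>2 + (cmod (g x))\<^sup>2)"
    by (intro AE_I2) (auto intro: order_trans)
  have [measurable]: "f \<in> borel_measurable M" "g \<in> borel_measurable M"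
    using f g by (auto dest: L2_measurable)
  show "(\<lambda>x. f x * cnj (g x)) \<in> borel_measurable M"
    by (intro borel_measurable_times) (auto intro!: borel_measurable_continuous_on[of cnj] continuous_intros)
qed

lemma L2_norm_nonneg: "0 \<le> L2_norm M f"
  by (simp add: L2_norm_def)

lemma L2_norm_power2: "(L2_norm M f)\<^sup>2 = (LINT x|M. (cmod (f x))\<^sup>2)"
  by (simp add: L2_norm_def)

lemma L2_inner_self: "L2_inner M f f = of_real ((L2_norm M f)\<^sup>2)"
  unfolding L2_inner_def L2_norm_power2 complex_norm_square[symmetric] by (rule integral_complex_of_real)

lemma L2_inner_commute: "L2_inner M g f = cnj (L2_inner M f g)"
proof -
  have "cnj (L2_inner M f g) = (LINT x|M. cnj (f x * cnj (g x)))"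
    unfolding L2_inner_def by (rule Bochner_Integration.integral_cnj[symmetric])
  then show ?thesis unfolding L2_inner_def by (simp add: mult.commute)
qed

lemma L2_norm_cmult: "L2_norm M (\<lambda>x. c * f x) = cmod c * L2_norm M f"
  by (simp add: L2_norm_def norm_mult power_mult_distrib real_sqrt_mult)

lemma L2_norm_minus_commute: "L2_norm M (\<lambda>x. f x - g x) = L2_norm M (\<lambda>x. g x - f x)"
  by (simp add: L2_norm_def norm_minus_commute)

lemma L2_inner_add_left:
  assumes "f \<in> L2 M" "g \<in> L2 M" "u \<in> L2 M"
  shows "L2_inner M (\<lambda>x. f x + g x) u = L2_inner M f u + L2_inner M g u"
  unfolding L2_inner_def
  using integrable_L2_mult[OF assms(1,3)] integrable_L2_mult[OF assms(2,3)]
  by (simp add: distrib_right)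

lemma L2_inner_cmult_left: "L2_inner M (\<lambda>x. c * f x) u = c * L2_inner M f u"
  unfolding L2_inner_def by (simp add: mult.assoc)

lemma L2_inner_cmult_right: "L2_inner M f (\<lambda>x. c * u x) = cnj c * L2_inner M f u"
  by (subst (1 2) L2_inner_commute) (simp add: L2_inner_cmult_left)

lemma L2_inner_add_right:
  assumes "f \<in> L2 M" "g \<in> L2 M" "u \<in> L2 M"
  shows "L2_inner M u (\<lambda>x. f x + g x) = L2_inner M u f + L2_inner M u g"
  by (subst (1 2 3) L2_inner_commute) (simp add: L2_inner_add_left assms)

lemma L2_inner_diff_left:
  assumes "f \<in> L2 M" "g \<in> L2 M" "u \<in> L2 M"
  shows "L2_inner M (\<lambda>x. f x - g x) u = L2_inner M f u - L2_inner M g u"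
  using L2_inner_add_left[OF assms(1) L2_cmult[OF assms(2), of "-1"] assms(3)]
    L2_inner_cmult_left[of M "-1" g u] by simp

lemma L2_inner_diff_right:
  assumes "f \<in> L2 M" "g \<in> L2 M" "u \<in> L2 M"
  shows "L2_inner M u (\<lambda>x. f x - g x) = L2_inner M u f - L2_inner M u g"
  by (subst (1 2 3) L2_inner_commute) (simp add: L2_inner_diff_left assms)

lemma L2_inner_sum_right:
  assumes "u \<in> L2 M" "\<And>i. i \<in> X \<Longrightarrow> F i \<in> L2 M"
  shows "L2_inner M u (\<lambda>x. \<Sum>i\<in>X. F i x) = (\<Sum>i\<in>X. L2_inner M u (F i))"
  using assms(2)
proof (induction X rule: infinite_finite_induct)
  case (insert i X)
  have "L2_inner M u (\<lambda>x. \<Sum>i\<in>insert i X. F i x) = L2_inner M u (\<lambda>x. F i x + (\<Sum>i\<in>X. F i x))"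
    using insert by simp
  also have "\<dots> = L2_inner M u (F i) + L2_inner M u (\<lambda>x. \<Sum>i\<in>X. F i x)"
    using insert by (intro L2_inner_add_right assms(1) L2_finite_sum) auto
  finally show ?case using insert by simp
qed (auto simp: L2_inner_def)

lemma L2_inner_sum_left:
  assumes "u \<in> L2 M" "\<And>i. i \<in> X \<Longrightarrow> F i \<in> L2 M"
  shows "L2_inner M (\<lambda>x. \<Sum>i\<in>X. F i x) u = (\<Sum>i\<in>X. L2_inner M (F i) u)"
  by (subst (1 2) L2_inner_commute) (simp add: L2_inner_sum_right assms)

text \<open>The pointwise inequality \<open>2 |f g| \<le> t |f|^2 + |g|^2 / t\<close> is integrated,
  and the weight \<open>t\<close> is taken close to its optimum \<open>q / p\<close>. Either
  seminorm may vanish, so both are first enlarged by a small \<open>d\<close>.\<close>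

lemma L2_Cauchy_Schwarz:
  assumes f: "f \<in> L2 M" and g: "g \<in> L2 M"
  shows "cmod (L2_inner M f g) \<le> L2_norm M f * L2_norm M g"
proof -
  define p q where "p = L2_norm M f" and "q = L2_norm M g"
  have pq: "p \<ge> 0" "q \<ge> 0" by (auto simp: p_def q_def L2_norm_nonneg)
  have *: "cmod (L2_inner M f g) \<le> (t * p\<^sup>2 + q\<^sup>2 / t) / 2" if t: "t > 0" for t
  proof -
    have "cmod (L2_inner M f g) \<le> (LINT x|M. cmod (f x * cnj (g x)))"
      unfolding L2_inner_def by (rule integral_norm_bound)
    also have "\<dots> \<le> (LINT x|M. (t * (cmod (f x))\<^sup>2 + (cmod (g x))\<^sup>2 / t) / 2)"
    proof (rule integral_mono)
      show "integrable M (\<lambda>x. cmod (f x * cnj (g x)))"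
        using integrable_L2_mult[OF f g] by (rule integrable_norm)
      show "integrable M (\<lambda>x. (t * (cmod (f x))\<^sup>2 + (cmod (g x))\<^sup>2 / t) / 2)"
        using f g by (simp add: L2_def)
      fix x
      have "0 \<le> (t * cmod (f x) - cmod (g x))\<^sup>2 / t" using t by simp
      also have "\<dots> = t * (cmod (f x))\<^sup>2 + (cmod (g x))\<^sup>2 / t - 2 * (cmod (f x) * cmod (g x))"
        using t by (simp add: power2_eq_square field_simps)
      finally show "cmod (f x * cnj (g x)) \<le> (t * (cmod (f x))\<^sup>2 + (cmod (g x))\<^sup>2 / t) / 2"
        by (simp add: norm_mult)
    qed
    also have "\<dots> = (t * p\<^sup>2 + q\<^sup>2 / t) / 2"
      using f g by (simp add: L2_def p_def q_def L2_norm_power2)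
    finally show ?thesis .
  qed
  have "cmod (L2_inner M f g) \<le> p * q + e" if e: "e > 0" for e
  proof -
    \<comment> \<open>The weight \<open>(q + d) / (p + d)\<close> costs an excess of
      \<open>d * (p + q) / 2\<close>, which this \<open>d\<close> keeps below
      \<open>e\<close>.\<close>
    define d where "d = e / (p + q + 1)"
    have d: "d > 0" using e pq by (simp add: d_def)
    have "(t * p\<^sup>2 + q\<^sup>2 / t) / 2 \<le> ((q + d) * p + q * (p + d)) / 2" if "t = (q + d) / (p + d)" for t
    proof -
      have "t * p\<^sup>2 = ((q + d) * p) * (p / (p + d))" by (simp add: that power2_eq_square)
      also have "\<dots> \<le> ((q + d) * p) * 1"
        using pq d by (intro mult_left_mono) auto
      finally have 1: "t * p\<^sup>2 \<le> (q + d) * p" by simp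
      have "q\<^sup>2 / t = (q * (p + d)) * (q / (q + d))" by (simp add: that power2_eq_square)
      also have "\<dots> \<le> (q * (p + d)) * 1"
        using pq d by (intro mult_left_mono) auto
      finally have 2: "q\<^sup>2 / t \<le> q * (p + d)" by simp
      show ?thesis using add_mono[OF 1 2] by (rule divide_right_mono) simp
    qed
    then have "cmod (L2_inner M f g) \<le> ((q + d) * p + q * (p + d)) / 2"
      using *[of "(q + d) / (p + d)"] pq d by (smt (verit) divide_pos_pos)
    also have "\<dots> = p * q + d * (p + q) / 2" by (simp add: field_simps)
    also have "d * (p + q) / 2 \<le> d * (p + q + 1)" using d pq by (simp add: field_simps)
    also have "d * (p + q + 1) = e" using pq by (simp add: d_def)
    finally show ?thesis by simp
  qed
  then show ?thesis unfolding p_def q_def by (rule field_le_epsilon)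
qed

lemma L2_norm_triangle:
  assumes f: "f \<in> L2 M" and g: "g \<in> L2 M"
  shows "L2_norm M (\<lambda>x. f x + g x) \<le> L2_norm M f + L2_norm M g"
proof -
  have "complex_of_real ((L2_norm M (\<lambda>x. f x + g x))\<^sup>2)
      = L2_inner M f f + L2_inner M f g + (L2_inner M g f + L2_inner M g g)"
    by (simp only: L2_inner_self[symmetric])
       (simp add: L2_inner_add_left L2_inner_add_right L2_add f g)
  then have "(L2_norm M (\<lambda>x. f x + g x))\<^sup>2 = Re (L2_inner M f f + L2_inner M f g + (L2_inner M g f + L2_inner M g g))"
    by (metis Re_complex_of_real)
  also have "\<dots> = (L2_norm M f)\<^sup>2 + (L2_norm M g)\<^sup>2 + 2 * Re (L2_inner M f g)"
    by (simp add: L2_inner_self L2_inner_commute[of M g f] del: of_real_power)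
  also have "\<dots> \<le> (L2_norm M f)\<^sup>2 + (L2_norm M g)\<^sup>2 + 2 * (L2_norm M f * L2_norm M g)"
    using complex_Re_le_cmod[of "L2_inner M f g"] L2_Cauchy_Schwarz[OF f g] by linarith
  also have "\<dots> = (L2_norm M f + L2_norm M g)\<^sup>2" by (simp add: power2_sum)
  finally show ?thesis
    by (rule power2_le_imp_le) (simp add: L2_norm_nonneg)
qed

lemma L2_norm_triangle_diff:
  assumes "f \<in> L2 M" "g \<in> L2 M" "u \<in> L2 M"
  shows "L2_norm M (\<lambda>x. f x - u x) \<le> L2_norm M (\<lambda>x. f x - g x) + L2_norm M (\<lambda>x. g x - u x)"
  using L2_norm_triangle[OF L2_diff[OF assms(1,2)] L2_diff[OF assms(2,3)]] by simp

lemma L2_norm_triangle_sub: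
  assumes "f \<in> L2 M" "g \<in> L2 M"
  shows "L2_norm M f \<le> L2_norm M g + L2_norm M (\<lambda>x. f x - g x)"
  using L2_norm_triangle[OF assms(2) L2_diff[OF assms]] by simp

lemma L2_norm_cong_AE:
  assumes "f \<in> borel_measurable M" "g \<in> borel_measurable M" "AE x in M. f x = g x"
  shows "L2_norm M f = L2_norm M g"
  unfolding L2_norm_def using assms by (auto intro!: integral_cong_AE arg_cong[where f = sqrt])

text \<open>The Riesz-Fischer argument for a fast Cauchy sequence. The rate \<open>(1/4) ^ n\<close>
  makes \<open>2 ^ n |D n|^2\<close> summable in the mean, hence summable almost everywhere, and
  \<open>|D n| \<le> (1/2) ^ n + 2 ^ n |D n|^2\<close> turns this into pointwise convergence.
  Fatou's lemma then carries the uniform tail estimate over to the pointwise limit.\<close>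

lemma L2_complete:
  assumes G: "\<And>n. G n \<in> L2 M"
    and small: "\<And>n. L2_norm M (\<lambda>x. G (Suc n) x - G n x) \<le> (1/4) ^ n"
  shows "\<exists>g\<in>L2 M. (\<lambda>n. L2_norm M (\<lambda>x. g x - G n x)) \<longlonglongrightarrow> 0"
proof -
  define D where "D n x = G (Suc n) x - G n x" for n x
  have [measurable]: "G n \<in> borel_measurable M" for n using G by (rule L2_measurable)
  have D: "D n \<in> L2 M" for n unfolding D_def by (intro L2_diff G)
  have [measurable]: "D n \<in> borel_measurable M" for n using D by (rule L2_measurable)
  have nnD: "(\<integral>\<^sup>+x. ennreal ((cmod (F x))\<^sup>2) \<partial>M) = ennreal ((L2_norm M F)\<^sup>2)" if "F \<in> L2 M" for F
    unfolding L2_norm_power2 using that by (intro nn_integral_eq_integral L2_integrable) auto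
  have "(\<integral>\<^sup>+x. (\<Sum>n. ennreal (2^n * (cmod (D n x))\<^sup>2)) \<partial>M)
      = (\<Sum>n. (\<integral>\<^sup>+x. ennreal (2^n * (cmod (D n x))\<^sup>2) \<partial>M))"
    by (rule nn_integral_suminf) measurable
  also have "\<dots> = (\<Sum>n. ennreal (2^n * (L2_norm M (D n))\<^sup>2))"
    by (simp add: ennreal_mult nn_integral_cmult nnD[OF D] cong: suminf_cong)
  also have "\<dots> \<le> (\<Sum>n. ennreal ((1/2)^n))"
  proof (intro suminf_le ennreal_leI)
    fix n
    have "(L2_norm M (D n))\<^sup>2 \<le> ((1/4)^n)\<^sup>2"
      using small[of n] unfolding D_def by (intro power_mono L2_norm_nonneg)
    then have "2^n * (L2_norm M (D n))\<^sup>2 \<le> 2^n * ((1/4)^n)\<^sup>2"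
      by (intro mult_left_mono) auto
    also have "\<dots> = (2 * (1/16)) ^ n"
      by (simp add: power_mult_distrib[symmetric] power2_eq_square flip: power_mult)
    also have "\<dots> \<le> (1/2)^n" by (intro power_mono) auto
    finally show "2^n * (L2_norm M (D n))\<^sup>2 \<le> (1/2)^n" .
  qed auto
  also have "\<dots> < \<infinity>"
  proof -
    have "(\<lambda>n. (1/2)^n :: real) sums 2" using geometric_sums[of "1/2::real"] by simp
    then have "(\<Sum>n. ennreal ((1/2)^n)) = ennreal 2" by (intro suminf_ennreal_eq) auto
    then show ?thesis by simp
  qed
  finally have "AE x in M. (\<Sum>n. ennreal (2^n * (cmod (D n x))\<^sup>2)) \<noteq> \<infinity>"
    by (intro nn_integral_noteq_infinite) auto
  then have AEconv: "AE x in M. convergent (\<lambda>n. G n x)"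
  proof eventually_elim
    case (elim x)
    then have s: "summable (\<lambda>n. 2^n * (cmod (D n x))\<^sup>2)"
      by (intro summable_suminf_not_top) auto
    have "summable (\<lambda>n. D n x)"
    proof (rule summable_comparison_test'[of "\<lambda>n. (1/2)^n + 2^n * (cmod (D n x))\<^sup>2" 0])
      show "summable (\<lambda>n. (1/2)^n + 2^n * (cmod (D n x))\<^sup>2)"
        using s by (intro summable_add summable_geometric) auto
      fix n
      have "cmod (D n x) \<le> (1/2)^n + 2^n * (cmod (D n x))\<^sup>2"
      proof -
        have "0 \<le> (1 - 2^n * cmod (D n x))\<^sup>2 / 2^n" by simp
        also have "\<dots> = (1/2)^n + 2^n * (cmod (D n x))\<^sup>2 - 2 * cmod (D n x)"
          by (simp add: power2_eq_square field_simps)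
        finally show ?thesis using norm_ge_zero[of "D n x"] by linarith
      qed
      then show "norm (D n x) \<le> (1/2)^n + 2^n * (cmod (D n x))\<^sup>2" .
    qed
    then have "convergent (\<lambda>n. \<Sum>i<n. D i x)" by (simp add: summable_iff_convergent)
    moreover have "(\<Sum>i<n. D i x) = G n x - G 0 x" for n
      unfolding D_def by (rule sum_lessThan_telescope)
    ultimately have "convergent (\<lambda>n. (G n x - G 0 x) + G 0 x)"
      by (intro convergent_add convergent_const) simp
    then show ?case by simp
  qed
  define g where "g x = lim (\<lambda>n. G n x)" for x
  have [measurable]: "g \<in> borel_measurable M" unfolding g_def by measurable
  have lim: "AE x in M. (\<lambda>n. G n x) \<longlonglongrightarrow> g x"
    using AEconv by eventually_elim (simp add: g_def convergent_LIMSEQ_iff)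
  have tail: "L2_norm M (\<lambda>x. G (n + m) x - G n x) \<le> 2 * (1/4)^n" for n m
  proof -
    have "L2_norm M (\<lambda>x. G (n + m) x - G n x) \<le> (\<Sum>i<m. (1/4)^(n+i))"
    proof (induction m)
      case 0
      then show ?case by (simp add: L2_norm_def)
    next
      case (Suc m)
      have "L2_norm M (\<lambda>x. G (n + Suc m) x - G n x)
          \<le> L2_norm M (\<lambda>x. G (Suc (n + m)) x - G (n + m) x) + L2_norm M (\<lambda>x. G (n + m) x - G n x)"
        using L2_norm_triangle_diff[OF G G G, of "Suc (n + m)" n "n + m"] by simp
      with Suc small[of "n + m"] show ?case by simp
    qed
    also have "\<dots> = (1/4)^n * (\<Sum>i<m. (1/4)^i)" by (simp add: power_add sum_distrib_left)
    also have "\<dots> \<le> (1/4)^n * 2"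
    proof (rule mult_left_mono)
      have "(\<Sum>i<m. (1/4::real)^i) = (1 - (1/4)^m) * (4/3)"
        using geometric_sum[of "1/4::real" m] by (simp add: field_simps)
      also have "\<dots> \<le> 1 * (4/3)" by (intro mult_right_mono) auto
      finally show "(\<Sum>i<m. (1/4::real)^i) \<le> 2" by simp
    qed simp
    finally show ?thesis by simp
  qed
  have bound: "(\<integral>\<^sup>+x. ennreal ((cmod (g x - G n x))\<^sup>2) \<partial>M) \<le> ennreal ((2 * (1/4)^n)\<^sup>2)" for n
  proof -
    have "(\<integral>\<^sup>+x. ennreal ((cmod (g x - G n x))\<^sup>2) \<partial>M)
        = (\<integral>\<^sup>+x. liminf (\<lambda>m. ennreal ((cmod (G (n + m) x - G n x))\<^sup>2)) \<partial>M)"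
    proof (rule nn_integral_cong_AE, use lim in eventually_elim)
      case (elim x)
      have "(\<lambda>m. G (n + m) x) \<longlonglongrightarrow> g x"
        using LIMSEQ_ignore_initial_segment[OF elim, of n] by (simp add: add.commute)
      then have "(\<lambda>m. ennreal ((cmod (G (n + m) x - G n x))\<^sup>2)) \<longlonglongrightarrow> ennreal ((cmod (g x - G n x))\<^sup>2)"
        by (intro tendsto_intros)
      then show ?case by (rule lim_imp_Liminf[OF sequentially_bot, symmetric])
    qed
    also have "\<dots> \<le> liminf (\<lambda>m. \<integral>\<^sup>+x. ennreal ((cmod (G (n + m) x - G n x))\<^sup>2) \<partial>M)"
      by (rule nn_integral_liminf) measurable
    also have "\<dots> \<le> ennreal ((2 * (1/4)^n)\<^sup>2)"
    proof (rule order_trans[OF Liminf_mono])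
      show "\<forall>\<^sub>F m in sequentially. (\<integral>\<^sup>+x. ennreal ((cmod (G (n + m) x - G n x))\<^sup>2) \<partial>M) \<le> ennreal ((2 * (1/4)^n)\<^sup>2)"
      proof (intro always_eventually allI)
        fix m
        show "(\<integral>\<^sup>+x. ennreal ((cmod (G (n + m) x - G n x))\<^sup>2) \<partial>M) \<le> ennreal ((2 * (1/4)^n)\<^sup>2)"
          unfolding nnD[OF L2_diff[OF G G]] by (intro ennreal_leI power_mono tail L2_norm_nonneg)
      qed
    qed (simp add: Liminf_const)
    finally show ?thesis .
  qed
  have diffL2: "(\<lambda>x. g x - G n x) \<in> L2 M" for n
  proof -
    have "(\<integral>\<^sup>+x. ennreal ((cmod (g x - G n x))\<^sup>2) \<partial>M) < \<infinity>"
      using bound[of n] by (rule le_less_trans) simp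
    then have "integrable M (\<lambda>x. (cmod (g x - G n x))\<^sup>2)"
      by (intro integrableI_nonneg) auto
    then show ?thesis by (simp add: L2_def)
  qed
  have "g \<in> L2 M" using L2_add[OF diffL2[of 0] G[of 0]] by simp
  moreover have "(\<lambda>n. L2_norm M (\<lambda>x. g x - G n x)) \<longlonglongrightarrow> 0"
  proof (rule tendsto_sandwich)
    show "\<forall>\<^sub>F n in sequentially. 0 \<le> L2_norm M (\<lambda>x. g x - G n x)"
      by (simp add: L2_norm_nonneg)
    show "\<forall>\<^sub>F n in sequentially. L2_norm M (\<lambda>x. g x - G n x) \<le> 2 * (1/4)^n"
    proof (intro always_eventually allI)
      fix n
      have "(L2_norm M (\<lambda>x. g x - G n x))\<^sup>2 \<le> (2 * (1/4)^n)\<^sup>2"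
        using bound[of n] nnD[OF diffL2[of n]] by (simp del: power_mult_distrib)
      then show "L2_norm M (\<lambda>x. g x - G n x) \<le> 2 * (1/4)^n"
        by (rule power2_le_imp_le) simp
    qed
    show "(\<lambda>n. 2 * (1/4)^n :: real) \<longlonglongrightarrow> 0"
      by (intro tendsto_mult_right_zero LIMSEQ_power_zero) simp
    show "(\<lambda>_. 0 :: real) \<longlonglongrightarrow> 0" by simp
  qed
  ultimately show ?thesis by blast
qed

subsection \<open>Series in \<open>L\<^sup>2\<close> and Bessel systems\<close>

lemma has_L2_sum_summand: "has_L2_sum M F I g \<Longrightarrow> i \<in> I \<Longrightarrow> F i \<in> L2 M"
  by (simp add: has_L2_sum_def)

lemma has_L2_sum_in_L2: "has_L2_sum M F I g \<Longrightarrow> g \<in> L2 M"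
  by (simp add: has_L2_sum_def)

lemma has_L2_sum_tendsto:
  "has_L2_sum M F I g \<Longrightarrow>
    ((\<lambda>X. L2_norm M (\<lambda>x. g x - (\<Sum>i\<in>X. F i x))) \<longlongrightarrow> 0) (finite_subsets_at_top I)"
  by (simp add: has_L2_sum_def)

lemma has_L2_sum_inner_right:
  assumes "has_L2_sum M F I g" "h \<in> L2 M"
  shows "((\<lambda>i. L2_inner M h (F i)) has_sum L2_inner M h g) I"
proof -
  have "((\<lambda>X. (\<Sum>i\<in>X. L2_inner M h (F i)) - L2_inner M h g) \<longlongrightarrow> 0) (finite_subsets_at_top I)"
  proof (rule Lim_null_comparison)
    show "((\<lambda>X. L2_norm M h * L2_norm M (\<lambda>x. g x - (\<Sum>i\<in>X. F i x))) \<longlongrightarrow> 0) (finite_subsets_at_top I)"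
      by (intro tendsto_mult_right_zero has_L2_sum_tendsto assms)
    show "\<forall>\<^sub>F X in finite_subsets_at_top I. norm ((\<Sum>i\<in>X. L2_inner M h (F i)) - L2_inner M h g)
        \<le> L2_norm M h * L2_norm M (\<lambda>x. g x - (\<Sum>i\<in>X. F i x))"
    proof (rule eventually_finite_subsets_at_top_weakI)
      fix X assume X: "finite X" "X \<subseteq> I"
      then have F: "F i \<in> L2 M" if "i \<in> X" for i
        using that assms(1) by (auto intro: has_L2_sum_summand)
      have "L2_inner M h g - (\<Sum>i\<in>X. L2_inner M h (F i)) = L2_inner M h (\<lambda>x. g x - (\<Sum>i\<in>X. F i x))"
        using F assms by (simp add: L2_inner_diff_right L2_inner_sum_right L2_finite_sum has_L2_sum_in_L2)
      then show "norm ((\<Sum>i\<in>X. L2_inner M h (F i)) - L2_inner M h g)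
        \<le> L2_norm M h * L2_norm M (\<lambda>x. g x - (\<Sum>i\<in>X. F i x))"
        using L2_Cauchy_Schwarz[OF assms(2) L2_diff[OF has_L2_sum_in_L2[OF assms(1)] L2_finite_sum[OF F]]]
        by (subst norm_minus_commute) simp
    qed
  qed
  then show ?thesis unfolding has_sum_def using LIM_zero_cancel by blast
qed

lemma has_L2_sum_inner_left:
  assumes "has_L2_sum M F I g" "h \<in> L2 M"
  shows "((\<lambda>i. L2_inner M (F i) h) has_sum L2_inner M g h) I"
  using has_L2_sum_inner_right[OF assms]
  by (subst (1 2) L2_inner_commute) simp

lemma has_L2_sum_cong_AE:
  assumes "has_L2_sum M F I g" "g' \<in> borel_measurable M" "AE x in M. g x = g' x"
  shows "has_L2_sum M F I g'"
proof -
  have g: "g \<in> L2 M" by (rule has_L2_sum_in_L2[OF assms(1)])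
  have g': "g' \<in> L2 M" by (rule L2_cong_AE[OF g assms(2,3)])
  have "\<forall>\<^sub>F X in finite_subsets_at_top I.
      L2_norm M (\<lambda>x. g x - (\<Sum>i\<in>X. F i x)) = L2_norm M (\<lambda>x. g' x - (\<Sum>i\<in>X. F i x))"
  proof (rule eventually_finite_subsets_at_top_weakI)
    fix X assume X: "finite X" "X \<subseteq> I"
    then have F: "(\<lambda>x. \<Sum>i\<in>X. F i x) \<in> L2 M"
      using assms(1) by (auto intro!: L2_finite_sum has_L2_sum_summand)
    show "L2_norm M (\<lambda>x. g x - (\<Sum>i\<in>X. F i x)) = L2_norm M (\<lambda>x. g' x - (\<Sum>i\<in>X. F i x))"
      using assms(3) by (intro L2_norm_cong_AE L2_measurable L2_diff g g' F) auto
  qed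
  then show ?thesis
    using assms(1) g' unfolding has_L2_sum_def by (simp add: tendsto_cong)
qed

lemma has_L2_sum_cmult:
  assumes "has_L2_sum M F I g"
  shows "has_L2_sum M (\<lambda>i x. c * F i x) I (\<lambda>x. c * g x)"
proof -
  have "L2_norm M (\<lambda>x. c * g x - (\<Sum>i\<in>X. c * F i x)) = cmod c * L2_norm M (\<lambda>x. g x - (\<Sum>i\<in>X. F i x))" for X
    by (subst L2_norm_cmult[symmetric]) (simp add: sum_distrib_left right_diff_distrib)
  then show ?thesis using assms unfolding has_L2_sum_def
    by (auto intro!: L2_cmult tendsto_mult_right_zero)
qed

lemma has_L2_sum_add:
  assumes "has_L2_sum M F I f" "has_L2_sum M G I g"
  shows "has_L2_sum M (\<lambda>i x. F i x + G i x) I (\<lambda>x. f x + g x)"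
  unfolding has_L2_sum_def
proof (intro conjI ballI)
  show "((\<lambda>X. L2_norm M (\<lambda>x. f x + g x - (\<Sum>i\<in>X. F i x + G i x))) \<longlongrightarrow> 0) (finite_subsets_at_top I)"
  proof (rule Lim_null_comparison)
    show "((\<lambda>X. L2_norm M (\<lambda>x. f x - (\<Sum>i\<in>X. F i x)) + L2_norm M (\<lambda>x. g x - (\<Sum>i\<in>X. G i x))) \<longlongrightarrow> 0)
        (finite_subsets_at_top I)"
      by (intro tendsto_add_zero has_L2_sum_tendsto assms)
    show "\<forall>\<^sub>F X in finite_subsets_at_top I. norm (L2_norm M (\<lambda>x. f x + g x - (\<Sum>i\<in>X. F i x + G i x)))
        \<le> L2_norm M (\<lambda>x. f x - (\<Sum>i\<in>X. F i x)) + L2_norm M (\<lambda>x. g x - (\<Sum>i\<in>X. G i x))"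
    proof (rule eventually_finite_subsets_at_top_weakI)
      fix X assume X: "finite X" "X \<subseteq> I"
      have "L2_norm M (\<lambda>x. (f x - (\<Sum>i\<in>X. F i x)) + (g x - (\<Sum>i\<in>X. G i x)))
        \<le> L2_norm M (\<lambda>x. f x - (\<Sum>i\<in>X. F i x)) + L2_norm M (\<lambda>x. g x - (\<Sum>i\<in>X. G i x))"
        using X assms by (intro L2_norm_triangle L2_diff L2_finite_sum)
          (auto simp: has_L2_sum_def)
      then show "norm (L2_norm M (\<lambda>x. f x + g x - (\<Sum>i\<in>X. F i x + G i x)))
        \<le> L2_norm M (\<lambda>x. f x - (\<Sum>i\<in>X. F i x)) + L2_norm M (\<lambda>x. g x - (\<Sum>i\<in>X. G i x))"
        by (simp add: sum.distrib L2_norm_nonneg algebra_simps)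
    qed
  qed
qed (use assms in \<open>auto simp: has_L2_sum_def intro: L2_add\<close>)

lemma has_L2_sum_finite_sum:
  assumes "finite S" "\<And>s. s \<in> S \<Longrightarrow> has_L2_sum M (F s) I (g s)"
  shows "has_L2_sum M (\<lambda>i x. \<Sum>s\<in>S. F s i x) I (\<lambda>x. \<Sum>s\<in>S. g s x)"
  using assms
proof (induction S)
  case empty
  show ?case by (simp add: has_L2_sum_def L2_zero) (simp add: L2_norm_def)
next
  case (insert s S)
  then show ?case using has_L2_sum_add[of M "F s" I "g s"] by simp
qed

lemma has_L2_sum_reindex:
  assumes "has_L2_sum M F I g" "bij_betw b J I"
  shows "has_L2_sum M (\<lambda>j. F (b j)) J g"
proof -
  have inj: "inj_on b J" and im: "b ` J = I" using assms(2) by (auto simp: bij_betw_def)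
  have "((\<lambda>X. L2_norm M (\<lambda>x. g x - (\<Sum>i\<in>b ` X. F i x))) \<longlongrightarrow> 0) (finite_subsets_at_top J)"
    using has_L2_sum_tendsto[OF assms(1)]
      filterlim_filtermap[of "\<lambda>X. L2_norm M (\<lambda>x. g x - (\<Sum>i\<in>X. F i x))" "nhds 0" "(`) b" "finite_subsets_at_top J"]
    unfolding filtermap_image_finite_subsets_at_top[OF inj] im by blast
  then have "((\<lambda>X. L2_norm M (\<lambda>x. g x - (\<Sum>j\<in>X. F (b j) x))) \<longlongrightarrow> 0) (finite_subsets_at_top J)"
  proof (rule Lim_transform_eventually)
    show "\<forall>\<^sub>F X in finite_subsets_at_top J. L2_norm M (\<lambda>x. g x - (\<Sum>i\<in>b ` X. F i x))
        = L2_norm M (\<lambda>x. g x - (\<Sum>j\<in>X. F (b j) x))"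
      by (rule eventually_finite_subsets_at_top_weakI)
         (use inj in \<open>simp add: sum.reindex inj_on_subset\<close>)
  qed
  then show ?thesis using assms im unfolding has_L2_sum_def by auto
qed

text \<open>Expanding one factor of \<open><G, G>\<close> and applying Cauchy-Schwarz gives
  \<open>N \<le> sqrt S * sqrt (C * N)\<close>, from which \<open>N\<close> can be cancelled. The
  analysis bound is required for the one function \<open>G\<close> only, so knowledge on the span of
  the system is enough.\<close>

lemma synthesis_bound:
  assumes "finite X" "\<And>i. i \<in> X \<Longrightarrow> u i \<in> L2 M" "0 \<le> C"
    and G: "G = (\<lambda>x. \<Sum>i\<in>X. c i * u i x)"
    and bound: "(\<Sum>i\<in>X. (cmod (L2_inner M G (u i)))\<^sup>2) \<le> C * (L2_norm M G)\<^sup>2"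
  shows "(L2_norm M G)\<^sup>2 \<le> C * (\<Sum>i\<in>X. (cmod (c i))\<^sup>2)"
proof -
  have GL: "G \<in> L2 M" unfolding G using assms(2) by (rule L2_lincomb)
  define N where "N = (L2_norm M G)\<^sup>2"
  define S where "S = (\<Sum>i\<in>X. (cmod (c i))\<^sup>2)"
  have "complex_of_real N = L2_inner M G G" by (simp add: N_def L2_inner_self)
  also have "\<dots> = (\<Sum>i\<in>X. L2_inner M G (\<lambda>x. c i * u i x))"
    by (subst (2) G) (intro L2_inner_sum_right GL L2_cmult assms(2))
  also have "\<dots> = (\<Sum>i\<in>X. cnj (c i) * L2_inner M G (u i))"
    by (simp add: L2_inner_cmult_right)
  finally have "N = cmod (\<Sum>i\<in>X. cnj (c i) * L2_inner M G (u i))"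
    by (metis N_def norm_of_real abs_of_nonneg zero_le_power2)
  also have "\<dots> \<le> (\<Sum>i\<in>X. cmod (c i) * cmod (L2_inner M G (u i)))"
    by (rule order_trans[OF norm_sum]) (simp add: norm_mult)
  finally have "N \<le> (\<Sum>i\<in>X. cmod (c i) * cmod (L2_inner M G (u i)))" .
  then have "N\<^sup>2 \<le> (\<Sum>i\<in>X. cmod (c i) * cmod (L2_inner M G (u i)))\<^sup>2"
    by (rule power_mono) (simp add: N_def)
  also have "\<dots> \<le> S * (\<Sum>i\<in>X. (cmod (L2_inner M G (u i)))\<^sup>2)"
    unfolding S_def by (rule Cauchy_Schwarz_ineq_sum)
  also have "\<dots> \<le> S * (C * N)"
    unfolding N_def by (intro mult_left_mono bound) (auto simp: S_def intro: sum_nonneg)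
  finally have *: "N * N \<le> (C * S) * N" by (simp add: power2_eq_square ac_simps)
  have "0 \<le> C * S" using assms(3) by (auto simp: S_def intro!: mult_nonneg_nonneg sum_nonneg)
  moreover have "0 \<le> N" by (simp add: N_def)
  ultimately have "N \<le> C * S"
    using * by (cases "N = 0") (auto simp: mult_le_cancel_right)
  then show ?thesis by (simp add: N_def S_def)
qed

text \<open>The bound is put on finite partial sums, so that summability of the squared inner
  products is a consequence and no separate condition. It ranges over all of \<open>L2 M\<close>,
  unlike the frame inequality.\<close>

definition bessel :: "'x measure \<Rightarrow> ('i \<Rightarrow> 'x \<Rightarrow> complex) \<Rightarrow> 'i set \<Rightarrow> real \<Rightarrow> bool" where
  "bessel M u I C \<longleftrightarrow> (\<forall>i\<in>I. u i \<in> L2 M) \<and> 0 \<le> C \<and>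
     (\<forall>F\<in>L2 M. \<forall>X. finite X \<longrightarrow> X \<subseteq> I \<longrightarrow>
        (\<Sum>i\<in>X. (cmod (L2_inner M F (u i)))\<^sup>2) \<le> C * (L2_norm M F)\<^sup>2)"

lemma bessel_in_L2: "bessel M u I C \<Longrightarrow> i \<in> I \<Longrightarrow> u i \<in> L2 M"
  by (simp add: bessel_def)

lemma bessel_sum_le:
  "bessel M u I C \<Longrightarrow> F \<in> L2 M \<Longrightarrow> finite X \<Longrightarrow> X \<subseteq> I \<Longrightarrow>
    (\<Sum>i\<in>X. (cmod (L2_inner M F (u i)))\<^sup>2) \<le> C * (L2_norm M F)\<^sup>2"
  by (simp add: bessel_def)

lemma bessel_summable:
  assumes "bessel M u I C" "F \<in> L2 M"
  shows "(\<lambda>i. (cmod (L2_inner M F (u i)))\<^sup>2) summable_on I"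
    and "(\<Sum>\<^sub>\<infinity>i\<in>I. (cmod (L2_inner M F (u i)))\<^sup>2) \<le> C * (L2_norm M F)\<^sup>2"
proof -
  show "(\<lambda>i. (cmod (L2_inner M F (u i)))\<^sup>2) summable_on I"
    by (intro nonneg_bounded_partial_sums_imp_summable_on[where C = "C * (L2_norm M F)\<^sup>2"]
        eventually_finite_subsets_at_top_weakI bessel_sum_le[OF assms]) auto
  then show "(\<Sum>\<^sub>\<infinity>i\<in>I. (cmod (L2_inner M F (u i)))\<^sup>2) \<le> C * (L2_norm M F)\<^sup>2"
    by (rule infsum_le_finite_sums) (use bessel_sum_le[OF assms] in auto)
qed

lemma bessel_synthesis:
  assumes "bessel M u I C" "finite X" "X \<subseteq> I"
  shows "(L2_norm M (\<lambda>x. \<Sum>i\<in>X. c i * u i x))\<^sup>2 \<le> C * (\<Sum>i\<in>X. (cmod (c i))\<^sup>2)"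
  using assms
  by (intro synthesis_bound[OF assms(2) _ _ refl] bessel_sum_le[OF assms(1)] L2_lincomb)
     (auto simp: bessel_def)

text \<open>By duality, a Bessel inequality on the finite linear combinations of the system
  extends to all of \<open>L\<^sup>2\<close> with the same constant.\<close>

lemma bessel_from_span:
  assumes u: "\<And>i. i \<in> I \<Longrightarrow> u i \<in> L2 M" and "0 \<le> C"
    and bound: "\<And>X c. finite X \<Longrightarrow> X \<subseteq> I \<Longrightarrow>
      (\<Sum>i\<in>X. (cmod (L2_inner M (\<lambda>x. \<Sum>i\<in>X. c i * u i x) (u i)))\<^sup>2)
        \<le> C * (L2_norm M (\<lambda>x. \<Sum>i\<in>X. c i * u i x))\<^sup>2"
  shows "bessel M u I C"
  unfolding bessel_def
proof (intro conjI ballI allI impI)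
  fix F X assume F: "F \<in> L2 M" and X: "finite X" "X \<subseteq> I"
  \<comment> \<open>\<open>F\<close> is tested against the combination \<open>G\<close> with its own
    coefficients: then \<open><F, G> = S\<close>, while the synthesis bound gives
    \<open>|G|^2 \<le> C * S\<close>. Cauchy-Schwarz and cancelling one \<open>S\<close>
    finish.\<close>
  define c where "c i = L2_inner M F (u i)" for i
  define G where "G = (\<lambda>x. \<Sum>i\<in>X. c i * u i x)"
  define S where "S = (\<Sum>i\<in>X. (cmod (c i))\<^sup>2)"
  have S0: "0 \<le> S" unfolding S_def by (intro sum_nonneg) auto
  have uX: "u i \<in> L2 M" if "i \<in> X" for i using that X u by auto
  have GL: "G \<in> L2 M" unfolding G_def using uX by (rule L2_lincomb)
  have le: "(L2_norm M G)\<^sup>2 \<le> C * S"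
    unfolding S_def by (rule synthesis_bound[OF X(1) uX \<open>0 \<le> C\<close> G_def])
      (use bound[OF X, of c] in \<open>simp_all add: G_def\<close>)
  have "L2_inner M F G = (\<Sum>i\<in>X. L2_inner M F (\<lambda>x. c i * u i x))"
    unfolding G_def by (intro L2_inner_sum_right F L2_cmult uX)
  also have "\<dots> = (\<Sum>i\<in>X. cnj (c i) * c i)"
    by (simp add: L2_inner_cmult_right c_def)
  also have "\<dots> = complex_of_real S"
    unfolding S_def of_real_sum complex_norm_square by (simp add: mult.commute)
  finally have "S = cmod (L2_inner M F G)" using S0 by simp
  also have "\<dots> \<le> L2_norm M F * L2_norm M G" by (rule L2_Cauchy_Schwarz[OF F GL])
  finally have "S\<^sup>2 \<le> (L2_norm M F * L2_norm M G)\<^sup>2" using S0 by (rule power_mono)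
  also have "\<dots> \<le> (L2_norm M F)\<^sup>2 * (C * S)"
    unfolding power_mult_distrib using le by (rule mult_left_mono) simp
  finally have *: "S * S \<le> (C * (L2_norm M F)\<^sup>2) * S" by (simp add: power2_eq_square ac_simps)
  have "0 \<le> C * (L2_norm M F)\<^sup>2" using \<open>0 \<le> C\<close> by simp
  then have "S \<le> C * (L2_norm M F)\<^sup>2"
    using * S0 by (cases "S = 0") (auto simp: mult_le_cancel_right)
  then show "(\<Sum>i\<in>X. (cmod (L2_inner M F (u i)))\<^sup>2) \<le> C * (L2_norm M F)\<^sup>2"
    by (simp add: S_def c_def)
qed (use u \<open>0 \<le> C\<close> in auto)

lemma summable_tail_bound:
  fixes f :: "'i \<Rightarrow> real"
  assumes "f summable_on I" "\<And>i. i \<in> I \<Longrightarrow> 0 \<le> f i" "e > 0"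
  shows "\<exists>X. finite X \<and> X \<subseteq> I \<and> (\<forall>Y. finite Y \<longrightarrow> Y \<subseteq> I - X \<longrightarrow> sum f Y < e)"
proof -
  have hs: "(f has_sum infsum f I) I" using assms(1) by simp
  then have "\<forall>\<^sub>F X in finite_subsets_at_top I. dist (sum f X) (infsum f I) < e"
    unfolding has_sum_def using assms(3) by (rule tendstoD)
  then obtain X where X: "finite X" "X \<subseteq> I" "dist (sum f X) (infsum f I) < e"
    by (auto simp: eventually_finite_subsets_at_top)
  have "sum f Y < e" if Y: "finite Y" "Y \<subseteq> I - X" for Y
  proof -
    have "sum f X + sum f Y = sum f (X \<union> Y)" using X Y by (subst sum.union_disjoint) auto
    also have "\<dots> \<le> infsum f I"
      using X Y assms(2) by (intro finite_sum_le_has_sum[OF hs]) auto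
    finally show ?thesis using X(3) by (simp add: dist_real_def)
  qed
  then show ?thesis using X by blast
qed

text \<open>By the synthesis bound the finite partial sums form a Cauchy net as soon as the
  coefficients are square summable. An increasing sequence of finite index sets with fast decaying
  tails reduces the net to \<open>L2_complete\<close>, and its limit is then shown to be the limit
  of the net.\<close>

lemma bessel_has_L2_sum:
  assumes b: "bessel M u I C" and c: "(\<lambda>i. (cmod (c i))\<^sup>2) summable_on I"
  shows "\<exists>g. has_L2_sum M (\<lambda>i x. c i * u i x) I g"
proof -
  have C: "0 \<le> C" using b by (simp add: bessel_def)
  \<comment> \<open>After multiplication by \<open>C\<close> the threshold is at most
    \<open>((1/4) ^ n)^2\<close>, the rate that \<open>L2_complete\<close> asks for;
    \<open>C + 1\<close> allows \<open>C = 0\<close>.\<close>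
  have "\<exists>X. finite X \<and> X \<subseteq> I \<and> (\<forall>Y. finite Y \<longrightarrow> Y \<subseteq> I - X \<longrightarrow> (\<Sum>i\<in>Y. (cmod (c i))\<^sup>2) < (1/4)^(2*n) / (C + 1))" for n
    using C by (intro summable_tail_bound c) auto
  then obtain Z where Z: "finite (Z n)" "Z n \<subseteq> I"
    "finite Y \<Longrightarrow> Y \<subseteq> I - Z n \<Longrightarrow> (\<Sum>i\<in>Y. (cmod (c i))\<^sup>2) < (1/4)^(2*n) / (C + 1)" for n Y
    by metis
  define X where "X n = (\<Union>m\<le>n. Z m)" for n
  have X: "finite (X n)" "X n \<subseteq> I" for n using Z by (auto simp: X_def)
  have XZ: "Z n \<subseteq> X n" for n by (auto simp: X_def)
  have Xmono: "X n \<subseteq> X (Suc n)" for n by (fastforce simp: X_def)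
  define G where "G Y x = (\<Sum>i\<in>Y. c i * u i x)" for Y x
  have GL: "G Y \<in> L2 M" if "Y \<subseteq> I" for Y
    unfolding G_def using that bessel_in_L2[OF b] by (intro L2_lincomb) auto
  have step: "L2_norm M (\<lambda>x. G Y x - G (X n) x) \<le> (1/4)^n" if Y: "finite Y" "X n \<subseteq> Y" "Y \<subseteq> I" for n Y
  proof -
    have "G Y x - G (X n) x = (\<Sum>i\<in>Y - X n. c i * u i x)" for x
      unfolding G_def using Y by (subst sum_diff) auto
    then have "(L2_norm M (\<lambda>x. G Y x - G (X n) x))\<^sup>2 \<le> C * (\<Sum>i\<in>Y - X n. (cmod (c i))\<^sup>2)"
      using bessel_synthesis[OF b, of "Y - X n" c] Y by auto
    also have "\<dots> \<le> C * ((1/4)^(2*n) / (C + 1))"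
    proof (rule mult_left_mono[OF less_imp_le C])
      show "(\<Sum>i\<in>Y - X n. (cmod (c i))\<^sup>2) < (1/4)^(2*n) / (C + 1)"
        using Y XZ[of n] by (intro Z(3)) auto
    qed
    also have "\<dots> = ((1/4)^n)\<^sup>2 * (C / (C + 1))"
      by (simp add: power_even_eq)
    also have "\<dots> \<le> ((1/4)^n)\<^sup>2 * 1"
      using C by (intro mult_left_mono) auto
    finally have "(L2_norm M (\<lambda>x. G Y x - G (X n) x))\<^sup>2 \<le> ((1/4)^n)\<^sup>2"
      by (simp only: mult_1_right)
    then show ?thesis by (rule power2_le_imp_le) simp
  qed
  have "\<exists>g\<in>L2 M. (\<lambda>n. L2_norm M (\<lambda>x. g x - G (X n) x)) \<longlonglongrightarrow> 0"
    by (rule L2_complete) (intro GL step X Xmono)+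
  then obtain g where g: "g \<in> L2 M" "(\<lambda>n. L2_norm M (\<lambda>x. g x - G (X n) x)) \<longlonglongrightarrow> 0"
    by blast
  have "((\<lambda>Y. L2_norm M (\<lambda>x. g x - G Y x)) \<longlongrightarrow> 0) (finite_subsets_at_top I)"
  proof (rule tendstoI)
    fix e :: real assume e: "e > 0"
    have "(\<lambda>n. L2_norm M (\<lambda>x. g x - G (X n) x) + (1/4)^n) \<longlonglongrightarrow> 0"
      by (intro tendsto_add_zero g LIMSEQ_power_zero) simp
    then have "\<forall>\<^sub>F n in sequentially. L2_norm M (\<lambda>x. g x - G (X n) x) + (1/4)^n < e"
      using e by (auto dest: order_tendstoD)
    then obtain n where n: "L2_norm M (\<lambda>x. g x - G (X n) x) + (1/4)^n < e"
      by (auto simp: eventually_sequentially)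
    have "L2_norm M (\<lambda>x. g x - G Y x) < e" if Y: "finite Y" "X n \<subseteq> Y" "Y \<subseteq> I" for Y
      using L2_norm_triangle_diff[OF g(1) GL[OF X(2)] GL[OF Y(3)], of n] step[OF Y] n
      by (simp add: L2_norm_minus_commute[of M "G (X n)"])
    then show "\<forall>\<^sub>F Y in finite_subsets_at_top I. dist (L2_norm M (\<lambda>x. g x - G Y x)) 0 < e"
      using X[of n] by (auto simp: eventually_finite_subsets_at_top L2_norm_nonneg intro!: exI[of _ "X n"])
  qed
  then show ?thesis
    using g(1) bessel_in_L2[OF b] unfolding has_L2_sum_def G_def
    by (intro exI[of _ g]) (auto intro: L2_cmult)
qed

lemma has_sum_finite_sum:
  fixes f :: "'s \<Rightarrow> 'i \<Rightarrow> 'b::topological_comm_monoid_add"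
  assumes "finite S" "\<And>s. s \<in> S \<Longrightarrow> (f s has_sum g s) A"
  shows "((\<lambda>i. \<Sum>s\<in>S. f s i) has_sum (\<Sum>s\<in>S. g s)) A"
  using assms by (induction S) (auto intro: has_sum_add)

text \<open>For finitely supported vectors the identity is the expanded square. Passing to the limit
  on finitely many rows gives \<open>D \<le> N c\<close>. Conversely, for a finite part
  \<open>c_X\<close> of \<open>c\<close> with image \<open>dX\<close>, the triangle inequality reads
  \<open>|c_X| = |dX| \<le> |d| + |d - dX|\<close>, and the upper estimate applied to the tail
  \<open>c - c_X\<close> bounds the last term by the norm of that tail, which tends to
  \<open>0\<close>.\<close>

lemma l2_isometry:
  fixes V :: "'p \<Rightarrow> 'q \<Rightarrow> complex"
  assumes orth: "\<And>q q'. q \<in> Q \<Longrightarrow> q' \<in> Q \<Longrightarrow>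
      ((\<lambda>p. V p q * cnj (V p q')) has_sum (if q = q' then 1 else 0)) P"
    and d: "\<And>p. p \<in> P \<Longrightarrow> ((\<lambda>q. V p q * c q) has_sum d p) Q"
    and c: "(\<lambda>q. (cmod (c q))\<^sup>2) summable_on Q"
  shows "((\<lambda>p. (cmod (d p))\<^sup>2) has_sum (\<Sum>\<^sub>\<infinity>q\<in>Q. (cmod (c q))\<^sup>2)) P"
proof -
  define N where "N b = (\<Sum>\<^sub>\<infinity>q\<in>Q. (cmod (b q))\<^sup>2)" for b :: "'q \<Rightarrow> complex"
  have fin: "((\<lambda>p. (cmod (\<Sum>q\<in>X. V p q * b q))\<^sup>2) has_sum (\<Sum>q\<in>X. (cmod (b q))\<^sup>2)) P"
    if X: "finite X" "X \<subseteq> Q" for X b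
  proof -
    have "((\<lambda>p. \<Sum>q\<in>X. \<Sum>q'\<in>X. (V p q * cnj (V p q')) * (b q * cnj (b q'))) has_sum
        (\<Sum>q\<in>X. \<Sum>q'\<in>X. (if q = q' then 1 else 0) * (b q * cnj (b q')))) P"
      using X by (intro has_sum_finite_sum has_sum_cmult_left orth) auto
    moreover have "(\<Sum>q\<in>X. \<Sum>q'\<in>X. (V p q * cnj (V p q')) * (b q * cnj (b q')))
        = complex_of_real ((cmod (\<Sum>q\<in>X. V p q * b q))\<^sup>2)" for p
      unfolding complex_norm_square cnj_sum sum_product by (simp add: ac_simps)
    moreover have "(\<Sum>q\<in>X. \<Sum>q'\<in>X. (if q = q' then 1 else 0) * (b q * cnj (b q')))
        = complex_of_real (\<Sum>q\<in>X. (cmod (b q))\<^sup>2)"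
      unfolding of_real_sum complex_norm_square
      using X(1) by (simp add: if_distrib[of "\<lambda>t. t * _"] cong: if_cong)
    ultimately show ?thesis by (simp only: has_sum_of_real_iff)
  qed
  have upper: "(\<Sum>p\<in>Y. (cmod (e p))\<^sup>2) \<le> N b"
    if Y: "finite Y" "Y \<subseteq> P" and e: "\<And>p. p \<in> P \<Longrightarrow> ((\<lambda>q. V p q * b q) has_sum e p) Q"
      and b: "(\<lambda>q. (cmod (b q))\<^sup>2) summable_on Q" for Y e b
  proof (rule tendsto_upperbound)
    show "((\<lambda>X. \<Sum>p\<in>Y. (cmod (\<Sum>q\<in>X. V p q * b q))\<^sup>2) \<longlongrightarrow> (\<Sum>p\<in>Y. (cmod (e p))\<^sup>2)) (finite_subsets_at_top Q)"
      using e Y by (intro tendsto_intros) (auto simp: has_sum_def)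
    show "\<forall>\<^sub>F X in finite_subsets_at_top Q. (\<Sum>p\<in>Y. (cmod (\<Sum>q\<in>X. V p q * b q))\<^sup>2) \<le> N b"
    proof (rule eventually_finite_subsets_at_top_weakI)
      fix X assume X: "finite X" "X \<subseteq> Q"
      have "(\<Sum>p\<in>Y. (cmod (\<Sum>q\<in>X. V p q * b q))\<^sup>2) \<le> (\<Sum>q\<in>X. (cmod (b q))\<^sup>2)"
        by (rule finite_sum_le_has_sum[OF fin[OF X]]) (use Y in auto)
      also have "\<dots> \<le> N b" unfolding N_def by (rule finite_sum_le_infsum[OF b]) (use X in auto)
      finally show "(\<Sum>p\<in>Y. (cmod (\<Sum>q\<in>X. V p q * b q))\<^sup>2) \<le> N b" .
    qed
  qed simp
  have sd: "(\<lambda>p. (cmod (d p))\<^sup>2) summable_on P"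
    by (intro nonneg_bounded_partial_sums_imp_summable_on[where C = "N c"]
        eventually_finite_subsets_at_top_weakI upper d c) auto
  define D where "D = (\<Sum>\<^sub>\<infinity>p\<in>P. (cmod (d p))\<^sup>2)"
  have "D \<le> N c" unfolding D_def by (rule infsum_le_finite_sums[OF sd]) (intro upper d c)
  have D0: "0 \<le> D" unfolding D_def by (intro infsum_nonneg) auto
  have key: "sqrt (\<Sum>q\<in>X. (cmod (c q))\<^sup>2) \<le> sqrt D + sqrt (N c - (\<Sum>q\<in>X. (cmod (c q))\<^sup>2))"
    if X: "finite X" "X \<subseteq> Q" for X
  proof -
    define T where "T = N c - (\<Sum>q\<in>X. (cmod (c q))\<^sup>2)"
    define dX where "dX p = (\<Sum>q\<in>X. V p q * c q)" for p
    define b where "b q = (if q \<in> X then 0 else c q)" for q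
    have hsb: "((\<lambda>q. (cmod (b q))\<^sup>2) has_sum T) Q"
    proof -
      have "((\<lambda>q. (cmod (c q))\<^sup>2 + (if q \<in> X then - (cmod (c q))\<^sup>2 else 0)) has_sum
          (N c + (\<Sum>q\<in>X. - (cmod (c q))\<^sup>2))) Q"
        by (rule has_sum_add) (use c X in \<open>auto simp: N_def intro!: has_sum_finite_neutralI[where B = X]\<close>)
      moreover have "(cmod (b q))\<^sup>2 = (cmod (c q))\<^sup>2 + (if q \<in> X then - (cmod (c q))\<^sup>2 else 0)" for q
        by (simp add: b_def)
      ultimately show ?thesis by (simp add: T_def sum_negf)
    qed
    have T: "N b = T" unfolding N_def by (rule infsumI[OF hsb])
    have db: "((\<lambda>q. V p q * b q) has_sum (d p - dX p)) Q" if "p \<in> P" for p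
    proof -
      have "((\<lambda>q. V p q * c q + (if q \<in> X then - (V p q * c q) else 0)) has_sum
          (d p + (\<Sum>q\<in>X. - (V p q * c q)))) Q"
        by (rule has_sum_add) (use d that X in \<open>auto intro!: has_sum_finite_neutralI[where B = X]\<close>)
      moreover have "V p q * b q = V p q * c q + (if q \<in> X then - (V p q * c q) else 0)" for q
        by (simp add: b_def)
      ultimately show ?thesis by (simp add: dX_def sum_negf)
    qed
    have le: "(\<Sum>p\<in>Y. (cmod (dX p))\<^sup>2) \<le> (sqrt D + sqrt T)\<^sup>2" if Y: "finite Y" "Y \<subseteq> P" for Y
    proof -
      have "L2_set (\<lambda>p. cmod (dX p)) Y \<le> L2_set (\<lambda>p. cmod (d p) + cmod (d p - dX p)) Y"
        by (rule L2_set_mono) (use norm_triangle_sub in \<open>auto simp: norm_minus_commute[of "d _"]\<close>)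
      also have "\<dots> \<le> L2_set (\<lambda>p. cmod (d p)) Y + L2_set (\<lambda>p. cmod (d p - dX p)) Y"
        by (rule L2_set_triangle_ineq)
      also have "L2_set (\<lambda>p. cmod (d p)) Y \<le> sqrt D"
        unfolding L2_set_def D_def by (intro real_sqrt_le_mono finite_sum_le_infsum[OF sd]) (use Y in auto)
      also have "L2_set (\<lambda>p. cmod (d p - dX p)) Y \<le> sqrt T"
        unfolding L2_set_def T[symmetric] using Y
        by (intro real_sqrt_le_mono upper db has_sum_imp_summable[OF hsb])
      finally have "sqrt (\<Sum>p\<in>Y. (cmod (dX p))\<^sup>2) \<le> sqrt D + sqrt T" by (simp add: L2_set_def)
      then have "(sqrt (\<Sum>p\<in>Y. (cmod (dX p))\<^sup>2))\<^sup>2 \<le> (sqrt D + sqrt T)\<^sup>2"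
        by (rule power_mono) (simp add: sum_nonneg)
      then show ?thesis by (simp add: sum_nonneg)
    qed
    have "(\<Sum>q\<in>X. (cmod (c q))\<^sup>2) \<le> (sqrt D + sqrt T)\<^sup>2"
      by (rule has_sum_le_finite_sums[OF fin[OF X]]) (use le in \<open>auto simp: dX_def\<close>)
    moreover have "0 \<le> T" using hsb by (rule has_sum_nonneg) auto
    ultimately show ?thesis unfolding T_def[symmetric]
      by (intro real_le_lsqrt) (use D0 in \<open>auto intro: sum_nonneg\<close>)
  qed
  have "sqrt (N c) \<le> sqrt D + sqrt (N c - N c)"
  proof (rule tendsto_le)
    have l: "((\<lambda>X. \<Sum>q\<in>X. (cmod (c q))\<^sup>2) \<longlongrightarrow> N c) (finite_subsets_at_top Q)"
      unfolding N_def using has_sum_infsum[OF c] by (simp only: has_sum_def)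
    show "((\<lambda>X. sqrt (\<Sum>q\<in>X. (cmod (c q))\<^sup>2)) \<longlongrightarrow> sqrt (N c)) (finite_subsets_at_top Q)"
      by (intro tendsto_intros l)
    show "((\<lambda>X. sqrt D + sqrt (N c - (\<Sum>q\<in>X. (cmod (c q))\<^sup>2))) \<longlongrightarrow> sqrt D + sqrt (N c - N c)) (finite_subsets_at_top Q)"
      by (intro tendsto_intros l)
    show "\<forall>\<^sub>F X in finite_subsets_at_top Q. sqrt (\<Sum>q\<in>X. (cmod (c q))\<^sup>2) \<le> sqrt D + sqrt (N c - (\<Sum>q\<in>X. (cmod (c q))\<^sup>2))"
      by (rule eventually_finite_subsets_at_top_weakI) (rule key)
  qed simp
  then have "N c \<le> D" by simp
  with \<open>D \<le> N c\<close> have "D = N c" by simp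
  then show ?thesis using has_sum_infsum[OF sd] by (simp add: D_def N_def)
qed

subsection \<open>Lebesgue measure under invertible affine maps\<close>

text \<open>The library proves this for well-ordered index types only; the index type
  enters its proof only through triangular determinants of shears and through transpositions,
  which are products of shears and reflections.\<close>

lemma lmeasurable_matrix_image:
  fixes f :: "real^'n \<Rightarrow> real^'n"
  assumes "linear f" "S \<in> lmeasurable"
  shows "f ` S \<in> lmeasurable \<and> measure lebesgue (f ` S) = \<bar>det (matrix f)\<bar> * measure lebesgue S"
proof -
  define P where "P g \<longleftrightarrow> linear g \<and> (\<forall>S\<in>lmeasurable. g ` S \<in> lmeasurable \<and>
      measure lebesgue (g ` S) = \<bar>det (matrix g)\<bar> * measure lebesgue S)" for g :: "real^'n \<Rightarrow> real^'n"
  have comp: "P (f \<circ> g)" if "P f" "P g" for f g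
    using that unfolding P_def
    by (auto simp: linear_compose matrix_compose det_mul abs_mult simp flip: image_image image_comp)
  define D where "D c = (\<lambda>x::real^'n. \<chi> i. c i * x $ i)" for c
  define sh where "sh m n = (\<lambda>x::real^'n. \<chi> i. if i = m then x $ m + x $ n else x $ i)" for m n
  have D: "P (D c)" for c
    unfolding P_def D_def
    by (auto intro!: linearI measurable_stretch
        simp: vec_eq_iff algebra_simps measure_stretch axis_def matrix_def det_diagonal)
  have sh: "P (sh m n)" if "m \<noteq> n" for m n
  proof -
    have lin: "linear (sh m n)"
      by (rule linearI) (auto simp: sh_def vec_eq_iff algebra_simps)
    have "matrix (sh m n) = (\<chi> k. if k = m then row m (mat 1) + 1 *s row n (mat 1) else row k (mat 1))"
      by (auto simp: matrix_def sh_def row_def mat_def axis_def vec_eq_iff)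
    then have det: "det (matrix (sh m n)) = 1"
      using det_row_operation[OF that, of "mat 1 :: real^'n^'n" 1] by simp
    have box: "measure lebesgue (sh m n ` cbox a b) = measure lebesgue (cbox a b)" for a b
    proof (cases "cbox a b = {}")
      case False
      \<comment> \<open>\<open>measure_shear_interval\<close> is for boxes whose lower corner has a
        nonnegative \<open>n\<close>-th coordinate; translating by \<open>v\<close> puts that corner
        at the origin.\<close>
      define v :: "real^'n" where "v = (\<chi> i. - a $ i)"
      have cb: "(+) v ` cbox a b = cbox (v + a) (v + b)" by (rule cbox_translation[symmetric])
      have "sh m n ` ((+) v ` cbox a b) = (+) (sh m n v) ` (sh m n ` cbox a b)"
        by (auto simp: image_image linear_add[OF lin])
      then have "measure lebesgue (sh m n ` cbox a b) = measure lebesgue (sh m n ` cbox (v + a) (v + b))"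
        by (simp add: cb measure_translation)
      also have "\<dots> = measure lebesgue (cbox (v + a) (v + b))"
        unfolding sh_def using False cb that by (intro measure_shear_interval) (auto simp: v_def)
      also have "\<dots> = measure lebesgue (cbox a b)"
        by (simp add: cb[symmetric] measure_translation)
      finally show ?thesis .
    qed simp
    show ?thesis
      unfolding P_def det
    proof (intro conjI lin ballI)
      fix S :: "(real^'n) set" assume "S \<in> lmeasurable"
      then have "sh m n ` S \<in> lmeasurable \<and> 1 * measure lebesgue S = measure lebesgue (sh m n ` S)"
        by (rule measure_linear_sufficient[OF lin]) (simp only: box mult_1)
      then show "sh m n ` S \<in> lmeasurable" "measure lebesgue (sh m n ` S) = \<bar>1\<bar> * measure lebesgue S"
        by auto
    qed
  qed
  have "P f"
  proof (rule induct_linear_elementary[OF assms(1)])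
    show "P (f \<circ> g)" if "P f" "P g" for f g using that by (rule comp)
  next
    fix f :: "real^'n \<Rightarrow> real^'n" and i
    assume lin: "linear f" and z: "\<And>x. f x $ i = 0"
    then have ninj: "\<not> inj f"
      by (metis (full_types) linear_injective_imp_surjective one_neq_zero surjE vec_component)
    then have "det (matrix f) = 0" using det_nz_iff_inj[OF lin] by blast
    moreover have "negligible (f ` S)" for S
      using lin ninj by (rule negligible_linear_singular_image)
    ultimately show "P f"
      using lin by (auto simp: P_def negligible_imp_measure0 negligible_imp_measurable)
  next
    fix m n :: 'n assume mn: "m \<noteq> n"
    define R where "R k = D (\<lambda>i. if i = k then -1 else 1)" for k
    \<comment> \<open>On the coordinates \<open>(m, n)\<close>, innermost map first:
      \<open>(x, y)\<close>, \<open>(x + y, y)\<close>, \<open>(-x - y, y)\<close>,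
      \<open>(-x - y, -x)\<close>, \<open>(x + y, -x)\<close>, \<open>(y, -x)\<close>,
      \<open>(y, x)\<close>.\<close>
    have "(\<lambda>x. \<chi> i. x $ Transposition.transpose m n i)
        = R n \<circ> (sh m n \<circ> (R m \<circ> (sh n m \<circ> (R m \<circ> sh m n))))"
      using mn by (auto simp: fun_eq_iff vec_eq_iff R_def D_def sh_def Transposition.transpose_def)
    then show "P (\<lambda>x. \<chi> i. x $ Transposition.transpose m n i)"
      using mn by (simp add: comp D sh R_def)
  qed (use D sh in \<open>auto simp: D_def sh_def\<close>)
  then show ?thesis using assms(2) by (auto simp: P_def)
qed

text \<open>A single notion for every change of variables below: affine maps of the space, with
  \<open>c\<close> the reciprocal of the absolute determinant, and translations of the torus, with
  \<open>c = 1\<close>. The factor is attached to the image measure, which gives integrals of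
  arbitrary integrands at once.\<close>

definition dilates :: "'x measure \<Rightarrow> real \<Rightarrow> ('x \<Rightarrow> 'x) \<Rightarrow> bool" where
  "dilates M c T \<longleftrightarrow> 0 < c \<and> T \<in> M \<rightarrow>\<^sub>M M \<and> distr M M T = density M (\<lambda>_. ennreal c)"

lemma dilatesI:
  assumes "0 < c" "T \<in> M \<rightarrow>\<^sub>M M"
    "\<And>S. S \<in> sets M \<Longrightarrow> emeasure M (T -` S \<inter> space M) = ennreal c * emeasure M S"
  shows "dilates M c T"
  unfolding dilates_def using assms
  by (auto intro!: measure_eqI simp: emeasure_distr emeasure_density_const)

lemma dilates_measurable: "dilates M c T \<Longrightarrow> T \<in> M \<rightarrow>\<^sub>M M"
  by (simp add: dilates_def)

lemma dilates_integral:
  fixes f :: "'x \<Rightarrow> 'b::{banach, second_countable_topology}"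
  assumes T: "dilates M c T" and f: "f \<in> borel_measurable M"
  shows "(LINT x|M. f (T x)) = c *\<^sub>R (LINT x|M. f x)"
    and "integrable M f \<Longrightarrow> integrable M (\<lambda>x. f (T x))"
proof -
  have eq: "distr M M T = density M (\<lambda>_. ennreal c)" and c: "0 < c" and m: "T \<in> M \<rightarrow>\<^sub>M M"
    using T by (auto simp: dilates_def)
  have "(LINT x|M. f (T x)) = integral\<^sup>L (density M (\<lambda>_. ennreal c)) f"
    unfolding eq[symmetric] by (rule integral_distr[OF m f, symmetric])
  also have "\<dots> = (LINT x|M. c *\<^sub>R f x)"
    using f c by (intro integral_density) auto
  finally show "(LINT x|M. f (T x)) = c *\<^sub>R (LINT x|M. f x)" by simp
  assume "integrable M f"
  then have "integrable (density M (\<lambda>_. ennreal c)) f"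
    using f c by (subst integrable_density) auto
  then show "integrable M (\<lambda>x. f (T x))"
    unfolding eq[symmetric] using integrable_distr_eq[OF m f] by simp
qed

lemma dilates_L2:
  assumes "dilates M c T" "f \<in> L2 M"
  shows "(\<lambda>x. f (T x)) \<in> L2 M"
  using dilates_integral(2)[OF assms(1), of "\<lambda>x. (cmod (f x))\<^sup>2"]
    measurable_compose[OF dilates_measurable[OF assms(1)], of f] assms(2)
  by (auto simp: L2_def)

lemma dilates_L2_inner:
  assumes "dilates M c T" "f \<in> L2 M" "g \<in> L2 M"
  shows "L2_inner M (\<lambda>x. f (T x)) (\<lambda>x. g (T x)) = c * L2_inner M f g"
  using dilates_integral(1)[OF assms(1), of "\<lambda>x. f x * cnj (g x)"] integrable_L2_mult[OF assms(2,3)]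
  unfolding L2_inner_def by (simp add: borel_measurable_integrable scaleR_conv_of_real)

lemma dilates_L2_norm:
  assumes "dilates M c T" "f \<in> borel_measurable M"
  shows "L2_norm M (\<lambda>x. f (T x)) = sqrt c * L2_norm M f"
  using dilates_integral(1)[OF assms(1), of "\<lambda>x. (cmod (f x))\<^sup>2"] assms(2)
  unfolding L2_norm_def by (simp add: real_sqrt_mult)

lemma dilates_has_L2_sum:
  assumes T: "dilates M c T" and s: "has_L2_sum M F I g"
  shows "has_L2_sum M (\<lambda>i x. F i (T x)) I (\<lambda>x. g (T x))"
  unfolding has_L2_sum_def
proof (intro conjI ballI)
  have ev: "\<forall>\<^sub>F X in finite_subsets_at_top I. sqrt c * L2_norm M (\<lambda>x. g x - (\<Sum>i\<in>X. F i x))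
      = L2_norm M (\<lambda>x. g (T x) - (\<Sum>i\<in>X. F i (T x)))"
  proof (rule eventually_finite_subsets_at_top_weakI)
    fix X assume "finite X" "X \<subseteq> I"
    then have "(\<lambda>x. g x - (\<Sum>i\<in>X. F i x)) \<in> L2 M"
      using s by (intro L2_diff L2_finite_sum) (auto simp: has_L2_sum_def)
    then show "sqrt c * L2_norm M (\<lambda>x. g x - (\<Sum>i\<in>X. F i x))
      = L2_norm M (\<lambda>x. g (T x) - (\<Sum>i\<in>X. F i (T x)))"
      using dilates_L2_norm[OF T, of "\<lambda>x. g x - (\<Sum>i\<in>X. F i x)"] by (simp add: L2_measurable)
  qed
  have "((\<lambda>X. sqrt c * L2_norm M (\<lambda>x. g x - (\<Sum>i\<in>X. F i x))) \<longlongrightarrow> 0) (finite_subsets_at_top I)"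
    using s by (intro tendsto_mult_right_zero) (simp add: has_L2_sum_def)
  then show "((\<lambda>X. L2_norm M (\<lambda>x. g (T x) - (\<Sum>i\<in>X. F i (T x)))) \<longlongrightarrow> 0) (finite_subsets_at_top I)"
    using ev by (rule Lim_transform_eventually)
qed (use s in \<open>auto simp: has_L2_sum_def intro: dilates_L2[OF T]\<close>)

lemma matrix_inv_cancel:
  fixes A :: "real^'d^'d"
  assumes "det A \<noteq> 0"
  shows "A ** matrix_inv A = mat 1" "matrix_inv A ** A = mat 1"
    "A *v (matrix_inv A *v x) = x" "matrix_inv A *v (A *v x) = x"
proof -
  have "invertible A" using assms by (simp add: invertible_det_nz)
  then show inv: "A ** matrix_inv A = mat 1" "matrix_inv A ** A = mat 1"
    using someI_ex[of "\<lambda>A'. A ** A' = mat 1 \<and> A' ** A = mat 1"] by (auto simp: invertible_def matrix_inv_def)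
  show "A *v (matrix_inv A *v x) = x" "matrix_inv A *v (A *v x) = x"
    by (simp_all add: matrix_vector_mul_assoc inv)
qed

text \<open>The preimage of \<open>S\<close> is the image of a translate of \<open>S\<close> under
  the inverse matrix, so sets of finite measure are covered by
  \<open>lmeasurable_matrix_image\<close>; other sets are exhausted by intersections with
  balls.\<close>

lemma dilates_affine:
  fixes A :: "real^'d^'d"
  assumes det: "det A \<noteq> 0"
  shows "dilates lebesgue (1 / \<bar>det A\<bar>) (\<lambda>x. A *v x - b)"
proof (rule dilatesI)
  define T where "T = (\<lambda>x. A *v x - b)"
  define f where "f = (\<lambda>x. matrix_inv A *v x)"
  note inv = matrix_inv_cancel(1,2)[OF det]
  have lin: "linear f" unfolding f_def by (rule matrix_vector_mul_linear)
  have "det (matrix_inv A) * det A = 1"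
    by (simp add: inv flip: det_mul)
  then have detf: "\<bar>det (matrix f)\<bar> = 1 / \<bar>det A\<bar>"
    using det by (simp add: f_def field_simps flip: abs_mult)
  have vim: "T -` S = f ` ((+) b ` S)" for S
  proof -
    have Tf: "T (f (b + y)) = y" for y
      by (simp add: T_def f_def matrix_vector_mul_assoc inv)
    have fT: "x = f (b + T x)" for x
      by (simp add: T_def f_def matrix_vector_mul_assoc inv)
    show ?thesis using Tf fT by (auto simp: image_iff)
  qed
  have fin: "T -` S \<in> lmeasurable \<and> emeasure lebesgue (T -` S) = ennreal (1 / \<bar>det A\<bar>) * emeasure lebesgue S"
    if "S \<in> lmeasurable" for S
  proof -
    have t: "(+) b ` S \<in> lmeasurable" using that by (rule measurable_translation)
    have m: "T -` S \<in> lmeasurable" "measure lebesgue (T -` S) = (1 / \<bar>det A\<bar>) * measure lebesgue S"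
      using lmeasurable_matrix_image[OF lin t] by (auto simp: vim detf measure_translation)
    then show ?thesis using that
      by (simp add: emeasure_eq_measure2 fmeasurableD2 flip: ennreal_mult)
  qed
  define Q where "Q n = cball (0 :: real^'d) (real n)" for n
  have Qinc: "incseq Q" by (intro incseq_SucI) (auto simp: Q_def)
  have QU: "(\<Union>n. Q n) = UNIV"
    using real_arch_simple by (auto simp: Q_def)
  have SQ: "S \<inter> Q n \<in> lmeasurable" if "S \<in> sets lebesgue" for S n
    using fmeasurable_Int_fmeasurable[OF lmeasurable_cball that] by (simp add: Q_def Int_commute)
  have all: "T -` S \<in> sets lebesgue \<and> emeasure lebesgue (T -` S) = ennreal (1 / \<bar>det A\<bar>) * emeasure lebesgue S"
    if S: "S \<in> sets lebesgue" for S
  proof -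
    have US: "(\<Union>n. S \<inter> Q n) = S" using QU by blast
    have UT: "(\<Union>n. T -` (S \<inter> Q n)) = T -` S" using QU by blast
    have inc: "incseq (\<lambda>n. S \<inter> Q n)" "incseq (\<lambda>n. T -` (S \<inter> Q n))"
      using Qinc by (fastforce simp: incseq_def)+
    have meas: "T -` (S \<inter> Q n) \<in> sets lebesgue" for n
      using fin[OF SQ[OF S]] by auto
    have "emeasure lebesgue (T -` S) = (SUP n. emeasure lebesgue (T -` (S \<inter> Q n)))"
      unfolding UT[symmetric] using meas inc by (intro SUP_emeasure_incseq[symmetric]) auto
    also have "\<dots> = (SUP n. ennreal (1 / \<bar>det A\<bar>) * emeasure lebesgue (S \<inter> Q n))"
      using fin[OF SQ[OF S]] by simp
    also have "\<dots> = ennreal (1 / \<bar>det A\<bar>) * (SUP n. emeasure lebesgue (S \<inter> Q n))"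
      by (rule SUP_mult_left_ennreal[symmetric])
    also have "(SUP n. emeasure lebesgue (S \<inter> Q n)) = emeasure lebesgue S"
      by (subst (2) US[symmetric], rule SUP_emeasure_incseq) (use inc S in \<open>auto simp: Q_def\<close>)
    finally show ?thesis using UT meas by (metis sets.countable_UN'' countableI_type)
  qed
  show "(\<lambda>x. A *v x - b) \<in> lebesgue \<rightarrow>\<^sub>M lebesgue"
    using all by (auto simp: measurable_def T_def)
  show "emeasure lebesgue ((\<lambda>x. A *v x - b) -` S \<inter> space lebesgue) = ennreal (1 / \<bar>det A\<bar>) * emeasure lebesgue S"
    if "S \<in> sets lebesgue" for S
    using all[OF that] by (simp add: T_def)
qed (use det in simp)

subsection \<open>Fourier series on the torus\<close>

lemma zvec_nth: "zvec k $ i = real_of_int (k $ i)"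
  by (simp add: zvec_def)

lemma zvec_add: "zvec (k + m) = zvec k + zvec m"
  by (simp add: vec_eq_iff zvec_nth)

lemma zvec_diff: "zvec (k - m) = zvec k - zvec m"
  by (simp add: vec_eq_iff zvec_nth)

lemma zvec_minus: "zvec (- k) = - zvec k"
  by (simp add: vec_eq_iff zvec_nth)

lemma zvec_0: "zvec 0 = 0"
  by (simp add: vec_eq_iff zvec_nth)

lemma zvec_inject: "zvec k = zvec m \<longleftrightarrow> k = m"
  by (simp add: vec_eq_iff zvec_nth)

lemma inner_zvec_Ints: "zvec k \<bullet> zvec m \<in> \<int>"
  by (auto simp: inner_vec_def zvec_nth intro!: Ints_sum Ints_mult)

lemma lebesgue_shift:
  fixes S :: "'a::euclidean_space set"
  assumes "S \<in> sets lebesgue"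
  shows "{x. x + v \<in> S} \<in> sets lebesgue" "emeasure lebesgue {x. x + v \<in> S} = emeasure lebesgue S"
proof -
  have eq: "{x. x + v \<in> S} = (\<lambda>x. 1 *\<^sub>R x + (- v)) ` S"
    by (auto simp: image_iff intro!: bexI[of _ "_ + v"])
  show "emeasure lebesgue {x. x + v \<in> S} = emeasure lebesgue S"
    unfolding eq by (subst emeasure_lebesgue_affine) simp
  show "{x. x + v \<in> S} \<in> sets lebesgue"
    using lebesgue_sets_translation[OF assms, of "- v"] unfolding eq by (simp add: add.commute)
qed

section \<open>The torus as a closed cube, and the invariance of its measure under
  translations\<close>

definition torus :: "(real^'d) measure" where
  "torus = lebesgue_on (cbox 0 (\<chi> i. 2 * pi))"

definition wrap :: "real^'d \<Rightarrow> real^'d" where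
  "wrap x = x - (2 * pi) *\<^sub>R zvec (\<chi> i. \<lfloor>x $ i / (2 * pi)\<rfloor>)"

text \<open>The half-open cube is an exact fundamental domain: every orbit of the lattice
  \<open>2 pi Z^d\<close> meets it once. In the closed cube opposite faces would be counted twice,
  but they form a null set.\<close>

definition torus_core :: "(real^'d) set" where
  "torus_core = {x. \<forall>i. 0 \<le> x $ i \<and> x $ i < 2 * pi}"

lemma wrap_eq_iff:
  "x - (2 * pi) *\<^sub>R zvec k \<in> torus_core \<longleftrightarrow> k = (\<chi> i. \<lfloor>x $ i / (2 * pi)\<rfloor>)"
proof -
  have "(0 \<le> x $ i - 2 * pi * real_of_int (k $ i) \<and> x $ i - 2 * pi * real_of_int (k $ i) < 2 * pi)
      \<longleftrightarrow> k $ i = \<lfloor>x $ i / (2 * pi)\<rfloor>" for i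
    by (auto simp: eq_commute[of "k $ i"] floor_eq_iff field_simps)
  then show ?thesis by (auto simp: torus_core_def zvec_nth vec_eq_iff)
qed

lemma wrap_in_core: "wrap x \<in> torus_core"
  unfolding wrap_def by (subst wrap_eq_iff) simp

lemma torus_core_subset: "torus_core \<subseteq> cbox 0 (\<chi> i. 2 * pi)"
  by (auto simp: torus_core_def mem_box_cart less_imp_le)

lemma space_torus: "space torus = cbox 0 (\<chi> i. 2 * pi)"
  by (simp add: torus_def)

lemma sets_torus: "S \<in> sets torus \<longleftrightarrow> S \<in> sets lebesgue \<and> S \<subseteq> cbox 0 (\<chi> i. 2 * pi)"
  unfolding torus_def by (subst sets_restrict_space_iff) auto

lemma emeasure_torus: "S \<subseteq> cbox 0 (\<chi> i. 2 * pi) \<Longrightarrow> emeasure torus S = emeasure lebesgue S"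
  unfolding torus_def by (subst emeasure_restrict_space) auto

lemma torus_core_sets: "torus_core \<in> sets lebesgue"
proof -
  have "torus_core = (\<Inter>i. {x::real^'d. 0 \<le> x $ i} \<inter> {x. x $ i < 2 * pi})"
    by (auto simp: torus_core_def)
  also have "\<dots> \<in> sets borel" by (intro sets.countable_INT'' sets.Int) auto
  finally show ?thesis by (metis sets_completionI_sets sets_lborel)
qed

lemma torus_core_null:
  fixes S :: "(real^'d) set"
  assumes "S \<in> sets lebesgue" "S \<subseteq> cbox 0 (\<chi> i. 2 * pi)"
  shows "emeasure lebesgue (S \<inter> torus_core) = emeasure lebesgue S"
proof -
  have "negligible (\<Union>i. {x::real^'d. x $ i = 2 * pi})"
  proof (rule negligible_Union)
    have "negligible {x::real^'d. x $ i = 2 * pi}" for i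
      using negligible_standard_hyperplane[of "axis i (1::real)" "2 * pi"]
      by (simp add: inner_axis axis_in_Basis_iff)
    then show "negligible S" if "S \<in> range (\<lambda>i. {x::real^'d. x $ i = 2 * pi})" for S
      using that by blast
  qed simp
  moreover have "S - torus_core \<subseteq> (\<Union>i. {x::real^'d. x $ i = 2 * pi})"
  proof
    fix x assume x: "x \<in> S - torus_core"
    then obtain i where "\<not> (0 \<le> x $ i \<and> x $ i < 2 * pi)" by (auto simp: torus_core_def)
    moreover have "0 \<le> x $ i \<and> x $ i \<le> 2 * pi"
      using x assms(2) by (auto simp: mem_box_cart dest: subsetD)
    ultimately have "x $ i = 2 * pi" by linarith
    then show "x \<in> (\<Union>i. {x. x $ i = 2 * pi})" by blast
  qed
  ultimately have "negligible (S - torus_core)" by (rule negligible_subset)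
  then have "S - torus_core \<in> null_sets lebesgue" by (simp add: negligible_iff_null_sets)
  then have "emeasure lebesgue (S - (S - torus_core)) = emeasure lebesgue S"
    using assms(1) by (rule emeasure_Diff_null_set)
  moreover have "S - (S - torus_core) = S \<inter> torus_core" by auto
  ultimately show ?thesis by simp
qed

text \<open>Cutting and reassembling: the preimage of \<open>S\<close> splits into countably many
  pieces, one for each lattice vector that \<open>wrap\<close> may subtract. Translating every piece
  back yields the disjoint parts \<open>S \<inter> torus_core \<inter> F k\<close> of
  \<open>S\<close>, which together fill it up to a null set.\<close>

lemma wrap_dilates:
  fixes t :: "real^'d"
  shows "dilates torus 1 (\<lambda>x. wrap (x + t))"
proof -
  let ?C = "cbox 0 (\<chi> i. 2 * pi) :: (real^'d) set"
  \<comment> \<open>The points of the preimage for which \<open>wrap\<close> subtracts the lattice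
    vector of index \<open>k\<close>.\<close>
  define E :: "(real^'d) set \<Rightarrow> int^'d \<Rightarrow> (real^'d) set" where "E S k = {x. x + (t - (2 * pi) *\<^sub>R zvec k) \<in> S \<inter> torus_core}" for S k
  have vim: "(\<lambda>x. wrap (x + t)) -` S = (\<Union>k. E S k)" for S
    unfolding E_def using wrap_in_core wrap_eq_iff[of "_ + t"] by (auto simp: wrap_def add_diff_eq)
  have disj: "disjoint_family (E S)" for S
    unfolding E_def disjoint_family_on_def using wrap_eq_iff[of "_ + t"] by (auto simp: add_diff_eq)
  have E: "E S k \<in> sets lebesgue" if "S \<in> sets lebesgue" for S k
    unfolding E_def by (intro lebesgue_shift sets.Int that torus_core_sets)
  show ?thesis
  proof (rule dilatesI)
    show "(\<lambda>x. wrap (x + t)) \<in> torus \<rightarrow>\<^sub>M torus"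
    proof (rule measurableI)
      fix S assume "S \<in> sets (torus :: (real^'d) measure)"
      then have S: "S \<in> sets lebesgue" by (simp add: sets_torus)
      show "(\<lambda>x. wrap (x + t)) -` S \<inter> space torus \<in> sets torus"
        unfolding vim sets_torus space_torus using E[OF S] by auto
    qed (use wrap_in_core torus_core_subset in \<open>auto simp: space_torus\<close>)
    fix S assume "S \<in> sets (torus :: (real^'d) measure)"
    then have S: "S \<in> sets lebesgue" "S \<subseteq> ?C" by (auto simp: sets_torus)
    \<comment> \<open>The points \<open>y\<close> whose preimage under the \<open>k\<close>-th
      branch, \<open>y + 2 pi k - t\<close>, lies in the fundamental domain.\<close>
    define F where "F k = {y. y + ((2 * pi) *\<^sub>R zvec k - t) \<in> torus_core}" for k :: "int^'d"
    have F: "F k \<in> sets lebesgue" for k unfolding F_def by (intro lebesgue_shift torus_core_sets)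
    have shift: "emeasure lebesgue (E S k \<inter> torus_core) = emeasure lebesgue (S \<inter> torus_core \<inter> F k)" for k
    proof -
      have "E S k \<inter> torus_core = {x. x + (t - (2 * pi) *\<^sub>R zvec k) \<in> S \<inter> torus_core \<inter> F k}"
        by (auto simp: E_def F_def)
      then show ?thesis
        using lebesgue_shift(2)[of "S \<inter> torus_core \<inter> F k" "t - (2 * pi) *\<^sub>R zvec k"] sets.Int[OF sets.Int[OF S(1) torus_core_sets] F]
        by (simp only:)
    qed
    have Fdisj: "disjoint_family F"
      unfolding disjoint_family_on_def
    proof (intro ballI impI)
      fix k k' :: "int^'d" assume "k \<noteq> k'"
      have "F k = {y. - k = (\<chi> i. \<lfloor>(y - t) $ i / (2 * pi)\<rfloor>)}" for k
        unfolding F_def wrap_eq_iff[symmetric] by (simp add: zvec_minus algebra_simps)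
      then show "F k \<inter> F k' = {}" using \<open>k \<noteq> k'\<close> by auto (metis neg_equal_iff_equal)
    qed
    have Fun: "(\<Union>k. F k) = UNIV"
    proof -
      have "y \<in> F (- (\<chi> i. \<lfloor>(y - t) $ i / (2 * pi)\<rfloor>))" for y
        using wrap_in_core[of "y - t"] unfolding F_def wrap_def by (simp add: zvec_minus algebra_simps)
      then show ?thesis by blast
    qed
    have "emeasure torus ((\<lambda>x. wrap (x + t)) -` S \<inter> space torus) = emeasure lebesgue ((\<Union>k. E S k) \<inter> ?C)"
      unfolding vim space_torus by (intro emeasure_torus) auto
    also have "\<dots> = emeasure lebesgue ((\<Union>k. E S k) \<inter> ?C \<inter> torus_core)"
      using E[OF S(1)] by (intro torus_core_null[symmetric]) auto
    also have "(\<Union>k. E S k) \<inter> ?C \<inter> torus_core = (\<Union>k. E S k \<inter> torus_core)"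
      using torus_core_subset by blast
    also have "emeasure lebesgue \<dots> = (\<integral>\<^sup>+k. emeasure lebesgue (E S k \<inter> torus_core) \<partial>count_space UNIV)"
      using E[OF S(1)] torus_core_sets disj[of S]
      by (intro emeasure_UN_countable) (auto simp: disjoint_family_on_def)
    also have "\<dots> = (\<integral>\<^sup>+k. emeasure lebesgue (S \<inter> torus_core \<inter> F k) \<partial>count_space UNIV)"
      by (simp add: shift)
    also have "\<dots> = emeasure lebesgue (\<Union>k. S \<inter> torus_core \<inter> F k)"
    proof (rule emeasure_UN_countable[symmetric])
      show "disjoint_family (\<lambda>k. S \<inter> torus_core \<inter> F k)"
        using Fdisj unfolding disjoint_family_on_def by blast
    qed (use S F torus_core_sets in auto)
    also have "(\<Union>k. S \<inter> torus_core \<inter> F k) = S \<inter> torus_core" using Fun by blast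
    also have "emeasure lebesgue (S \<inter> torus_core) = emeasure lebesgue S" by (rule torus_core_null[OF S])
    also have "\<dots> = ennreal 1 * emeasure torus S" by (simp add: emeasure_torus S)
    finally show "emeasure torus ((\<lambda>x. wrap (x + t)) -` S \<inter> space torus) = ennreal 1 * emeasure torus S" .
  qed simp
qed

definition periodic :: "(real^'d \<Rightarrow> complex) \<Rightarrow> bool" where
  "periodic m \<longleftrightarrow> (\<forall>\<xi> k. m (\<xi> + (2 * pi) *\<^sub>R zvec k) = m \<xi>)"

lemma periodic_wrap: "periodic m \<Longrightarrow> m (wrap x) = m x"
  unfolding periodic_def wrap_def by (metis diff_add_cancel)

lemma wrap_periodic: "wrap (x + (2 * pi) *\<^sub>R zvec k) = wrap x"
proof -
  have "(\<chi> i. \<lfloor>(x + (2 * pi) *\<^sub>R zvec k) $ i / (2 * pi)\<rfloor>) = (\<chi> i. \<lfloor>x $ i / (2 * pi)\<rfloor>) + k"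
    by (simp add: vec_eq_iff zvec_nth add_divide_distrib)
  then show ?thesis unfolding wrap_def by (simp add: zvec_add scaleR_add_right)
qed

section \<open>Characters of the torus and Fourier coefficients\<close>

definition character :: "int^'d \<Rightarrow> real^'d \<Rightarrow> complex" where
  "character k \<xi> = exp (- \<i> * of_real (\<xi> \<bullet> zvec k))"

lemma character_add_left: "character k (\<xi> + \<eta>) = character k \<xi> * character k \<eta>"
  by (simp add: character_def inner_add_left distrib_left exp_diff exp_minus divide_inverse)

lemma character_mult_cnj: "character k \<xi> * cnj (character m \<xi>) = character (k - m) \<xi>"
  by (simp add: character_def exp_cnj zvec_diff inner_diff_right flip: exp_add)
     (simp add: algebra_simps)

lemma norm_character: "cmod (character k \<xi>) = 1"
  by (simp add: character_def)

lemma character_0: "character 0 \<xi> = 1"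
  by (simp add: character_def zvec_0)

lemma character_2pi:
  assumes "n \<bullet> zvec k \<in> \<int>"
  shows "character k ((2 * pi) *\<^sub>R n) = 1"
proof -
  obtain m where "n \<bullet> zvec k = of_int m" using assms by (rule Ints_cases)
  then show ?thesis
    unfolding character_def exp_eq_1 by (auto intro!: exI[of _ "- m"])
qed

lemma periodic_character: "periodic (character k)"
  by (simp add: periodic_def character_add_left character_2pi inner_zvec_Ints)

lemma finite_measure_torus: "finite_measure torus"
  by (rule finite_measureI) (simp add: emeasure_torus space_torus emeasure_lborel_cbox_eq)

lemma borel_measurable_character: "character k \<in> borel_measurable torus"
proof -
  have "continuous_on UNIV (character k)" unfolding character_def by (intro continuous_intros)
  then have "character k \<in> borel_measurable borel" by (rule borel_measurable_continuous_onI)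
  then have "character k \<in> borel_measurable lebesgue" by (simp add: measurable_completion)
  then show ?thesis unfolding torus_def by (rule measurable_restrict_space1)
qed

lemma character_in_L2: "character k \<in> L2 torus"
  by (rule L2_comparison[of _ _ "\<lambda>_. 1"])
     (use borel_measurable_character finite_measure.integrable_const[OF finite_measure_torus] in \<open>auto simp: norm_character\<close>)

text \<open>The number \<open>(2 pi)^d\<close>. It is kept as an abstract positive constant because
  it cancels in \<open>filters_orthonormal\<close>.\<close>

definition torus_vol :: "'d::finite itself \<Rightarrow> real" where
  "torus_vol _ = measure (torus :: (real^'d) measure) (space torus)"

lemma torus_vol_pos: "0 < torus_vol TYPE('d::finite)"
proof -
  have "(cbox 0 (\<chi> i. 2 * pi) :: (real^'d) set) \<noteq> {}"
    by (auto simp: interval_ne_empty_cart)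
  then have "measure lebesgue (cbox 0 (\<chi> i. 2 * pi) :: (real^'d) set) = (2 * pi) ^ CARD('d)"
    by (simp add: content_cbox_cart)
  then have "torus_vol TYPE('d) = (2 * pi) ^ CARD('d)"
    by (simp add: torus_vol_def space_torus measure_def emeasure_torus)
  then show ?thesis by simp
qed

text \<open>For \<open>k \<noteq> 0\<close> a translation by half a period in a coordinate with
  \<open>k $ i \<noteq> 0\<close> multiplies the character by \<open>-1\<close>. Invariance of the
  measure makes the integral equal to its negative.\<close>

lemma integral_character:
  "(LINT \<xi>|torus. character k \<xi>) = (if k = 0 then of_real (torus_vol TYPE('d::finite)) else 0)"
  for k :: "int^'d"
proof (cases "k = 0")
  case True
  then show ?thesis using finite_measure.integrable_const[OF finite_measure_torus]
    by (simp add: character_0 torus_vol_def scaleR_conv_of_real)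
next
  case False
  then obtain i where i: "k $ i \<noteq> 0" by (auto simp: vec_eq_iff)
  define t where "t = axis i (pi / real_of_int (k $ i))"
  have "t \<bullet> zvec k = pi"
    using i by (simp add: t_def inner_axis' zvec_nth)
  then have t: "character k t = -1"
    by (simp add: character_def exp_minus)
  have "(LINT \<xi>|torus. character k \<xi>) = (LINT \<xi>|torus. character k (wrap (\<xi> + t)))"
    using dilates_integral(1)[OF wrap_dilates borel_measurable_character, of k t] by simp
  also have "\<dots> = - (LINT \<xi>|torus. character k \<xi>)"
    by (simp add: periodic_wrap periodic_character character_add_left t)
  finally show ?thesis using False by simp
qed

lemma character_orthogonal:
  "L2_inner torus (character k) (character m) = (if k = m then of_real (torus_vol TYPE('d::finite)) else 0)"
  for k m :: "int^'d"
  unfolding L2_inner_def character_mult_cnj integral_character by simp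

text \<open>On trigonometric polynomials orthogonality gives equality with this constant;
  \<open>bessel_from_span\<close> extends the inequality to the whole space.\<close>

lemma bessel_character:
  "bessel torus (character :: int^'d \<Rightarrow> _) UNIV (torus_vol TYPE('d::finite))"
proof (rule bessel_from_span)
  fix X c assume X: "finite (X :: (int^'d) set)"
  let ?v = "torus_vol TYPE('d)"
  let ?G = "\<lambda>x. \<Sum>i\<in>X. c i * character i x"
  have G: "?G \<in> L2 torus" by (intro L2_lincomb character_in_L2)
  have inn: "L2_inner torus ?G (character i) = of_real ?v * c i" if "i \<in> X" for i
    using X that by (subst L2_inner_sum_left)
      (auto simp: character_in_L2 L2_cmult L2_inner_cmult_left character_orthogonal mult.commute if_distrib[of "\<lambda>t. _ * t"] cong: if_cong)
  have "L2_inner torus ?G ?G = (\<Sum>i\<in>X. cnj (c i) * (of_real ?v * c i))"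
    using X G inn by (subst L2_inner_sum_right) (auto simp: character_in_L2 L2_cmult L2_inner_cmult_right)
  also have "\<dots> = of_real (?v * (\<Sum>i\<in>X. (cmod (c i))\<^sup>2))"
    unfolding of_real_mult of_real_sum complex_norm_square by (simp add: sum_distrib_left ac_simps)
  finally have n: "(L2_norm torus ?G)\<^sup>2 = ?v * (\<Sum>i\<in>X. (cmod (c i))\<^sup>2)"
    unfolding L2_inner_self of_real_eq_iff .
  have "(\<Sum>i\<in>X. (cmod (L2_inner torus ?G (character i)))\<^sup>2) = (\<Sum>i\<in>X. ?v\<^sup>2 * (cmod (c i))\<^sup>2)"
    using torus_vol_pos[where 'd='d] by (intro sum.cong) (auto simp: inn norm_mult power_mult_distrib)
  then show "(\<Sum>i\<in>X. (cmod (L2_inner torus ?G (character i)))\<^sup>2) \<le> ?v * (L2_norm torus ?G)\<^sup>2"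
    unfolding n by (simp add: sum_distrib_left power2_eq_square mult.assoc)
qed (use torus_vol_pos character_in_L2 in \<open>auto intro: less_imp_le\<close>)

text \<open>The choice in \<open>fourier_series\<close> has to be shown nonvacuous. The series
  converges by the Bessel bound, and composing its sum with \<open>wrap\<close> makes it periodic:
  the characters do not change under \<open>wrap\<close>, and \<open>wrap\<close> preserves the
  measure.\<close>

lemma fourier_series:
  assumes "(\<lambda>k. (cmod (c k))\<^sup>2) summable_on UNIV"
  shows "periodic (fourier_series c)"
    and "has_L2_sum torus (\<lambda>k \<xi>. c k * character k \<xi>) UNIV (fourier_series c)"
proof -
  obtain g where "has_L2_sum torus (\<lambda>k \<xi>. c k * character k \<xi>) UNIV g"
    using bessel_has_L2_sum[OF bessel_character assms] by blast
  then have "has_L2_sum torus (\<lambda>k \<xi>. c k * character k (wrap (\<xi> + 0))) UNIV (\<lambda>\<xi>. g (wrap (\<xi> + 0)))"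
    by (rule dilates_has_L2_sum[OF wrap_dilates])
  then have "has_L2_sum torus (\<lambda>k \<xi>. c k * character k \<xi>) UNIV (\<lambda>\<xi>. g (wrap \<xi>))"
    by (simp add: periodic_wrap periodic_character)
  moreover have "periodic (\<lambda>\<xi>. g (wrap \<xi>))" by (simp add: periodic_def wrap_periodic)
  ultimately have "\<exists>m. periodic m \<and> has_L2_sum torus (\<lambda>k \<xi>. c k * character k \<xi>) UNIV m" by blast
  moreover have "fourier_series c = (SOME m. periodic m \<and> has_L2_sum torus (\<lambda>k \<xi>. c k * character k \<xi>) UNIV m)"
    unfolding fourier_series_def periodic_def torus_def character_def ..
  ultimately show "periodic (fourier_series c)"
    and "has_L2_sum torus (\<lambda>k \<xi>. c k * character k \<xi>) UNIV (fourier_series c)"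
    using someI_ex[of "\<lambda>m. periodic m \<and> has_L2_sum torus (\<lambda>k \<xi>. c k * character k \<xi>) UNIV m"] by auto
qed

lemma has_L2_sum_shift:
  assumes "has_L2_sum torus (\<lambda>k \<xi>. c k * character k \<xi>) UNIV m" "periodic m"
  shows "has_L2_sum torus (\<lambda>k \<xi>. (c k * character k t) * character k \<xi>) UNIV (\<lambda>\<xi>. m (\<xi> + t))"
  using dilates_has_L2_sum[OF wrap_dilates assms(1), of t]
  by (simp add: periodic_wrap periodic_character assms(2) character_add_left ac_simps)

lemma has_L2_sum_coefficient:
  fixes n :: "int^'d"
  assumes "has_L2_sum torus (\<lambda>k \<xi>. c k * character k \<xi>) UNIV m"
  shows "L2_inner torus (character n) m = of_real (torus_vol TYPE('d::finite)) * cnj (c n)"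
proof -
  have "((\<lambda>k. L2_inner torus (character n) (\<lambda>\<xi>. c k * character k \<xi>)) has_sum L2_inner torus (character n) m) UNIV"
    using assms by (rule has_L2_sum_inner_right) (rule character_in_L2)
  moreover have "((\<lambda>k. L2_inner torus (character n) (\<lambda>\<xi>. c k * character k \<xi>)) has_sum
      of_real (torus_vol TYPE('d)) * cnj (c n)) UNIV"
    by (rule has_sum_finite_neutralI[where B = "{n}"])
       (auto simp: L2_inner_cmult_right character_orthogonal)
  ultimately show ?thesis by (rule has_sum_unique)
qed

subsection \<open>Dilation matrices and digits\<close>

lemma poly_of_int: "poly (of_int n) x = of_int n"
  by (metis of_int_poly poly_const_conv)

lemma eigenvector_exists:
  fixes M :: "complex^'d^'d"
  assumes "det (M - mat z) = 0"
  shows "\<exists>v. v \<noteq> 0 \<and> M *v v = z *s v"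
proof -
  have "\<not> invertible (M - mat z)" using assms invertible_det_nz by blast
  then have "\<not> (\<exists>B. B ** (M - mat z) = mat 1)"
    by (simp add: invertible_left_inverse)
  then obtain v where v: "v \<noteq> 0" "(M - mat z) *v v = 0"
    unfolding matrix_left_invertible_ker by blast
  have "(M - mat z) *v v = M *v v - z *s v"
    by (simp add: vec_eq_iff matrix_vector_mult_def mat_def left_diff_distrib sum_subtractf
        if_distrib[of "\<lambda>t. t * _"] cong: if_cong)
  then show ?thesis using v by auto
qed

text \<open>The determinant is the value at \<open>0\<close> of the characteristic polynomial, hence up to sign
  the product of its roots.\<close>

lemma det_gt_1_if_expanding:
  fixes M :: "complex^'d^'d"
  assumes ev: "\<And>z v. v \<noteq> 0 \<Longrightarrow> M *v v = z *s v \<Longrightarrow> 1 < cmod z"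
  shows "1 < cmod (det M)"
proof -
  \<comment> \<open>The matrix \<open>M - X I\<close> over the polynomials, whose determinant
    evaluates at \<open>z\<close> to \<open>det (M - mat z)\<close>.\<close>
  define Q :: "complex poly^'d^'d" where "Q = (\<chi> i j. [:M $ i $ j:] - (if i = j then [:0, 1:] else 0))"
  define p where "p = det Q"
  define n where "n = CARD('d)"
  have n: "0 < n" by (simp add: n_def)
  have pz: "poly p z = det (M - mat z)" for z
    unfolding p_def det_def
    by (simp add: poly_sum poly_prod poly_of_int Q_def mat_def if_distrib[of "\<lambda>q. poly q z"] cong: if_cong)
  have degQ: "degree (Q $ i $ j) \<le> (if i = j then 1 else 0)" for i j
    by (auto simp: Q_def intro: degree_diff_le)
  \<comment> \<open>A permutation other than the identity moves some \<open>k\<close>, and the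
    factor in row \<open>k\<close> is off the diagonal, hence constant.\<close>
  have deg: "degree (\<Prod>i\<in>UNIV. Q $ i $ \<sigma> i) < n" if "\<sigma> permutes UNIV" "\<sigma> \<noteq> id" for \<sigma>
  proof -
    obtain k where k: "k \<noteq> \<sigma> k" using \<open>\<sigma> \<noteq> id\<close> by (metis eq_id_iff)
    have "degree (\<Prod>i\<in>UNIV. Q $ i $ \<sigma> i) \<le> (\<Sum>i\<in>UNIV. degree (Q $ i $ \<sigma> i))"
      by (rule degree_prod_sum_le[unfolded comp_def]) simp
    also have "\<dots> \<le> (\<Sum>i\<in>UNIV. if i = k then 0 else 1)"
      using k by (intro sum_mono order_trans[OF degQ]) auto
    also have "\<dots> = n - 1"
      by (simp add: n_def sum.If_cases Compl_eq_Diff_UNIV card_Diff_singleton)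
    finally show ?thesis using n by simp
  qed
  have lead: "coeff (\<Prod>i\<in>UNIV. Q $ i $ i) n = (-1) ^ n"
  proof -
    have Qi: "Q $ i $ i = [:M $ i $ i, -1:]" for i by (simp add: Q_def)
    have "degree (\<Prod>i\<in>UNIV. Q $ i $ i) = n"
      by (subst degree_prod_eq_sum_degree) (auto simp: Qi n_def)
    moreover have "lead_coeff (\<Prod>i\<in>UNIV. Q $ i $ i) = (-1) ^ n"
      by (subst lead_coeff_prod) (simp add: Qi n_def)
    ultimately show ?thesis by metis
  qed
  have "coeff p n = (\<Sum>\<sigma>\<in>{\<sigma>. \<sigma> permutes UNIV}. coeff (of_int (sign \<sigma>) * (\<Prod>i\<in>UNIV. Q $ i $ \<sigma> i)) n)"
    by (simp add: p_def det_def coeff_sum)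
  also have "\<dots> = (\<Sum>\<sigma>\<in>{\<sigma>. \<sigma> permutes (UNIV :: 'd set)}. if \<sigma> = id then (-1) ^ n else 0)"
  proof (intro sum.cong refl)
    fix \<sigma> :: "'d \<Rightarrow> 'd" assume "\<sigma> \<in> {\<sigma>. \<sigma> permutes UNIV}"
    then show "coeff (of_int (sign \<sigma>) * (\<Prod>i\<in>UNIV. Q $ i $ \<sigma> i)) n = (if \<sigma> = id then (-1) ^ n else 0)"
      using deg[of \<sigma>] lead by (auto simp: sign_id of_int_poly coeff_eq_0)
  qed
  also have "\<dots> = (-1) ^ n"
    by (simp add: finite_permutations permutes_id)
  finally have cn: "coeff p n = (-1) ^ n" .
  have "degree p \<le> n"
    unfolding p_def det_def
  proof (intro degree_sum_le)
    fix \<sigma> :: "'d \<Rightarrow> 'd" assume "\<sigma> \<in> {\<sigma>. \<sigma> permutes UNIV}"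
    have "degree (of_int (sign \<sigma>) * (\<Prod>i\<in>UNIV. Q $ i $ \<sigma> i)) \<le> degree (\<Prod>i\<in>UNIV. Q $ i $ \<sigma> i)"
      by (simp add: of_int_poly)
    also have "\<dots> \<le> (\<Sum>i\<in>UNIV. degree (Q $ i $ \<sigma> i))"
      by (rule degree_prod_sum_le[unfolded comp_def]) simp
    also have "\<dots> \<le> (\<Sum>i\<in>(UNIV::'d set). 1)"
      by (intro sum_mono order_trans[OF degQ]) auto
    finally show "degree (of_int (sign \<sigma>) * (\<Prod>i\<in>UNIV. Q $ i $ \<sigma> i)) \<le> n" by (simp add: n_def)
  qed (simp add: finite_permutations)
  moreover have "n \<le> degree p" by (rule le_degree) (simp add: cn)
  ultimately have degp: "degree p = n" by simp
  then have lc: "lead_coeff p = (-1) ^ n" using cn by simp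
  have pne: "p \<noteq> 0" using degp n by auto
  have root: "1 < cmod z" if "poly p z = 0" for z
    using eigenvector_exists[of M z] that ev by (auto simp: pz)
  have fin: "finite {z. poly p z = 0}" by (rule poly_roots_finite[OF pne])
  \<comment> \<open>An empty product would only give the value \<open>1\<close>; the strict
    inequality needs at least one root, which exists since the degree \<open>n\<close> is
    positive.\<close>
  obtain z0 where z0: "poly p z0 = 0"
    using fundamental_theorem_of_algebra[of p] degp n by (auto simp: constant_degree)
  have "poly p 0 = poly (smult (lead_coeff p) (\<Prod>z|poly p z = 0. [:-z, 1:] ^ order z p)) 0"
    by (simp only: complex_poly_decompose)
  then have "cmod (poly p 0) = (\<Prod>z|poly p z = 0. cmod z ^ order z p)"
    by (simp add: lc poly_prod norm_mult norm_power prod_norm[symmetric])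
  also have "1 < (\<Prod>z|poly p z = 0. cmod z ^ order z p)"
    by (rule less_1_prod2[OF fin, of z0])
       (use z0 root pne in \<open>auto intro!: one_less_power simp: order_root less_imp_le one_le_power\<close>)
  finally show ?thesis by (simp add: pz)
qed

lemma dilation_matrix_det:
  assumes "dilation_matrix A"
  shows "1 < \<bar>det A\<bar>"
proof -
  have "1 < cmod (det (\<chi> i j. complex_of_real (A $ i $ j)))"
    using assms by (intro det_gt_1_if_expanding) (auto simp: dilation_matrix_def)
  also have "det (\<chi> i j. complex_of_real (A $ i $ j)) = complex_of_real (det A)"
    by (simp add: det_def)
  finally show ?thesis by simp
qed

text \<open>The action of \<open>A\<close> on the lattice, read on integer vectors; the inverse of
  \<open>zvec\<close> is legitimate because a dilation matrix maps the lattice into itself.\<close>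

definition lattice_map :: "real^'d^'d \<Rightarrow> int^'d \<Rightarrow> int^'d" where
  "lattice_map A k = inv zvec (A *v zvec k)"

lemma zvec_lattice_map:
  assumes "dilation_matrix A"
  shows "zvec (lattice_map A k) = A *v zvec k"
  unfolding lattice_map_def using assms by (intro f_inv_into_f) (simp add: dilation_matrix_def)

lemma inj_lattice_map:
  assumes "dilation_matrix A"
  shows "inj (lattice_map A)"
proof (rule injI)
  fix k m assume "lattice_map A k = lattice_map A m"
  then have "A *v zvec k = A *v zvec m" using zvec_lattice_map[OF assms] by metis
  moreover have "det A \<noteq> 0" using dilation_matrix_det[OF assms] by auto
  ultimately have "zvec k = zvec m" by (metis matrix_inv_cancel(4))
  then show "k = m" by (simp add: zvec_inject)
qed

lemma lattice_map_minus:
  assumes "dilation_matrix A"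
  shows "lattice_map A (- k) = - lattice_map A k"
proof -
  have "zvec (lattice_map A (- k)) = zvec (- lattice_map A k)"
    by (simp add: zvec_lattice_map[OF assms] zvec_minus)
       (metis matrix_vector_mult_diff_distrib diff_0 matrix_vector_mult_0_right)
  then show ?thesis by (simp only: zvec_inject)
qed

text \<open>Orthogonality of characters on the quotient \<open>Z^d / B Z^d\<close>. The map
  \<open>\<psi>\<close> is a character of this group, and it is trivial exactly if the inverse of
  \<open>A\<close> maps \<open>n\<close> to an integral vector. If
  \<open>\<psi> b \<noteq> 1\<close> for some \<open>b\<close>, then adding \<open>b\<close>
  permutes the cosets and multiplies the sum by \<open>\<psi> b\<close>, so the sum is
  \<open>0\<close>.\<close>

lemma digit_character_sum:
  fixes A :: "real^'d^'d"
  assumes A: "dilation_matrix A" and K: "digit_set (transpose A) K" and \<beta>: "bij_betw \<beta> {..<a} K"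
  shows "(\<Sum>s<a. character n ((2 * pi) *\<^sub>R (matrix_inv (transpose A) *v zvec (\<beta> s))))
    = (if n \<in> range (lattice_map A) then of_nat a else 0)"
proof -
  define B where "B = transpose A"
  have detA: "det A \<noteq> 0" using dilation_matrix_det[OF A] by auto
  then have detB: "det B \<noteq> 0" by (simp add: B_def)
  have adj: "(matrix_inv B *v x) \<bullet> y = x \<bullet> (matrix_inv A *v y)" for x y
  proof -
    have "(matrix_inv B *v x) \<bullet> y = (matrix_inv B *v x) \<bullet> (A *v (matrix_inv A *v y))"
      by (simp add: matrix_inv_cancel[OF detA])
    also have "\<dots> = (B *v (matrix_inv B *v x)) \<bullet> (matrix_inv A *v y)"
      unfolding B_def transpose_matrix_vector by (rule dot_lmul_matrix[symmetric])
    finally show ?thesis by (simp add: matrix_inv_cancel[OF detB])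
  qed
  define \<psi> where "\<psi> b = character n ((2 * pi) *\<^sub>R (matrix_inv B *v zvec b))" for b
  have psi_add: "\<psi> (b + c) = \<psi> b * \<psi> c" for b c
    by (simp add: \<psi>_def zvec_add matrix_vector_right_distrib scaleR_add_right character_add_left)
  have "(\<Sum>k\<in>K. \<psi> k) = (if n \<in> range (lattice_map A) then of_nat a else 0)"
  proof (cases "n \<in> range (lattice_map A)")
    case True
    then obtain m where m: "zvec n = A *v zvec m" using zvec_lattice_map[OF A] by auto
    have "\<psi> b = 1" for b
      unfolding \<psi>_def by (intro character_2pi) (simp add: adj m matrix_inv_cancel[OF detA] inner_zvec_Ints)
    moreover have "card K = a" using bij_betw_same_card[OF \<beta>] by simp
    ultimately show ?thesis using True by simp
  next
    case False
    \<comment> \<open>If \<open>\<psi>\<close> were trivial, its values at the unit vectors would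
      make every coordinate of \<open>matrix_inv A *v zvec n\<close> an integer, putting
      \<open>n\<close> into the range of \<open>lattice_map A\<close>.\<close>
    have "\<exists>b. \<psi> b \<noteq> 1"
    proof (rule ccontr)
      assume "\<nexists>b. \<psi> b \<noteq> 1"
      then have one: "\<psi> (axis i 1) = 1" for i by blast
      have "(matrix_inv A *v zvec n) $ i \<in> \<int>" for i
      proof -
        have "zvec (axis i 1) = (axis i 1 :: real^'d)" by (simp add: vec_eq_iff zvec_nth axis_def)
        then have "character n ((2 * pi) *\<^sub>R (matrix_inv B *v zvec (axis i 1)))
            = exp (- \<i> * of_real (2 * pi * (matrix_inv A *v zvec n) $ i))"
          by (simp add: character_def adj inner_axis')
        then have "exp (- \<i> * of_real (2 * pi * (matrix_inv A *v zvec n) $ i)) = 1"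
          using one[of i] unfolding \<psi>_def by simp
        then have "\<exists>k::int. Im (- \<i> * of_real (2 * pi * (matrix_inv A *v zvec n) $ i)) = of_int (2 * k) * pi"
          by (simp only: exp_eq_1)
        then obtain k :: int where "Im (- \<i> * of_real (2 * pi * (matrix_inv A *v zvec n) $ i)) = of_int (2 * k) * pi"
          by (rule exE)
        moreover have "Im (- \<i> * of_real (2 * pi * y)) = - (2 * pi * y)" for y by simp
        ultimately have "- (2 * pi * (matrix_inv A *v zvec n) $ i) = 2 * of_int k * pi"
          by (simp only: of_int_mult of_int_numeral)
        then have "2 * pi * ((matrix_inv A *v zvec n) $ i + of_int k) = 0" by algebra
        then have "(matrix_inv A *v zvec n) $ i + of_int k = 0" by (metis mult_eq_0_iff pi_neq_zero zero_neq_numeral)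
        then have "(matrix_inv A *v zvec n) $ i = of_int (- k)" unfolding of_int_minus by (rule eq_neg_iff_add_eq_0[THEN iffD2])
        then show ?thesis by (metis Ints_of_int)
      qed
      then have "\<forall>i. \<exists>k. (matrix_inv A *v zvec n) $ i = of_int k" by (auto elim: Ints_cases)
      then obtain k where "\<And>i. (matrix_inv A *v zvec n) $ i = of_int (k i)" by metis
      then have "matrix_inv A *v zvec n = zvec (\<chi> i. k i)" by (simp add: vec_eq_iff zvec_nth)
      then have "zvec n = A *v zvec (\<chi> i. k i)" by (metis matrix_inv_cancel(3)[OF detA])
      then have "n = lattice_map A (\<chi> i. k i)" by (simp add: zvec_lattice_map[OF A] flip: zvec_inject)
      with False show False by blast
    qed
    then obtain b where b: "\<psi> b \<noteq> 1" by blast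
    have "\<exists>r. r \<in> K \<and> (\<exists>m. zvec x - zvec r = B *v zvec m)" for x
      using K unfolding digit_set_def B_def by blast
    \<comment> \<open>\<open>rep x\<close> is the digit in the coset of \<open>x\<close>. It turns
      addition of \<open>b\<close>, which leaves \<open>K\<close>, into a permutation of
      \<open>K\<close> along which \<open>\<psi>\<close> changes only by the factor
      \<open>\<psi> b\<close>.\<close>
    then obtain rep where rep: "\<And>x. rep x \<in> K" "\<And>x. \<exists>m. zvec x - zvec (rep x) = B *v zvec m"
      by metis
    have psi_rep: "\<psi> (rep x) = \<psi> x" for x
    proof -
      obtain m where m: "zvec x - zvec (rep x) = B *v zvec m" using rep by blast
      have "\<psi> (x - rep x) = 1"
        unfolding \<psi>_def zvec_diff m
        by (intro character_2pi) (simp add: matrix_inv_cancel[OF detB] inner_zvec_Ints)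
      then show ?thesis using psi_add[of "x - rep x" "rep x"] by simp
    qed
    have "inj_on (\<lambda>k. rep (k + b)) K"
    proof (rule inj_onI)
      fix k k' assume k: "k \<in> K" "k' \<in> K" "rep (k + b) = rep (k' + b)"
      obtain m m' where "zvec (k + b) - zvec (rep (k + b)) = B *v zvec m"
        "zvec (k' + b) - zvec (rep (k' + b)) = B *v zvec m'" using rep by blast
      moreover have "zvec k - zvec k' = (zvec (k + b) - zvec (rep (k + b))) - (zvec (k' + b) - zvec (rep (k' + b)))"
        using k(3) by (simp add: zvec_add)
      ultimately have "zvec k - zvec k' = B *v zvec (m - m')"
        by (simp only: zvec_diff matrix_vector_mult_diff_distrib)
      moreover have "zvec k - zvec k = B *v zvec 0" by (simp add: zvec_0)
      ultimately show "k = k'" using K k unfolding digit_set_def B_def by blast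
    qed
    moreover have "finite K" using \<beta> by (metis bij_betw_finite finite_lessThan)
    ultimately have "bij_betw (\<lambda>k. rep (k + b)) K K"
      using rep(1) by (simp add: bij_betw_def endo_inj_surj image_subsetI)
    then have "(\<Sum>k\<in>K. \<psi> k) = (\<Sum>k\<in>K. \<psi> (rep (k + b)))"
      by (rule sum.reindex_bij_betw[symmetric])
    also have "\<dots> = \<psi> b * (\<Sum>k\<in>K. \<psi> k)"
      by (simp add: psi_rep psi_add sum_distrib_left mult.commute)
    finally have "(\<Sum>k\<in>K. \<psi> k) = 0" using b by (simp add: mult_cancel_right1)
    then show ?thesis using False by simp
  qed
  then show ?thesis
    using sum.reindex_bij_betw[OF \<beta>, of \<psi>] by (simp add: \<psi>_def B_def)
qed

subsection \<open>Orthonormality of the filters\<close>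

lemma has_sum_finite_Times:
  fixes f :: "'s \<times> 'i \<Rightarrow> 'b::{topological_comm_monoid_add, t2_space}"
  assumes "finite S" "\<And>s. s \<in> S \<Longrightarrow> ((\<lambda>i. f (s, i)) has_sum g s) A"
  shows "(f has_sum (\<Sum>s\<in>S. g s)) (S \<times> A)"
  using assms
proof (induction S)
  case (insert s S)
  have "(f has_sum g s) ({s} \<times> A)"
  proof -
    have "inj_on (Pair s) A" by (auto simp: inj_on_def)
    then have "(f has_sum g s) (Pair s ` A)"
      using insert.prems[of s] by (subst has_sum_reindex) (auto simp: comp_def)
    also have "Pair s ` A = {s} \<times> A" by auto
    finally show ?thesis .
  qed
  moreover have "(f has_sum (\<Sum>s\<in>S. g s)) (S \<times> A)" using insert by auto
  ultimately have "(f has_sum (g s + (\<Sum>s\<in>S. g s))) ({s} \<times> A \<union> S \<times> A)"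
    using insert.hyps by (intro has_sum_Un_disjoint) auto
  also have "{s} \<times> A \<union> S \<times> A = insert s S \<times> A" by auto
  finally show ?case using insert.hyps by simp
qed simp

locale unitary_filters =
  fixes A :: "real^'d^'d" and a :: nat and K :: "(int^'d) set" and \<beta> :: "nat \<Rightarrow> int^'d"
    and h :: "nat \<Rightarrow> 'l::finite \<Rightarrow> 'l \<Rightarrow> int^'d \<Rightarrow> complex"
  assumes dilation: "dilation_matrix A"
    and a_det: "real a = \<bar>det A\<bar>"
    and digits: "digit_set (transpose A) K" "bij_betw \<beta> {..<a} K"
    and h_summable: "\<And>r l j. r < a \<Longrightarrow> (\<lambda>k. (cmod (h r l j k))\<^sup>2) summable_on UNIV"
    and unitary: "AE \<xi> in lebesgue.
      unitary_matrix_on ({..<a} \<times> UNIV) (filter_matrix (transpose A) a \<beta> h \<xi>)"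
begin

lemma a_gt_1: "1 < a"
proof -
  have "1 < real a" using dilation_matrix_det[OF dilation] a_det by simp
  then show ?thesis by simp
qed

lemma det_nonzero: "det A \<noteq> 0"
  using dilation_matrix_det[OF dilation] by auto

definition digit_shift :: "nat \<Rightarrow> real^'d" where
  "digit_shift s = (2 * pi) *\<^sub>R (matrix_inv (transpose A) *v zvec (\<beta> s))"

text \<open>Up to a factor, the part of the Fourier series \<open>m\<close> with frequencies in \<open>k + A\<int>\<^sup>d\<close>.\<close>

definition decimate :: "int^'d \<Rightarrow> (real^'d \<Rightarrow> complex) \<Rightarrow> real^'d \<Rightarrow> complex" where
  "decimate k m \<xi> = (\<Sum>s<a. cnj (character k (digit_shift s)) * m (\<xi> + digit_shift s))"

lemma digit_shift_sum:
  "(\<Sum>s<a. character n (digit_shift s)) = (if n \<in> range (lattice_map A) then of_nat a else 0)"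
  unfolding digit_shift_def by (rule digit_character_sum[OF dilation digits])

text \<open>A translation by \<open>digit_shift s\<close> multiplies the coefficient at
  \<open>n\<close> by \<open>character n (digit_shift s)\<close>. The sum over \<open>s\<close> is
  therefore the digit sum at \<open>n - k\<close>, which is \<open>a\<close> on the coset of
  \<open>k\<close> and \<open>0\<close> elsewhere.\<close>

lemma decimate_has_L2_sum:
  assumes "has_L2_sum torus (\<lambda>n \<xi>. c n * character n \<xi>) UNIV m" "periodic m"
  shows "has_L2_sum torus (\<lambda>n \<xi>. (c n * (if n - k \<in> range (lattice_map A) then of_nat a else 0)) * character n \<xi>)
    UNIV (decimate k m)"
proof -
  have "has_L2_sum torus
      (\<lambda>n \<xi>. \<Sum>s<a. cnj (character k (digit_shift s)) * ((c n * character n (digit_shift s)) * character n \<xi>))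
      UNIV (\<lambda>\<xi>. \<Sum>s<a. cnj (character k (digit_shift s)) * m (\<xi> + digit_shift s))"
    by (intro has_L2_sum_finite_sum has_L2_sum_cmult has_L2_sum_shift assms) simp
  moreover have "(\<Sum>s<a. cnj (character k (digit_shift s)) * ((c n * character n (digit_shift s)) * character n \<xi>))
      = (c n * (if n - k \<in> range (lattice_map A) then of_nat a else 0)) * character n \<xi>" for n \<xi>
  proof -
    have "(\<Sum>s<a. cnj (character k (digit_shift s)) * ((c n * character n (digit_shift s)) * character n \<xi>))
        = (\<Sum>s<a. c n * character n \<xi> * (character n (digit_shift s) * cnj (character k (digit_shift s))))"
      by (simp add: ac_simps)
    then show ?thesis
      by (simp only: character_mult_cnj sum_distrib_left[symmetric] digit_shift_sum) (simp add: ac_simps)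
  qed
  ultimately show ?thesis unfolding decimate_def by simp
qed

text \<open>Parseval's identity for two decimated series, written as the convergence of its
  right-hand side. The two decimations contribute the factor \<open>a^2\<close>, and the extra
  character aligns the cosets of \<open>k\<close> and \<open>k'\<close>, so that only matching
  frequencies meet.\<close>

lemma decimate_inner:
  assumes m: "has_L2_sum torus (\<lambda>n \<xi>. c n * character n \<xi>) UNIV m" "periodic m"
    and m': "has_L2_sum torus (\<lambda>n \<xi>. c' n * character n \<xi>) UNIV m'" "periodic m'"
  shows "((\<lambda>n. of_real ((real a)\<^sup>2 * torus_vol TYPE('d)) * (c (k - lattice_map A n) * cnj (c' (k' - lattice_map A n))))
    has_sum (LINT \<xi>|torus. decimate k m \<xi> * cnj (decimate k' m' \<xi>) * cnj (character (k - k') \<xi>))) UNIV"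
proof -
  define R where "R = range (lattice_map A)"
  \<comment> \<open>Multiplication by this character moves the frequencies of
    \<open>decimate k' m'\<close> from the coset of \<open>k'\<close> to that of
    \<open>k\<close>.\<close>
  define G where "G \<xi> = character (k - k') \<xi> * decimate k' m' \<xi>" for \<xi>
  note d = decimate_has_L2_sum[OF m, of k] and d' = decimate_has_L2_sum[OF m', of k']
  have D: "decimate k m \<in> L2 torus" "decimate k' m' \<in> L2 torus"
    using d d' by (auto dest: has_L2_sum_in_L2)
  have G: "G \<in> L2 torus"
    unfolding G_def
    by (rule L2_comparison[OF _ L2_integrable[OF D(2)]])
       (use L2_measurable[OF D(2)] borel_measurable_character in
         \<open>auto intro!: borel_measurable_times simp: norm_mult norm_character\<close>)
  have GI: "L2_inner torus (character n) G
      = of_real (torus_vol TYPE('d)) * cnj (c' (n - k + k') * (if n - k \<in> R then of_nat a else 0))" for n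
  proof -
    have "L2_inner torus (character n) G = L2_inner torus (character (n - k + k')) (decimate k' m')"
      unfolding L2_inner_def G_def
      by (simp add: mult.assoc[symmetric] character_mult_cnj algebra_simps)
    then show ?thesis using has_L2_sum_coefficient[OF d', of "n - k + k'"] by (simp add: R_def)
  qed
  define t where "t n = of_real ((real a)\<^sup>2 * torus_vol TYPE('d)) * (c n * cnj (c' (n - k + k')))" for n
  have "((\<lambda>n. L2_inner torus (\<lambda>\<xi>. (c n * (if n - k \<in> R then of_nat a else 0)) * character n \<xi>) G)
      has_sum L2_inner torus (decimate k m) G) UNIV"
    unfolding R_def by (rule has_L2_sum_inner_left[OF d G])
  then have "((\<lambda>n. if n - k \<in> R then t n else 0) has_sum L2_inner torus (decimate k m) G) UNIV"
    unfolding L2_inner_cmult_left GI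
    by (rule has_sum_cong[THEN iffD1, rotated]) (auto simp: t_def power2_eq_square)
  \<comment> \<open>The surviving frequencies, those with \<open>n - k\<close> in the range, are
    parametrised by \<open>k - lattice_map A n\<close>. The minus sign matches the index
    \<open>k - A m\<close> of the filters and is harmless because the range is symmetric.\<close>
  then have "(t has_sum L2_inner torus (decimate k m) G) ((\<lambda>n. k - lattice_map A n) ` UNIV)"
  proof (rule has_sum_cong_neutral[THEN iffD1, rotated -1])
    fix n assume "n \<in> UNIV - (\<lambda>n. k - lattice_map A n) ` UNIV"
    then have "n - k \<noteq> lattice_map A i" for i
      using lattice_map_minus[OF dilation, of "- i"] by (auto simp: image_iff algebra_simps)
    then show "(if n - k \<in> R then t n else 0) = 0" by (auto simp: R_def)
  next
    fix n assume "n \<in> UNIV \<inter> (\<lambda>n. k - lattice_map A n) ` UNIV"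
    then obtain i where "n = k - lattice_map A i" by auto
    then have "n - k = lattice_map A (- i)" using lattice_map_minus[OF dilation] by simp
    then show "(if n - k \<in> R then t n else 0) = t n" by (auto simp: R_def)
  qed auto
  moreover have "inj (\<lambda>n. k - lattice_map A n)"
    using inj_lattice_map[OF dilation] by (auto simp: inj_def)
  ultimately have "((\<lambda>n. t (k - lattice_map A n)) has_sum L2_inner torus (decimate k m) G) UNIV"
    by (subst (asm) has_sum_reindex) (auto simp: comp_def)
  moreover have "t (k - lattice_map A n)
      = of_real ((real a)\<^sup>2 * torus_vol TYPE('d)) * (c (k - lattice_map A n) * cnj (c' (k' - lattice_map A n)))" for n
    by (simp add: t_def algebra_simps)
  moreover have "L2_inner torus (decimate k m) G
      = (LINT \<xi>|torus. decimate k m \<xi> * cnj (decimate k' m' \<xi>) * cnj (character (k - k') \<xi>))"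
    unfolding L2_inner_def G_def by (simp add: ac_simps)
  ultimately show ?thesis by simp
qed

lemma symbol:
  assumes "r < a"
  shows "periodic (filter_symbol a h r l j)"
    and "has_L2_sum torus (\<lambda>k \<xi>. (h r l j k / sqrt (real a)) * character k \<xi>) UNIV (filter_symbol a h r l j)"
proof -
  have "(\<lambda>k. (cmod (h r l j k))\<^sup>2 / real a) summable_on UNIV"
    using h_summable[OF assms, of l j] unfolding divide_inverse by (rule summable_on_cmult_left)
  then have "(\<lambda>k. (cmod (h r l j k / sqrt (real a)))\<^sup>2) summable_on UNIV"
    by (simp add: norm_divide power_divide)
  from fourier_series[OF this] show "periodic (filter_symbol a h r l j)"
    and "has_L2_sum torus (\<lambda>k \<xi>. (h r l j k / sqrt (real a)) * character k \<xi>) UNIV (filter_symbol a h r l j)"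
    by (simp_all add: filter_symbol_def)
qed

text \<open>Expanding both decimations gives a double sum over \<open>s\<close> and
  \<open>s'\<close> of inner products between the columns \<open>(s, j)\<close> and
  \<open>(s', j')\<close> of the block matrix. Orthonormality leaves the diagonal
  \<open>s = s'\<close> and the condition \<open>j = j'\<close>; what remains is the digit sum at
  \<open>k' - k\<close>.\<close>

lemma sum_decimate_symbols:
  assumes u: "unitary_matrix_on ({..<a} \<times> UNIV) (filter_matrix (transpose A) a \<beta> h \<xi>)"
  shows "(\<Sum>r<a. \<Sum>l\<in>UNIV. decimate k (filter_symbol a h r l j) \<xi> * cnj (decimate k' (filter_symbol a h r l j') \<xi>))
    = (if j = j' \<and> k' - k \<in> range (lattice_map A) then of_nat a else 0)"
proof -
  define m where "m r l j s = filter_symbol a h r l j (\<xi> + digit_shift s)" for r l j s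
  define e where "e k s = character k (digit_shift s)" for k s
  have orth: "(\<Sum>r<a. \<Sum>l\<in>UNIV. m r l j s * cnj (m r l j' s')) = (if s = s' \<and> j = j' then 1 else 0)"
    if "s < a" "s' < a" for s s'
  proof -
    have "(\<Sum>t\<in>{..<a} \<times> UNIV. cnj (filter_matrix (transpose A) a \<beta> h \<xi> t (s', j')) * filter_matrix (transpose A) a \<beta> h \<xi> t (s, j))
        = (if (s', j') = (s, j) then 1 else 0)"
      using u that unfolding unitary_matrix_on_def by blast
    then show ?thesis
      by (auto simp: filter_matrix_def m_def digit_shift_def sum.cartesian_product split_def mult.commute)
  qed
  have "(\<Sum>r<a. \<Sum>l\<in>UNIV. decimate k (filter_symbol a h r l j) \<xi> * cnj (decimate k' (filter_symbol a h r l j') \<xi>))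
      = (\<Sum>r<a. \<Sum>l\<in>UNIV. \<Sum>s<a. \<Sum>s'<a. (cnj (e k s) * e k' s') * (m r l j s * cnj (m r l j' s')))"
    unfolding decimate_def m_def[symmetric] e_def[symmetric] cnj_sum sum_product by (simp add: ac_simps)
  also have "\<dots> = (\<Sum>r<a. \<Sum>s<a. \<Sum>l\<in>UNIV. \<Sum>s'<a. (cnj (e k s) * e k' s') * (m r l j s * cnj (m r l j' s')))"
    by (intro sum.cong refl sum.swap)
  also have "\<dots> = (\<Sum>r<a. \<Sum>s<a. \<Sum>s'<a. \<Sum>l\<in>UNIV. (cnj (e k s) * e k' s') * (m r l j s * cnj (m r l j' s')))"
    by (intro sum.cong refl sum.swap)
  also have "\<dots> = (\<Sum>s<a. \<Sum>r<a. \<Sum>s'<a. \<Sum>l\<in>UNIV. (cnj (e k s) * e k' s') * (m r l j s * cnj (m r l j' s')))"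
    by (rule sum.swap)
  also have "\<dots> = (\<Sum>s<a. \<Sum>s'<a. \<Sum>r<a. \<Sum>l\<in>UNIV. (cnj (e k s) * e k' s') * (m r l j s * cnj (m r l j' s')))"
    by (intro sum.cong refl sum.swap)
  also have "\<dots> = (\<Sum>s<a. \<Sum>s'<a. (cnj (e k s) * e k' s') * (if s = s' \<and> j = j' then 1 else 0))"
    by (intro sum.cong refl) (simp add: orth flip: sum_distrib_left)
  also have "\<dots> = (if j = j' then \<Sum>s<a. e k' s * cnj (e k s) else 0)"
    by (auto intro!: sum.cong simp: if_distrib[of "\<lambda>t. _ * t"] mult.commute cong: if_cong)
  also have "\<dots> = (if j = j' \<and> k' - k \<in> range (lattice_map A) then of_nat a else 0)"
    unfolding e_def character_mult_cnj digit_shift_sum by simp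
  finally show ?thesis .
qed

text \<open>The left-hand side is \<open>decimate_inner\<close>, summed over \<open>r\<close> and
  \<open>l\<close>, and the integrand is known almost everywhere by
  \<open>sum_decimate_symbols\<close>: a constant times \<open>character (k' - k)\<close>, whose
  integral vanishes unless \<open>k = k'\<close>. As for constants, \<open>a^2 * v\<close> from
  Parseval times \<open>1 / a\<close> from the normalisation of the symbols equals the
  \<open>a * v\<close> on the other side.\<close>

lemma filters_orthonormal:
  "((\<lambda>(r, l, n). h r l j (k - lattice_map A n) * cnj (h r l j' (k' - lattice_map A n)))
    has_sum (if (j, k) = (j', k') then 1 else 0)) ({..<a} \<times> UNIV)"
proof -
  define v where "v = torus_vol TYPE('d)"
  have v: "v > 0" by (simp add: v_def torus_vol_pos)
  have a0: "real a > 0" using a_gt_1 by simp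
  define I where "I r l = (LINT \<xi>|torus. decimate k (filter_symbol a h r l j) \<xi>
      * cnj (decimate k' (filter_symbol a h r l j') \<xi>) * cnj (character (k - k') \<xi>))" for r l
  define x where "x r l n = h r l j (k - lattice_map A n) * cnj (h r l j' (k' - lattice_map A n))" for r l n
  have sq: "complex_of_real (sqrt (real a)) * complex_of_real (sqrt (real a)) = of_nat a"
    by (simp flip: of_real_mult)
  have X: "(x r l has_sum (I r l / of_real (real a * v))) UNIV" if "r < a" for r l
  proof -
    have "((\<lambda>n. (of_real ((real a)\<^sup>2 * v) * ((h r l j (k - lattice_map A n) / sqrt (real a))
          * cnj (h r l j' (k' - lattice_map A n) / sqrt (real a)))) / of_real (real a * v))
        has_sum (I r l / of_real (real a * v))) UNIV"
      unfolding I_def v_def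
      by (intro has_sum_divide_const decimate_inner symbol that)
    moreover have "(of_real ((real a)\<^sup>2 * v) * ((h r l j (k - lattice_map A n) / sqrt (real a))
          * cnj (h r l j' (k' - lattice_map A n) / sqrt (real a)))) / of_real (real a * v) = x r l n" for n
      using v a0 sq by (simp add: x_def field_simps power2_eq_square)
    ultimately show ?thesis by simp
  qed
  have sum: "((\<lambda>(r, l, n). x r l n) has_sum (\<Sum>r<a. \<Sum>l\<in>UNIV. I r l / of_real (real a * v))) ({..<a} \<times> UNIV \<times> UNIV)"
  proof (rule has_sum_finite_Times)
    fix r assume "r \<in> {..<a}"
    then have "((\<lambda>(l, n). x r l n) has_sum (\<Sum>l\<in>UNIV. I r l / of_real (real a * v))) (UNIV \<times> UNIV)"
      by (intro has_sum_finite_Times) (use X in simp_all)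
    then show "((\<lambda>i. case (r, i) of (r, l, n) \<Rightarrow> x r l n) has_sum (\<Sum>l\<in>UNIV. I r l / of_real (real a * v))) (UNIV \<times> UNIV)"
      by simp
  qed simp
  have "(\<Sum>r<a. \<Sum>l\<in>UNIV. I r l) = (if (j, k) = (j', k') then of_real (real a * v) else 0)"
  proof -
    have L: "decimate k (filter_symbol a h r l j) \<in> L2 torus" if "r < a" for r l k j
      using decimate_has_L2_sum[OF symbol(2,1)[OF that]] by (rule has_L2_sum_in_L2)
    have int: "integrable torus (\<lambda>\<xi>. decimate k (filter_symbol a h r l j) \<xi>
        * cnj (decimate k' (filter_symbol a h r l j') \<xi>) * cnj (character (k - k') \<xi>))" if "r < a" for r l
    proof (rule Bochner_Integration.integrable_bound[OF integrable_L2_mult[OF L[OF that] L[OF that]]])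
      show "(\<lambda>\<xi>. decimate k (filter_symbol a h r l j) \<xi> * cnj (decimate k' (filter_symbol a h r l j') \<xi>)
          * cnj (character (k - k') \<xi>)) \<in> borel_measurable torus"
        using borel_measurable_character[of "k' - k"] character_mult_cnj[of 0 _ "k - k'"]
          borel_measurable_integrable[OF integrable_L2_mult[OF L[OF that] L[OF that]]]
        by (intro borel_measurable_times[of "\<lambda>\<xi>. _ \<xi> * cnj (_ \<xi>)"]) (simp_all add: character_0)
    qed (auto simp: norm_mult norm_character)
    have AEt: "AE \<xi> in torus. unitary_matrix_on ({..<a} \<times> UNIV) (filter_matrix (transpose A) a \<beta> h \<xi>)"
      unfolding torus_def using unitary by (subst AE_restrict_space_iff) auto
    have "(\<Sum>r<a. \<Sum>l\<in>UNIV. I r l) = (LINT \<xi>|torus. (\<Sum>r<a. \<Sum>l\<in>UNIV. decimate k (filter_symbol a h r l j) \<xi>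
        * cnj (decimate k' (filter_symbol a h r l j') \<xi>) * cnj (character (k - k') \<xi>)))"
      unfolding I_def using int by (simp add: Bochner_Integration.integral_sum Bochner_Integration.integrable_sum)
    also have "\<dots> = (LINT \<xi>|torus. (if j = j' \<and> k' - k \<in> range (lattice_map A) then of_nat a else 0) * character (k' - k) \<xi>)"
    proof (rule integral_cong_AE)
      show "AE \<xi> in torus. (\<Sum>r<a. \<Sum>l\<in>UNIV. decimate k (filter_symbol a h r l j) \<xi>
        * cnj (decimate k' (filter_symbol a h r l j') \<xi>) * cnj (character (k - k') \<xi>))
        = (if j = j' \<and> k' - k \<in> range (lattice_map A) then of_nat a else 0) * character (k' - k) \<xi>"
        using AEt
      proof eventually_elim
        case (elim \<xi>)
        have "cnj (character (k - k') \<xi>) = character (k' - k) \<xi>"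
          using character_mult_cnj[of 0 \<xi> "k - k'"] by (simp add: character_0)
        then show ?case
          by (simp add: sum_decimate_symbols[OF elim] flip: sum_distrib_right)
      qed
      show "(\<lambda>\<xi>. \<Sum>r<a. \<Sum>l\<in>UNIV. decimate k (filter_symbol a h r l j) \<xi>
        * cnj (decimate k' (filter_symbol a h r l j') \<xi>) * cnj (character (k - k') \<xi>)) \<in> borel_measurable torus"
        using int by (intro borel_measurable_sum) (auto intro: borel_measurable_integrable)
    qed (use borel_measurable_character[of "k' - k"] in auto)
    also have "\<dots> = (if j = j' \<and> k' - k \<in> range (lattice_map A) then of_nat a else 0) * (if k' = k then of_real v else 0)"
      by (simp add: integral_character v_def)
    also have "\<dots> = (if (j, k) = (j', k') then of_real (real a * v) else 0)"
    proof -
      \<comment> \<open>For \<open>k = k'\<close> the coset condition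
        \<open>k' - k \<in> range (lattice_map A)\<close> is then automatic, so it disappears from
        the final case distinction.\<close>
      have "lattice_map A 0 = 0"
        by (simp add: zvec_lattice_map[OF dilation] zvec_0 flip: zvec_inject)
      then show ?thesis by (auto simp: image_iff intro: exI[of _ 0])
    qed
    finally show ?thesis .
  qed
  then have "(\<Sum>r<a. \<Sum>l\<in>UNIV. I r l / of_real (real a * v)) = (if (j, k) = (j', k') then 1 else 0)"
    using v a0 by (simp add: sum_divide_distrib[symmetric])
  with sum show ?thesis by (simp only: x_def UNIV_Times_UNIV)
qed

end

subsection \<open>Closed spans and frames\<close>

text \<open>\<open>lin_span\<close> sums over a set of functions, while the families here are
  indexed and may repeat a function. The coefficients of equal functions are therefore
  collected.\<close>

lemma lincomb_in_lin_span:
  assumes X: "finite X" "\<And>i. i \<in> X \<Longrightarrow> u i \<in> U"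
  shows "(\<lambda>x. \<Sum>i\<in>X. c i * u i x) \<in> lin_span U"
proof -
  have "(\<Sum>i\<in>X. c i * u i x) = (\<Sum>v\<in>u ` X. (\<Sum>i\<in>{i \<in> X. u i = v}. c i) * v x)" for x
    by (subst sum.image_gen[OF X(1), of _ u]) (auto simp: sum_distrib_right intro!: sum.cong)
  then show ?thesis
    unfolding lin_span_def using X
    by (auto intro!: exI[of _ "u ` X"] exI[of _ "\<lambda>v. \<Sum>i\<in>{i \<in> X. u i = v}. c i"])
qed

lemma lin_span_in_L2:
  assumes "U \<subseteq> L2 M" "g \<in> lin_span U"
  shows "g \<in> L2 M"
  using assms unfolding lin_span_def by (auto intro!: L2_lincomb)

lemma lin_span_add:
  assumes "f \<in> lin_span U" "g \<in> lin_span U"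
  shows "(\<lambda>x. f x + g x) \<in> lin_span U"
proof -
  obtain F c G d where f: "f = (\<lambda>x. \<Sum>u\<in>F. c u * u x)" "finite F" "F \<subseteq> U"
    and g: "g = (\<lambda>x. \<Sum>u\<in>G. d u * u x)" "finite G" "G \<subseteq> U"
    using assms unfolding lin_span_def by blast
  \<comment> \<open>The disjoint sum keeps the two families apart, since \<open>F\<close> and
    \<open>G\<close> may overlap.\<close>
  have "(\<lambda>x. \<Sum>i\<in>F <+> G. case_sum c d i * case_sum id id i x) \<in> lin_span U"
    using f g by (intro lincomb_in_lin_span) auto
  then show ?thesis using f g by (simp add: sum.Plus)
qed

lemma lin_span_cmult:
  assumes "f \<in> lin_span U"
  shows "(\<lambda>x. b * f x) \<in> lin_span U"
proof -
  obtain F c where f: "f = (\<lambda>x. \<Sum>u\<in>F. c u * u x)" "finite F" "F \<subseteq> U"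
    using assms unfolding lin_span_def by blast
  have "(\<lambda>x. \<Sum>u\<in>F. (b * c u) * id u x) \<in> lin_span U"
    using f by (intro lincomb_in_lin_span) auto
  then show ?thesis using f by (simp add: sum_distrib_left mult.assoc)
qed

lemma L2_closure_in_L2: "f \<in> L2_closure M U \<Longrightarrow> f \<in> L2 M"
  by (simp add: L2_closure_def)

lemma L2_closure_superset:
  assumes "f \<in> U" "f \<in> L2 M"
  shows "f \<in> L2_closure M U"
  using assms by (auto simp: L2_closure_def L2_norm_def intro!: bexI[of _ f])

lemma L2_closure_closed:
  assumes U: "U \<subseteq> L2 M" and f: "f \<in> L2 M"
    and approx: "\<And>e. e > 0 \<Longrightarrow> \<exists>g\<in>L2_closure M U. L2_norm M (\<lambda>x. f x - g x) < e"
  shows "f \<in> L2_closure M U"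
  unfolding L2_closure_def
proof (intro CollectI conjI allI impI f)
  fix e :: real assume "e > 0"
  then obtain g where g: "g \<in> L2_closure M U" "L2_norm M (\<lambda>x. f x - g x) < e / 2"
    using approx[of "e / 2"] by auto
  then obtain u where u: "u \<in> U" "L2_norm M (\<lambda>x. g x - u x) < e / 2"
    using \<open>e > 0\<close> unfolding L2_closure_def by (auto dest: spec[of _ "e / 2"])
  have "L2_norm M (\<lambda>x. f x - u x) < e"
    using L2_norm_triangle_diff[OF f L2_closure_in_L2[OF g(1)] subsetD[OF U u(1)]] g u by linarith
  then show "\<exists>g\<in>U. L2_norm M (\<lambda>x. f x - g x) < e" using u by blast
qed

lemma L2_closure_span_add:
  assumes R: "R \<subseteq> L2 M" and f: "f \<in> L2_closure M (lin_span R)" and g: "g \<in> L2_closure M (lin_span R)"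
  shows "(\<lambda>x. f x + g x) \<in> L2_closure M (lin_span R)"
  unfolding L2_closure_def
proof (intro CollectI conjI allI impI)
  have L: "f \<in> L2 M" "g \<in> L2 M" using f g by (auto dest: L2_closure_in_L2)
  then show "(\<lambda>x. f x + g x) \<in> L2 M" by (rule L2_add)
  fix e :: real assume "e > 0"
  then obtain u v where u: "u \<in> lin_span R" "L2_norm M (\<lambda>x. f x - u x) < e / 2"
    and v: "v \<in> lin_span R" "L2_norm M (\<lambda>x. g x - v x) < e / 2"
    using f g unfolding L2_closure_def by (auto dest!: spec[of _ "e / 2"])
  have "L2_norm M (\<lambda>x. (f x - u x) + (g x - v x)) \<le> L2_norm M (\<lambda>x. f x - u x) + L2_norm M (\<lambda>x. g x - v x)"
    by (intro L2_norm_triangle L2_diff L lin_span_in_L2[OF R] u v)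
  then have "L2_norm M (\<lambda>x. (f x + g x) - (u x + v x)) < e"
    using u v by (simp add: algebra_simps)
  then show "\<exists>w\<in>lin_span R. L2_norm M (\<lambda>x. (f x + g x) - w x) < e"
    using lin_span_add[OF u(1) v(1)] by (auto intro!: bexI[of _ "\<lambda>x. u x + v x"])
qed

lemma L2_closure_span_cmult:
  assumes f: "f \<in> L2_closure M (lin_span R)"
  shows "(\<lambda>x. b * f x) \<in> L2_closure M (lin_span R)"
  unfolding L2_closure_def
proof (intro CollectI conjI allI impI)
  show "(\<lambda>x. b * f x) \<in> L2 M" using f by (intro L2_cmult L2_closure_in_L2)
  fix e :: real assume e: "e > 0"
  then have "e / (cmod b + 1) > 0" by (simp add: add_nonneg_pos)
  then obtain u where u: "u \<in> lin_span R" "L2_norm M (\<lambda>x. f x - u x) < e / (cmod b + 1)"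
    using f unfolding L2_closure_def by blast
  have "L2_norm M (\<lambda>x. b * f x - b * u x) = cmod b * L2_norm M (\<lambda>x. f x - u x)"
    unfolding right_diff_distrib[symmetric] by (rule L2_norm_cmult)
  also have "\<dots> \<le> cmod b * (e / (cmod b + 1))"
    using u by (intro mult_left_mono) auto
  also have "\<dots> = e * (cmod b / (cmod b + 1))" by simp
  also have "\<dots> < e * 1"
    using e by (intro mult_strict_left_mono) (simp_all add: divide_less_eq_1_pos add_nonneg_pos)
  finally have "L2_norm M (\<lambda>x. b * f x - b * u x) < e" by simp
  then show "\<exists>w\<in>lin_span R. L2_norm M (\<lambda>x. b * f x - w x) < e"
    using lin_span_cmult[OF u(1)] by (auto intro!: bexI[of _ "\<lambda>x. b * u x"])
qed

lemma L2_closure_span_has_L2_sum: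
  assumes R: "R \<subseteq> L2 M" and F: "\<And>i. i \<in> I \<Longrightarrow> F i \<in> L2_closure M (lin_span R)"
    and s: "has_L2_sum M F I g"
  shows "g \<in> L2_closure M (lin_span R)"
proof (rule L2_closure_closed)
  show "lin_span R \<subseteq> L2 M" using lin_span_in_L2[OF R] by blast
  show "g \<in> L2 M" using s by (rule has_L2_sum_in_L2)
  have zero: "(\<lambda>x. 0) \<in> L2_closure M (lin_span R)"
    using lincomb_in_lin_span[of "{}" "\<lambda>_. undefined" R] by (intro L2_closure_superset L2_zero) simp
  have fin: "(\<lambda>x. \<Sum>i\<in>X. F i x) \<in> L2_closure M (lin_span R)" if "finite X" "X \<subseteq> I" for X
    using that by (induction X) (auto intro!: L2_closure_span_add[OF R] F zero)
  fix e :: real assume "e > 0"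
  with has_L2_sum_tendsto[OF s] have "\<forall>\<^sub>F X in finite_subsets_at_top I. L2_norm M (\<lambda>x. g x - (\<Sum>i\<in>X. F i x)) < e"
    by (rule order_tendstoD)
  then obtain X where "finite X" "X \<subseteq> I" "L2_norm M (\<lambda>x. g x - (\<Sum>i\<in>X. F i x)) < e"
    by (auto simp: eventually_finite_subsets_at_top)
  then show "\<exists>u\<in>L2_closure M (lin_span R). L2_norm M (\<lambda>x. g x - u x) < e"
    by (intro bexI[where x = "\<lambda>x. \<Sum>i\<in>X. F i x"] fin)
qed

text \<open>The square root of the energy is a seminorm, and the Bessel bound makes it Lipschitz
  with constant \<open>sqrt C2\<close>. Both sides of the lower estimate are thus continuous in the
  norm, so it passes to limits.\<close>

lemma bessel_lower_bound_closure:
  assumes b: "bessel M u I C2" and U: "U \<subseteq> L2 M" and "0 \<le> C1"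
    and low: "\<And>G. G \<in> U \<Longrightarrow> C1 * (L2_norm M G)\<^sup>2 \<le> (\<Sum>\<^sub>\<infinity>i\<in>I. (cmod (L2_inner M G (u i)))\<^sup>2)"
    and F: "F \<in> L2_closure M U"
  shows "C1 * (L2_norm M F)\<^sup>2 \<le> (\<Sum>\<^sub>\<infinity>i\<in>I. (cmod (L2_inner M F (u i)))\<^sup>2)"
proof -
  define T where "T G = (\<Sum>\<^sub>\<infinity>i\<in>I. (cmod (L2_inner M G (u i)))\<^sup>2)" for G
  have T0: "0 \<le> T G" for G unfolding T_def by (intro infsum_nonneg) auto
  have FL: "F \<in> L2 M" using F by (rule L2_closure_in_L2)
  have C2: "0 \<le> C2" using b by (simp add: bessel_def)
  have tri: "sqrt (T G) \<le> sqrt (T F) + sqrt C2 * L2_norm M (\<lambda>x. G x - F x)" if G: "G \<in> L2 M" for G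
  proof -
    define N where "N = L2_norm M (\<lambda>x. G x - F x)"
    have N: "0 \<le> N" by (simp add: N_def L2_norm_nonneg)
    have "T G \<le> (sqrt (T F) + sqrt C2 * N)\<^sup>2"
      unfolding T_def[of G]
    proof (rule infsum_le_finite_sums[OF bessel_summable(1)[OF b G]])
      fix X assume X: "finite X" "X \<subseteq> I"
      have "L2_set (\<lambda>i. cmod (L2_inner M G (u i))) X
          \<le> L2_set (\<lambda>i. cmod (L2_inner M F (u i)) + cmod (L2_inner M (\<lambda>x. G x - F x) (u i))) X"
      proof (rule L2_set_mono)
        fix i assume "i \<in> X"
        then have "u i \<in> L2 M" using X bessel_in_L2[OF b] by auto
        then show "cmod (L2_inner M G (u i)) \<le> cmod (L2_inner M F (u i)) + cmod (L2_inner M (\<lambda>x. G x - F x) (u i))"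
          using G FL by (simp add: L2_inner_diff_left norm_triangle_sub)
      qed simp
      also have "\<dots> \<le> L2_set (\<lambda>i. cmod (L2_inner M F (u i))) X + L2_set (\<lambda>i. cmod (L2_inner M (\<lambda>x. G x - F x) (u i))) X"
        by (rule L2_set_triangle_ineq)
      also have "L2_set (\<lambda>i. cmod (L2_inner M F (u i))) X \<le> sqrt (T F)"
        unfolding L2_set_def T_def using X
        by (intro real_sqrt_le_mono finite_sum_le_infsum bessel_summable[OF b FL]) auto
      also have "L2_set (\<lambda>i. cmod (L2_inner M (\<lambda>x. G x - F x) (u i))) X \<le> sqrt (C2 * N\<^sup>2)"
        unfolding L2_set_def N_def using X by (intro real_sqrt_le_mono bessel_sum_le[OF b] L2_diff G FL)
      finally have "sqrt (\<Sum>i\<in>X. (cmod (L2_inner M G (u i)))\<^sup>2) \<le> sqrt (T F) + sqrt C2 * N"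
        using N by (simp add: L2_set_def real_sqrt_mult)
      then have "(sqrt (\<Sum>i\<in>X. (cmod (L2_inner M G (u i)))\<^sup>2))\<^sup>2 \<le> (sqrt (T F) + sqrt C2 * N)\<^sup>2"
        by (rule power_mono) (simp add: sum_nonneg)
      then show "(\<Sum>i\<in>X. (cmod (L2_inner M G (u i)))\<^sup>2) \<le> (sqrt (T F) + sqrt C2 * N)\<^sup>2"
        by (simp add: sum_nonneg)
    qed
    then show ?thesis unfolding N_def[symmetric]
      using N C2 T0[of F] by (intro real_le_lsqrt T0) auto
  qed
  have "sqrt C1 * L2_norm M F \<le> sqrt (T F) + e" if "e > 0" for e
  proof -
    \<comment> \<open>One \<open>d\<close> pays for two errors: \<open>sqrt C1 * d\<close> for
      replacing the norm of \<open>F\<close> by that of \<open>G\<close>, and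
      \<open>sqrt C2 * d\<close> for replacing the energy.\<close>
    define d where "d = e / (sqrt C1 + sqrt C2 + 1)"
    have "d > 0" using \<open>e > 0\<close> \<open>0 \<le> C1\<close> C2 by (simp add: d_def add_nonneg_pos)
    then obtain G where G: "G \<in> U" "L2_norm M (\<lambda>x. F x - G x) < d"
      using F unfolding L2_closure_def by blast
    have GL: "G \<in> L2 M" using G U by auto
    have "L2_norm M F \<le> L2_norm M G + d"
      using L2_norm_triangle_sub[OF FL GL] G(2) by linarith
    then have "sqrt C1 * L2_norm M F \<le> sqrt C1 * (L2_norm M G + d)"
      using \<open>0 \<le> C1\<close> by (intro mult_left_mono) auto
    also have "\<dots> = sqrt (C1 * (L2_norm M G)\<^sup>2) + sqrt C1 * d"
      by (simp add: real_sqrt_mult L2_norm_nonneg distrib_left)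
    also have "sqrt (C1 * (L2_norm M G)\<^sup>2) \<le> sqrt (T G)"
      using low[OF G(1)] unfolding T_def by (rule real_sqrt_le_mono)
    also have "sqrt (T G) \<le> sqrt (T F) + sqrt C2 * L2_norm M (\<lambda>x. G x - F x)" by (rule tri[OF GL])
    also have "L2_norm M (\<lambda>x. G x - F x) \<le> d"
      using G(2) by (simp add: L2_norm_minus_commute[of M G F])
    finally have "sqrt C1 * L2_norm M F \<le> sqrt (T F) + sqrt C2 * d + sqrt C1 * d"
      using C2 by (simp add: mult_left_mono)
    also have "\<dots> \<le> sqrt (T F) + d * (sqrt C1 + sqrt C2 + 1)"
      using \<open>d > 0\<close> by (simp add: algebra_simps)
    also have "d * (sqrt C1 + sqrt C2 + 1) = e"
      using \<open>0 \<le> C1\<close> C2 by (simp add: d_def add_nonneg_pos order_less_imp_not_eq2)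
    finally show ?thesis .
  qed
  then have "sqrt C1 * L2_norm M F \<le> sqrt (T F)" by (rule field_le_epsilon)
  then have "(sqrt C1 * L2_norm M F)\<^sup>2 \<le> (sqrt (T F))\<^sup>2"
    using \<open>0 \<le> C1\<close> by (intro power_mono mult_nonneg_nonneg L2_norm_nonneg) auto
  then show ?thesis using \<open>0 \<le> C1\<close> T0[of F] by (simp add: power_mult_distrib T_def)
qed

lemma upper_frame_bound_reindex:
  assumes "bij_betw b J I"
  shows "upper_frame_bound M V (\<lambda>j. u (b j)) J C \<longleftrightarrow> upper_frame_bound M V u I C"
  unfolding upper_frame_bound_def
  by (simp add: summable_on_reindex_bij_betw[OF assms, of "\<lambda>i. (cmod (L2_inner M _ (u i)))\<^sup>2"]
      infsum_reindex_bij_betw[OF assms, of "\<lambda>i. (cmod (L2_inner M _ (u i)))\<^sup>2"])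

lemma frame_with_bounds_reindex:
  assumes "bij_betw b J I"
  shows "frame_with_bounds M V (\<lambda>j. u (b j)) J C1 C2 \<longleftrightarrow> frame_with_bounds M V u I C1 C2"
proof -
  have "(\<forall>j\<in>J. u (b j) \<in> V) \<longleftrightarrow> (\<forall>i\<in>I. u i \<in> V)"
    using assms by (auto simp: bij_betw_def)
  then show ?thesis
    unfolding frame_with_bounds_def
    by (simp add: summable_on_reindex_bij_betw[OF assms, of "\<lambda>i. (cmod (L2_inner M _ (u i)))\<^sup>2"]
        infsum_reindex_bij_betw[OF assms, of "\<lambda>i. (cmod (L2_inner M _ (u i)))\<^sup>2"])
qed

subsection \<open>Powers of the dilation matrix\<close>

lemma matpow_0: "matpow A 0 = mat 1"
  by (simp add: matpow_def)

lemma matpow_Suc: "matpow A (int (Suc j)) = A ** matpow A (int j)"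
  by (simp add: matpow_def nat_add_distrib del: of_nat_Suc)

lemma matpow_minus: "matpow A (- int j) = (((**) (matrix_inv A)) ^^ j) (mat 1)"
  by (cases "j = 0") (simp_all add: matpow_def)

lemma matpow_minus_Suc: "matpow A (- int (Suc j)) = matrix_inv A ** matpow A (- int j)"
  unfolding matpow_minus by simp

text \<open>The inverse is split off on the right, where it meets a factor \<open>A\<close> of the
  positive power; the same form reduces level \<open>Suc j\<close> to level \<open>1\<close> in
  \<open>V_space_mono\<close>.\<close>

lemma matpow_minus_Suc': "matpow A (- int (Suc j)) = matpow A (- int j) ** matrix_inv A"
proof (induction j)
  case (Suc j)
  then show ?case unfolding matpow_minus_Suc[of A "Suc j"]
    by (simp only: matpow_minus_Suc[of A j] matrix_mul_assoc)
qed (simp add: matpow_0 matpow_minus_Suc[of A 0, simplified])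

lemma matpow_inverse:
  assumes "det A \<noteq> 0"
  shows "matpow A (- int j) ** matpow A (int j) = mat 1"
    and "matpow A (int j) ** matpow A (- int j) = mat 1"
proof -
  show "matpow A (- int j) ** matpow A (int j) = mat 1"
  proof (induction j)
    case (Suc j)
    have "matpow A (- int (Suc j)) ** matpow A (int (Suc j))
        = matpow A (- int j) ** (matrix_inv A ** A) ** matpow A (int j)"
      unfolding matpow_Suc matpow_minus_Suc' by (simp only: matrix_mul_assoc)
    then show ?case using Suc by (simp add: matrix_inv_cancel[OF assms])
  qed (simp add: matpow_0)
  then show "matpow A (int j) ** matpow A (- int j) = mat 1"
    by (metis matrix_left_right_inverse)
qed

lemma det_matpow: "det (matpow A (int j)) = det A ^ j"
  by (induction j) (simp_all add: matpow_0 matpow_Suc det_mul del: of_nat_Suc)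

lemma matpow_integral:
  assumes "dilation_matrix A"
  shows "\<exists>m. matpow A (int j) *v zvec k = zvec m"
proof (induction j)
  case (Suc j)
  then obtain m where "matpow A (int j) *v zvec k = zvec m" by blast
  then have "matpow A (int (Suc j)) *v zvec k = zvec (lattice_map A m)"
    unfolding matpow_Suc by (simp add: zvec_lattice_map[OF assms] flip: matrix_vector_mul_assoc)
  then show ?case by blast
qed (auto simp: matpow_0)

text \<open>Completeness of the Lebesgue measure. A packet is prescribed only up to a null set, so
  its measurability has to be inherited from the sum of its series.\<close>

lemma borel_measurable_lebesgue_AE:
  fixes f g :: "'a::euclidean_space \<Rightarrow> 'b::second_countable_topology"
  assumes "g \<in> borel_measurable lebesgue" "AE x in lebesgue. f x = g x"
  shows "f \<in> borel_measurable lebesgue"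
proof (rule measurableI)
  fix S :: "'b set" assume S: "S \<in> sets borel"
  have "g -` S \<inter> space lebesgue \<in> sets lebesgue" using assms(1) S by (rule measurable_sets)
  then show "f -` S \<inter> space lebesgue \<in> sets lebesgue"
    by (rule completion.in_sets_AE[rotated]) (use assms(2) in \<open>auto simp: sets_eq_imp_space_eq\<close>)
qed simp

subsection \<open>Wavelet frame packets\<close>

locale frame_packets = unitary_filters A a K \<beta> h
  for A :: "real^'d^'d" and a K \<beta> and h :: "nat \<Rightarrow> 'l::finite \<Rightarrow> 'l \<Rightarrow> int^'d \<Rightarrow> complex" +
  fixes \<phi> :: "'l \<Rightarrow> real^'d \<Rightarrow> complex" and f :: "nat \<Rightarrow> 'l \<Rightarrow> real^'d \<Rightarrow> complex" and C1 C2 :: real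
  assumes \<phi>_L2: "\<And>l. \<phi> l \<in> L2 lebesgue"
    and frame: "frame_with_bounds lebesgue (V_space A \<phi> 0) (\<lambda>(l, k) x. \<phi> l (x - zvec k)) UNIV C1 C2"
    and nested: "V_space A \<phi> 0 \<subseteq> V_space A \<phi> 1"
    and packets: "wavelet_frame_packets A a h \<phi> f"
begin

abbreviation "translates \<equiv> (\<lambda>(l::'l, k::int^'d) x. \<phi> l (x - zvec k))"

text \<open>Levels are natural numbers here: the blocks of a partition are nonempty, which excludes
  negative exponents. The power of \<open>a\<close> makes the dilation an isometry.\<close>

definition atom :: "nat \<Rightarrow> nat \<Rightarrow> 'l \<times> (int^'d) \<Rightarrow> real^'d \<Rightarrow> complex" where
  "atom n j = (\<lambda>(l, k) x. of_real (real a powr (real j / 2)) * f n l (matpow A (int j) *v x - zvec k))"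

abbreviation energy :: "nat \<Rightarrow> nat \<Rightarrow> (real^'d \<Rightarrow> complex) \<Rightarrow> real" where
  "energy n j F \<equiv> (\<Sum>\<^sub>\<infinity>q. (cmod (L2_inner lebesgue F (atom n j q)))\<^sup>2)"

lemma a_pos: "0 < real a"
  using a_gt_1 by simp

lemma f_0: "f 0 = \<phi>"
  using packets by (simp add: wavelet_frame_packets_def)

lemma atom_0: "atom n 0 (l, k) x = f n l (x - zvec k)"
  using a_pos by (simp add: atom_def matpow_0)

lemma atom_0_0: "atom 0 0 = translates"
  by (auto simp: fun_eq_iff atom_0 f_0)

lemma bounds_pos: "0 < C1" "0 < C2"
  using frame by (auto simp: frame_with_bounds_def)

lemma det_matpow_nonzero: "det (matpow A (int j)) \<noteq> 0"
  using det_nonzero by (simp add: det_matpow)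

lemma det_matpow_minus_nonzero: "det (matpow A (- int j)) \<noteq> 0"
  using arg_cong[OF matpow_inverse(1)[OF det_nonzero, of j], of det] by (auto simp: det_mul)

lemma dilates_matpow: "dilates lebesgue (1 / real a ^ j) (\<lambda>x. matpow A (int j) *v x - b)"
  using dilates_affine[OF det_matpow_nonzero] by (simp add: det_matpow power_abs a_det)

lemma powr_half_sq: "(real a powr (real j / 2))\<^sup>2 = real a ^ j"
  using a_pos by (simp add: power2_eq_square powr_realpow flip: powr_add)

lemma matpow_cancel:
  "matpow A (int j) *v (matpow A (- int j) *v x) = x"
  "matpow A (- int j) *v (matpow A (int j) *v x) = x"
  by (simp_all add: matrix_vector_mul_assoc matpow_inverse[OF det_nonzero])

section \<open>The spaces \<open>V_j\<close> under inclusion, translation, dilation and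
  limits\<close>

definition span_translates :: "(real^'d \<Rightarrow> complex) set" where
  "span_translates = L2_closure lebesgue (lin_span (range translates))"

lemma V_space_iff: "F \<in> V_space A \<phi> (int j) \<longleftrightarrow> (\<lambda>x. F (matpow A (- int j) *v x)) \<in> span_translates"
  by (simp add: V_space_def span_translates_def)

lemma V_space_0: "V_space A \<phi> 0 = span_translates"
  using V_space_iff[of _ 0] by (auto simp: matpow_0)

lemma dilates_translation: "dilates lebesgue 1 (\<lambda>x. x - zvec k :: real^'d)"
  using dilates_affine[of "mat 1 :: real^'d^'d" "zvec k"] by simp

lemma translates_L2: "range translates \<subseteq> L2 lebesgue"
  using dilates_L2[OF dilates_translation \<phi>_L2] by auto

lemma span_translates_L2: "F \<in> span_translates \<Longrightarrow> F \<in> L2 lebesgue"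
  unfolding span_translates_def by (rule L2_closure_in_L2)

lemma V_space_L2:
  assumes "F \<in> V_space A \<phi> (int j)"
  shows "F \<in> L2 lebesgue"
proof -
  have "(\<lambda>x. F (matpow A (- int j) *v x)) \<in> L2 lebesgue"
    using assms unfolding V_space_iff by (rule span_translates_L2)
  from dilates_L2[OF dilates_matpow[of j 0] this] show ?thesis by (simp add: matpow_cancel)
qed

lemma V_space_mono:
  assumes "i \<le> j" "F \<in> V_space A \<phi> (int i)"
  shows "F \<in> V_space A \<phi> (int j)"
  using assms
proof (induction j rule: dec_induct)
  case (step j)
  then have "(\<lambda>x. F (matpow A (- int j) *v x)) \<in> V_space A \<phi> 1"
    using nested by (auto simp: V_space_iff V_space_0)
  then show ?case
    using V_space_iff[of _ 1] V_space_iff[of F "Suc j"] matpow_minus_Suc'[of A j] matpow_minus_Suc[of A 0]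
    by (simp add: matpow_0 matrix_vector_mul_assoc)
qed

lemma V_space_cmult: "F \<in> V_space A \<phi> (int j) \<Longrightarrow> (\<lambda>x. c * F x) \<in> V_space A \<phi> (int j)"
  unfolding V_space_iff span_translates_def by (rule L2_closure_span_cmult)

lemma span_translates_shift:
  assumes "F \<in> span_translates"
  shows "(\<lambda>x. F (x - zvec k)) \<in> span_translates"
proof -
  have lin: "(\<lambda>x. G (x - zvec k)) \<in> lin_span (range translates)" if "G \<in> lin_span (range translates)" for G
  proof -
    obtain U c where G: "G = (\<lambda>x. \<Sum>u\<in>U. c u * u x)" and U: "finite U" "U \<subseteq> range translates"
      using \<open>G \<in> lin_span (range translates)\<close> unfolding lin_span_def by blast
    have "(\<lambda>x. \<Sum>u\<in>U. c u * (\<lambda>u x. u (x - zvec k)) u x) \<in> lin_span (range translates)"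
    proof (rule lincomb_in_lin_span[OF U(1)])
      fix u assume "u \<in> U"
      then obtain l m where "u = translates (l, m)" using U by auto
      then have "(\<lambda>x. u (x - zvec k)) = translates (l, k + m)"
        by (simp add: zvec_add diff_diff_eq)
      then show "(\<lambda>x. u (x - zvec k)) \<in> range translates" by blast
    qed
    then show ?thesis by (simp add: G)
  qed
  show ?thesis
    unfolding span_translates_def L2_closure_def
  proof (intro CollectI conjI allI impI)
    have FL: "F \<in> L2 lebesgue" using assms by (rule span_translates_L2)
    show "(\<lambda>x. F (x - zvec k)) \<in> L2 lebesgue"
      by (rule dilates_L2[OF dilates_translation FL])
    fix e :: real assume "e > 0"
    then obtain G where G: "G \<in> lin_span (range translates)" "L2_norm lebesgue (\<lambda>x. F x - G x) < e"
      using assms unfolding span_translates_def L2_closure_def by blast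
    have "L2_norm lebesgue (\<lambda>x. F (x - zvec k) - G (x - zvec k)) = L2_norm lebesgue (\<lambda>x. F x - G x)"
      using dilates_L2_norm[OF dilates_translation, of "\<lambda>x. F x - G x"]
        L2_measurable[OF L2_diff[OF FL lin_span_in_L2[OF translates_L2 G(1)]]] by simp
    then show "\<exists>g\<in>lin_span (range translates). L2_norm lebesgue (\<lambda>x. F (x - zvec k) - g x) < e"
      using lin[OF G(1)] G(2) by (auto intro!: bexI[of _ "\<lambda>x. G (x - zvec k)"])
  qed
qed

text \<open>A translation by \<open>k\<close> at level \<open>j\<close> is a translation by
  \<open>A^j k\<close> at level \<open>0\<close>, and this vector is again integral since
  \<open>j\<close> is nonnegative.\<close>

lemma V_space_shift:
  assumes "F \<in> V_space A \<phi> (int j)"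
  shows "(\<lambda>x. F (x - zvec k)) \<in> V_space A \<phi> (int j)"
proof -
  obtain m where m: "matpow A (int j) *v zvec k = zvec m"
    using matpow_integral[OF dilation] by blast
  have "matpow A (- int j) *v zvec m = zvec k" unfolding m[symmetric] by (rule matpow_cancel)
  then show ?thesis
    using span_translates_shift[OF assms[unfolded V_space_iff], of m]
    unfolding V_space_iff by (simp add: matrix_vector_mult_diff_distrib)
qed

lemma V_space_dilate:
  assumes "F \<in> V_space A \<phi> (int i)"
  shows "(\<lambda>x. F (matpow A (int j) *v x)) \<in> V_space A \<phi> (int (i + j))"
  using assms
proof (induction j arbitrary: F i)
  case 0
  then show ?case by (simp add: matpow_0)
next
  case (Suc j)
  have "(\<lambda>x. F (A *v x)) \<in> V_space A \<phi> (int (Suc i))"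
    using Suc.prems unfolding V_space_iff matpow_minus_Suc
    by (simp add: matrix_inv_cancel(3)[OF det_nonzero] flip: matrix_vector_mul_assoc)
  from Suc.IH[OF this] show ?case
    unfolding matpow_Suc by (simp flip: matrix_vector_mul_assoc)
qed

lemma V_space_has_L2_sum:
  assumes "\<And>i. i \<in> I \<Longrightarrow> F i \<in> V_space A \<phi> (int j)" "has_L2_sum lebesgue F I g"
  shows "g \<in> V_space A \<phi> (int j)"
  unfolding V_space_iff span_translates_def
proof (rule L2_closure_span_has_L2_sum[OF translates_L2])
  show "has_L2_sum lebesgue (\<lambda>i x. F i (matpow A (- int j) *v x)) I (\<lambda>x. g (matpow A (- int j) *v x))"
    using dilates_has_L2_sum[OF dilates_affine[OF det_matpow_minus_nonzero, of _ 0] assms(2), of j] by simp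
qed (use assms(1) in \<open>simp add: V_space_iff span_translates_def\<close>)

text \<open>The factor \<open>a^(j/2)\<close> compensates the determinant in the change of
  variables, so energy and squared norm scale alike and the constant is kept.\<close>

lemma bessel_dilate:
  assumes "bessel lebesgue (atom n 0) UNIV C"
  shows "bessel lebesgue (atom n j) UNIV C"
  unfolding bessel_def
proof (intro conjI ballI allI impI)
  define c where "c = real a powr (real j / 2)"
  have c2: "c\<^sup>2 = real a ^ j" unfolding c_def by (rule powr_half_sq)
  have c0: "0 < c" using a_pos by (simp add: c_def)
  have at: "atom n j q = (\<lambda>x. of_real c * atom n 0 q (matpow A (int j) *v x))" for q
    by (cases q) (simp add: fun_eq_iff atom_0, simp add: atom_def c_def)
  note dil = dilates_matpow[of j 0, simplified]
  have L: "atom n 0 q \<in> L2 lebesgue" for q using bessel_in_L2[OF assms] by simp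
  show "atom n j q \<in> L2 lebesgue" for q
    unfolding at by (intro L2_cmult dilates_L2[OF dil] L)
  show "0 \<le> C" using assms by (simp add: bessel_def)
  fix F :: "real^'d \<Rightarrow> complex" and X :: "('l \<times> (int^'d)) set"
  assume F: "F \<in> L2 lebesgue" and X: "finite X"
  define G where "G = (\<lambda>x. F (matpow A (- int j) *v x))"
  have G: "G \<in> L2 lebesgue"
    using dilates_L2[OF dilates_affine[OF det_matpow_minus_nonzero, of _ 0] F, of j] by (simp add: G_def)
  have FG: "F = (\<lambda>x. G (matpow A (int j) *v x))" by (simp add: G_def matpow_cancel)
  have "(cmod (L2_inner lebesgue F (atom n j q)))\<^sup>2 = (cmod (L2_inner lebesgue G (atom n 0 q)))\<^sup>2 / real a ^ j" for q
  proof -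
    have "L2_inner lebesgue F (atom n j q) = of_real (c / real a ^ j) * L2_inner lebesgue G (atom n 0 q)"
      unfolding at L2_inner_cmult_right FG
      by (subst dilates_L2_inner[OF dil G L]) simp
    then have "(cmod (L2_inner lebesgue F (atom n j q)))\<^sup>2
        = (c / real a ^ j)\<^sup>2 * (cmod (L2_inner lebesgue G (atom n 0 q)))\<^sup>2"
      using c0 a_pos by (simp only: norm_mult norm_of_real power_mult_distrib power2_abs)
    also have "(c / real a ^ j)\<^sup>2 = 1 / real a ^ j"
      using a_pos unfolding power_divide c2 by (simp add: power2_eq_square)
    finally show ?thesis by simp
  qed
  then have "(\<Sum>q\<in>X. (cmod (L2_inner lebesgue F (atom n j q)))\<^sup>2)
      = (\<Sum>q\<in>X. (cmod (L2_inner lebesgue G (atom n 0 q)))\<^sup>2) / real a ^ j"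
    by (simp add: sum_divide_distrib)
  also have "\<dots> \<le> (C * (L2_norm lebesgue G)\<^sup>2) / real a ^ j"
    using bessel_sum_le[OF assms G X] a_pos by (intro divide_right_mono) auto
  also have "(C * (L2_norm lebesgue G)\<^sup>2) / real a ^ j = C * (L2_norm lebesgue F)\<^sup>2"
    unfolding FG dilates_L2_norm[OF dil L2_measurable[OF G]] using a_pos by (simp add: power_mult_distrib)
  finally show "(\<Sum>q\<in>X. (cmod (L2_inner lebesgue F (atom n j q)))\<^sup>2) \<le> C * (L2_norm lebesgue F)\<^sup>2" .
qed

text \<open>Finite combinations of the translates lie in \<open>V_0\<close>, where the frame
  inequality applies; \<open>bessel_from_span\<close> removes the restriction to
  \<open>V_0\<close>.\<close>

lemma bessel_translates: "bessel lebesgue (atom 0 0) UNIV C2"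
  unfolding atom_0_0
proof (rule bessel_from_span)
  show "translates q \<in> L2 lebesgue" for q using translates_L2 by blast
  show "0 \<le> C2" using bounds_pos by simp
  fix X :: "('l \<times> (int^'d)) set" and c :: "'l \<times> (int^'d) \<Rightarrow> complex" assume X: "finite X"
  let ?G = "\<lambda>x. \<Sum>i\<in>X. c i * translates i x"
  have lin: "?G \<in> lin_span (range translates)" using X by (intro lincomb_in_lin_span) auto
  then have "?G \<in> V_space A \<phi> 0"
    unfolding V_space_0 span_translates_def
    by (intro L2_closure_superset lin_span_in_L2[OF translates_L2])
  then have s: "(\<lambda>i. (cmod (L2_inner lebesgue ?G (translates i)))\<^sup>2) summable_on UNIV"
    and le: "(\<Sum>\<^sub>\<infinity>i. (cmod (L2_inner lebesgue ?G (translates i)))\<^sup>2) \<le> C2 * (L2_norm lebesgue ?G)\<^sup>2"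
    using frame unfolding frame_with_bounds_def by blast+
  have "(\<Sum>i\<in>X. (cmod (L2_inner lebesgue ?G (translates i)))\<^sup>2) \<le> (\<Sum>\<^sub>\<infinity>i. (cmod (L2_inner lebesgue ?G (translates i)))\<^sup>2)"
    using X by (intro finite_sum_le_infsum s) auto
  with le show "(\<Sum>i\<in>X. (cmod (L2_inner lebesgue ?G (translates i)))\<^sup>2) \<le> C2 * (L2_norm lebesgue ?G)\<^sup>2"
    by linarith
qed

text \<open>A packet is almost everywhere an \<open>L2_sum\<close>, a choice that means something
  only once the series converges. Convergence follows from square summable filters and the Bessel
  bound for the atoms of index \<open>r\<close> at level \<open>1\<close>.\<close>

lemma packet_has_L2_sum:
  assumes b: "bessel lebesgue (atom r 0) UNIV C" and s: "s < a"
  shows "has_L2_sum lebesgue (\<lambda>(j, k) x. h s l j k * sqrt (real a) * f r j (A *v x - zvec k)) UNIV (f (s + a * r) l)"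
proof -
  have a1: "atom r 1 (j, k) x = sqrt (real a) * f r j (A *v x - zvec k)" for j k x
    using a_pos matpow_Suc[of A 0] by (simp add: atom_def matpow_0 powr_half_sqrt)
  have "((\<lambda>(j, k). (cmod (h s l j k))\<^sup>2) has_sum (\<Sum>j\<in>UNIV. \<Sum>\<^sub>\<infinity>k. (cmod (h s l j k))\<^sup>2)) (UNIV \<times> UNIV)"
    by (rule has_sum_finite_Times) (use h_summable[OF s] in simp_all)
  then have "(\<lambda>q. (cmod (case q of (j, k) \<Rightarrow> h s l j k))\<^sup>2) summable_on UNIV"
    by (simp add: case_prod_unfold has_sum_imp_summable)
  then obtain g where "has_L2_sum lebesgue (\<lambda>q x. (case q of (j, k) \<Rightarrow> h s l j k) * atom r 1 q x) UNIV g"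
    using bessel_has_L2_sum[OF bessel_dilate[OF b, of 1], of "case_prod (h s l)"] by auto
  moreover have "(\<lambda>q x. (case q of (j, k) \<Rightarrow> h s l j k) * atom r 1 q x)
      = (\<lambda>(j, k) x. h s l j k * sqrt (real a) * f r j (A *v x - zvec k))"
    by (simp add: fun_eq_iff a1[unfolded One_nat_def])
  ultimately have ex: "\<exists>g. has_L2_sum lebesgue (\<lambda>(j, k) x. h s l j k * sqrt (real a) * f r j (A *v x - zvec k)) UNIV g"
    by auto
  define g where "g = L2_sum lebesgue (\<lambda>(j, k) x. h s l j k * sqrt (real a) * f r j (A *v x - zvec k)) UNIV"
  have g: "has_L2_sum lebesgue (\<lambda>(j, k) x. h s l j k * sqrt (real a) * f r j (A *v x - zvec k)) UNIV g"
    unfolding g_def L2_sum_def using ex by (rule someI_ex)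
  have ae: "AE x in lebesgue. f (s + a * r) l x = g x"
    using packets s unfolding wavelet_frame_packets_def g_def by blast
  show ?thesis
  proof (rule has_L2_sum_cong_AE[OF g])
    show "f (s + a * r) l \<in> borel_measurable lebesgue"
      using L2_measurable[OF has_L2_sum_in_L2[OF g]] ae by (rule borel_measurable_lebesgue_AE)
    show "AE x in lebesgue. g x = f (s + a * r) l x" using ae by eventually_elim simp
  qed
qed

text \<open>The defining series is evaluated at \<open>A^j x - m\<close>. As
  \<open>A (A^j x - m) - k = A^(j+1) x - (k + A m)\<close>, reindexing \<open>k\<close> produces the
  coefficients \<open>h (k - A m)\<close>, the matrix entries of
  \<open>filters_orthonormal\<close>.\<close>

lemma atom_has_L2_sum:
  assumes b: "bessel lebesgue (atom r 0) UNIV C" and s: "s < a"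
  shows "has_L2_sum lebesgue (\<lambda>(i, k) x. h s l i (k - lattice_map A m) * atom r (Suc j) (i, k) x) UNIV
    (atom (s + a * r) j (l, m))"
proof -
  define c where "c = complex_of_real (real a powr (real j / 2))"
  have cs: "c * sqrt (real a) = complex_of_real (real a powr (real (Suc j) / 2))"
    using a_pos by (simp add: c_def add_divide_distrib powr_add powr_half_sqrt mult.commute)
  \<comment> \<open>The reindexing: the new summation index is the translation of the atom at level
    \<open>Suc j\<close>, no longer the position in the filter.\<close>
  define B where "B = (\<lambda>(i::'l, k). (i, k - lattice_map A m))"
  have bij: "bij_betw B UNIV UNIV"
    by (rule bij_betw_byWitness[where f' = "\<lambda>(i, k). (i, k + lattice_map A m)"]) (auto simp: B_def)
  have "has_L2_sum lebesgue
      (\<lambda>q x. c * (case q of (i, k) \<Rightarrow> \<lambda>x. h s l i k * sqrt (real a) * f r i (A *v x - zvec k)) (matpow A (int j) *v x - zvec m))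
      UNIV (\<lambda>x. c * f (s + a * r) l (matpow A (int j) *v x - zvec m))"
    by (intro has_L2_sum_cmult dilates_has_L2_sum[OF dilates_matpow] packet_has_L2_sum[OF b s])
  from has_L2_sum_reindex[OF this bij]
  have "has_L2_sum lebesgue
      (\<lambda>q x. c * (case B q of (i, k) \<Rightarrow> \<lambda>x. h s l i k * sqrt (real a) * f r i (A *v x - zvec k)) (matpow A (int j) *v x - zvec m))
      UNIV (\<lambda>x. c * f (s + a * r) l (matpow A (int j) *v x - zvec m))" .
  moreover have "c * (case B q of (i, k) \<Rightarrow> \<lambda>x. h s l i k * sqrt (real a) * f r i (A *v x - zvec k)) (matpow A (int j) *v x - zvec m)
      = (case q of (i, k) \<Rightarrow> \<lambda>x. h s l i (k - lattice_map A m) * atom r (Suc j) (i, k) x) x" for q x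
  proof -
    obtain i k where q: "q = (i, k)" by (cases q)
    have "A *v (matpow A (int j) *v x - zvec m) - zvec (k - lattice_map A m)
        = matpow A (int (Suc j)) *v x - zvec k"
      unfolding matpow_Suc
      by (simp add: zvec_diff zvec_lattice_map[OF dilation] matrix_vector_mult_diff_distrib flip: matrix_vector_mul_assoc)
    then show ?thesis by (simp add: q B_def atom_def cs[symmetric] del: of_nat_Suc)
  qed
  ultimately show ?thesis by (simp add: atom_def c_def)
qed

text \<open>Pairing \<open>F\<close> with the expansion in \<open>atom_has_L2_sum\<close> expresses
  the inner products with the split packets as a matrix applied to those with the atoms of index
  \<open>r\<close>. Its columns are orthonormal, so \<open>l2_isometry\<close> equates the two sums
  of squares.\<close>

lemma energy_split:
  assumes b: "bessel lebesgue (atom r 0) UNIV C" and F: "F \<in> L2 lebesgue"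
  shows "((\<lambda>(s, q). (cmod (L2_inner lebesgue F (atom (s + a * r) j q)))\<^sup>2) has_sum energy r (Suc j) F) ({..<a} \<times> UNIV)"
proof -
  \<comment> \<open>The entries are conjugated because the inner product is antilinear in its second
    argument; accordingly \<open>filters_orthonormal\<close> is used with the two columns
    exchanged.\<close>
  define V where "V = (\<lambda>(s, l, m) (i, k). cnj (h s l i (k - lattice_map A m)))"
  have "((\<lambda>p. (cmod (case p of (s, q) \<Rightarrow> L2_inner lebesgue F (atom (s + a * r) j q)))\<^sup>2) has_sum energy r (Suc j) F) ({..<a} \<times> UNIV)"
  proof (rule l2_isometry[where V = V])
    fix q q' :: "'l \<times> (int^'d)"
    obtain i k i' k' where q: "q = (i, k)" "q' = (i', k')" by (cases q; cases q')
    show "((\<lambda>p. V p q * cnj (V p q')) has_sum (if q = q' then 1 else 0)) ({..<a} \<times> UNIV)"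
      using filters_orthonormal[of i' k' i k]
      by (simp add: q V_def case_prod_unfold mult.commute eq_commute[of i'] eq_commute[of k'])
  next
    fix p :: "nat \<times> 'l \<times> (int^'d)" assume p: "p \<in> {..<a} \<times> UNIV"
    obtain s l m where p': "p = (s, l, m)" by (cases p)
    then have s: "s < a" using p by simp
    have "(\<lambda>q. V p q * L2_inner lebesgue F (atom r (Suc j) q))
        = (\<lambda>q. L2_inner lebesgue F ((case q of (i, k) \<Rightarrow> \<lambda>x. h s l i (k - lattice_map A m) * atom r (Suc j) (i, k) x)))"
      by (auto simp: fun_eq_iff V_def p' L2_inner_cmult_right)
    then show "((\<lambda>q. V p q * L2_inner lebesgue F (atom r (Suc j) q)) has_sum
        (case p of (s, q) \<Rightarrow> L2_inner lebesgue F (atom (s + a * r) j q))) UNIV"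
      using has_L2_sum_inner_right[OF atom_has_L2_sum[OF b s, of l m j] F] by (simp add: p')
  next
    show "(\<lambda>q. (cmod (L2_inner lebesgue F (atom r (Suc j) q)))\<^sup>2) summable_on UNIV"
      by (rule bessel_summable(1)[OF bessel_dilate[OF b] F])
  qed
  then show ?thesis by (simp add: case_prod_unfold)
qed

text \<open>With \<open>n = s + a * r\<close> and \<open>r < n\<close>, the energy of index
  \<open>n\<close> at level \<open>0\<close> is part of the energy of index \<open>r\<close> at
  level \<open>1\<close>. The induction hypothesis bounds the latter by \<open>C2\<close>, with no
  growth along the induction.\<close>

lemma bessel_packet: "bessel lebesgue (atom n 0) UNIV C2"
proof (induction n rule: less_induct)
  case (less n)
  show ?case
  proof (cases "n = 0")
    case True
    then show ?thesis using bessel_translates by simp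
  next
    case False
    define r s where "r = n div a" and "s = n mod a"
    have n: "n = s + a * r" by (simp add: r_def s_def)
    have s: "s < a" using a_gt_1 by (simp add: s_def)
    have "r < n" unfolding r_def using False a_gt_1 by (intro div_less_dividend) auto
    then have b: "bessel lebesgue (atom r 0) UNIV C2" by (rule less)
    show ?thesis
      unfolding bessel_def
    proof (intro conjI ballI allI impI)
      show "atom n 0 q \<in> L2 lebesgue" for q
        using has_L2_sum_in_L2[OF atom_has_L2_sum[OF b s, of "fst q" "snd q" 0]] by (simp add: n)
      show "0 \<le> C2" using bounds_pos by simp
      fix F :: "real^'d \<Rightarrow> complex" and X :: "('l \<times> (int^'d)) set"
      assume F: "F \<in> L2 lebesgue" and X: "finite X"
      have "(\<Sum>q\<in>X. (cmod (L2_inner lebesgue F (atom n 0 q)))\<^sup>2)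
          = (\<Sum>(s, q)\<in>{s} \<times> X. (cmod (L2_inner lebesgue F (atom (s + a * r) 0 q)))\<^sup>2)"
        by (simp add: sum.cartesian_product[symmetric] n)
      also have "\<dots> \<le> energy r (Suc 0) F"
        using X s by (intro finite_sum_le_has_sum[OF energy_split[OF b F]]) auto
      also have "\<dots> \<le> C2 * (L2_norm lebesgue F)\<^sup>2"
        by (rule bessel_summable(2)[OF bessel_dilate[OF b] F])
      finally show "(\<Sum>q\<in>X. (cmod (L2_inner lebesgue F (atom n 0 q)))\<^sup>2) \<le> C2 * (L2_norm lebesgue F)\<^sup>2" .
    qed
  qed
qed

lemma bessel_atom: "bessel lebesgue (atom n j) UNIV C2"
  by (rule bessel_dilate[OF bessel_packet])

end

text \<open>For integers the upper limit, with its \<open>- 1\<close>, says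
  \<open>r < a^j (n + 1)\<close>. The block thus becomes a fibre of division by \<open>a^j\<close>,
  the form in which blocks subdivide by base-\<open>a\<close> digits.\<close>

lemma packet_block_nat:
  assumes "0 < a"
  shows "packet_block a (n, int j) = {r. r div a ^ j = n}"
proof -
  have "(real a powi int j * real n \<le> real r \<and> real r \<le> real a powi int j * (real n + 1) - 1)
      \<longleftrightarrow> r div a ^ j = n" for r
  proof -
    have "real a powi int j * real n \<le> real r \<longleftrightarrow> a ^ j * n \<le> r"
      by (simp flip: of_nat_power of_nat_mult)
    moreover have "real r \<le> real a powi int j * (real n + 1) - 1 \<longleftrightarrow> r < a ^ j * Suc n"
    proof -
      have "real r \<le> real a powi int j * (real n + 1) - 1 \<longleftrightarrow> real (Suc r) \<le> real (a ^ j * Suc n)"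
        by (auto simp: algebra_simps)
      then show ?thesis unfolding of_nat_le_iff by (simp add: Suc_le_eq)
    qed
    moreover have "a ^ j * n \<le> r \<and> r < a ^ j * Suc n \<longleftrightarrow> r div a ^ j = n"
      using assms div_nat_eqI[of "a ^ j" n r] dividend_less_times_div[of "a ^ j" r] times_div_less_eq_dividend[of "a ^ j" r]
      by auto
    ultimately show ?thesis by simp
  qed
  then show ?thesis unfolding packet_block_def by simp
qed

text \<open>The two limits of the block differ by \<open>a^j - 1\<close>, which is negative for
  \<open>j < 0\<close>.\<close>

lemma packet_block_negative:
  assumes "1 < a" "j < 0"
  shows "packet_block a (n, j) = {}"
proof -
  define y where "y = real a powi j"
  have "y < 1"
  proof -
    have "real a powi j = inverse (real a ^ nat (- j))"
      using assms by (simp add: power_int_def power_inverse)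
    also have "\<dots> < 1" using assms by (intro inverse_less_1_iff[THEN iffD2] disjI2 one_less_power) auto
    finally show ?thesis by (simp add: y_def)
  qed
  then have "\<not> (y * real n \<le> x \<and> x \<le> y * (real n + 1) - 1)" for x
    by (auto simp: algebra_simps)
  then show ?thesis unfolding packet_block_def y_def by simp
qed

section \<open>Energies over blocks and the lower bound on \<open>V_j\<close>\<close>

context frame_packets
begin

lemma energy_Suc:
  assumes F: "F \<in> L2 lebesgue"
  shows "energy r (Suc j) F = (\<Sum>s<a. energy (s + a * r) j F)"
proof (rule has_sum_unique[OF energy_split[OF bessel_packet F]])
  show "((\<lambda>(s, q). (cmod (L2_inner lebesgue F (atom (s + a * r) j q)))\<^sup>2) has_sum
      (\<Sum>s<a. energy (s + a * r) j F)) ({..<a} \<times> UNIV)"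
    by (rule has_sum_finite_Times) (use bessel_summable(1)[OF bessel_atom F] in simp_all)
qed

lemma finite_block: "finite {r. r div a ^ j = n}"
proof (rule finite_subset)
  show "{r. r div a ^ j = n} \<subseteq> {..<a ^ j * Suc n}"
    using dividend_less_times_div[of "a ^ j"] a_gt_1 by auto
qed simp

text \<open>Iteration of \<open>energy_Suc\<close>: an integer has quotient \<open>n\<close> by
  \<open>a^(j+1)\<close> exactly if its quotient by \<open>a^j\<close> is \<open>s + a * n\<close>
  for a digit \<open>s < a\<close>, so the block splits just as the energy does.\<close>

lemma energy_block:
  assumes F: "F \<in> L2 lebesgue"
  shows "energy n j F = (\<Sum>r\<in>{r. r div a ^ j = n}. energy r 0 F)"
proof (induction j arbitrary: n)
  case (Suc j)
  have "{r. r div a ^ Suc j = n} = (\<Union>s<a. {r. r div a ^ j = s + a * n})"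
  proof -
    have "r div a ^ Suc j = n \<longleftrightarrow> (\<exists>s<a. r div a ^ j = s + a * n)" for r
    proof -
      have "r div a ^ Suc j = (r div a ^ j) div a" by (simp only: power_Suc2 div_mult2_eq)
      moreover have "y div a = n \<longleftrightarrow> (\<exists>s<a. y = s + a * n)" for y
      proof
        assume "y div a = n"
        then show "\<exists>s<a. y = s + a * n"
          using a_gt_1 by (intro exI[of _ "y mod a"]) auto
      qed auto
      ultimately show ?thesis by simp
    qed
    then show ?thesis by blast
  qed
  then have "(\<Sum>r\<in>{r. r div a ^ Suc j = n}. energy r 0 F)
      = (\<Sum>s<a. \<Sum>r\<in>{r. r div a ^ j = s + a * n}. energy r 0 F)"
    by (simp only:) (rule sum.UNION_disjoint, use finite_block in auto)
  then show ?case by (simp only: energy_Suc[OF F] Suc)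
qed simp

lemma energy_0_block:
  assumes "F \<in> L2 lebesgue"
  shows "energy 0 j F = (\<Sum>r<a ^ j. energy r 0 F)"
proof -
  have "{r. r div a ^ j = 0} = {..<a ^ j}" using a_gt_1 by (auto simp: div_eq_0_iff)
  then show ?thesis using energy_block[OF assms, of 0 j] by simp
qed

lemma energy_nonneg: "0 \<le> energy n j F"
  by (rule infsum_nonneg) simp

text \<open>The frame inequality for \<open>F (A^(-j) x)\<close> in \<open>V_0\<close>, transported
  by dilation; energy and squared norm both acquire the factor \<open>1 / a^j\<close>.\<close>

lemma energy_lower_bound:
  assumes F: "F \<in> V_space A \<phi> (int j)"
  shows "C1 * (L2_norm lebesgue F)\<^sup>2 \<le> energy 0 j F"
proof -
  define c where "c = real a powr (real j / 2)"
  have c2: "c\<^sup>2 = real a ^ j" unfolding c_def by (rule powr_half_sq)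
  define G where "G = (\<lambda>x. F (matpow A (- int j) *v x))"
  have GV: "G \<in> span_translates" using F by (simp add: V_space_iff G_def)
  then have G: "G \<in> L2 lebesgue" by (rule span_translates_L2)
  have FG: "F = (\<lambda>x. G (matpow A (int j) *v x))" by (simp add: G_def matpow_cancel)
  note dil = dilates_matpow[of j 0, simplified]
  have at: "atom 0 j q = (\<lambda>x. of_real c * translates q (matpow A (int j) *v x))" for q
    by (cases q) (simp add: fun_eq_iff atom_def c_def f_0)
  have "(cmod (L2_inner lebesgue F (atom 0 j q)))\<^sup>2 = (1 / real a ^ j) * (cmod (L2_inner lebesgue G (translates q)))\<^sup>2" for q
  proof -
    have "L2_inner lebesgue F (atom 0 j q) = of_real (c / real a ^ j) * L2_inner lebesgue G (translates q)"
      unfolding at L2_inner_cmult_right FG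
      by (subst dilates_L2_inner[OF dil G]) (use translates_L2 in auto)
    then have "(cmod (L2_inner lebesgue F (atom 0 j q)))\<^sup>2
        = (c / real a ^ j)\<^sup>2 * (cmod (L2_inner lebesgue G (translates q)))\<^sup>2"
      by (simp only: norm_mult norm_of_real power_mult_distrib power2_abs)
    also have "(c / real a ^ j)\<^sup>2 = 1 / real a ^ j"
      using a_pos unfolding power_divide c2 by (simp add: power2_eq_square)
    finally show ?thesis .
  qed
  then have "energy 0 j F = (1 / real a ^ j) * (\<Sum>\<^sub>\<infinity>q. (cmod (L2_inner lebesgue G (translates q)))\<^sup>2)"
    by (simp only: infsum_cmult_right')
  moreover have "C1 * (L2_norm lebesgue G)\<^sup>2 \<le> (\<Sum>\<^sub>\<infinity>q. (cmod (L2_inner lebesgue G (translates q)))\<^sup>2)"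
    using frame GV unfolding frame_with_bounds_def V_space_0 by blast
  moreover have "(L2_norm lebesgue F)\<^sup>2 = (1 / real a ^ j) * (L2_norm lebesgue G)\<^sup>2"
    unfolding FG dilates_L2_norm[OF dil L2_measurable[OF G]] using a_pos by (simp add: power_mult_distrib)
  ultimately show ?thesis
    using mult_left_mono[of "C1 * (L2_norm lebesgue G)\<^sup>2" _ "1 / real a ^ j"] a_pos
    by (simp add: ac_simps)
qed

text \<open>One refinement raises the level by one, and \<open>n div a + 1 \<le> n\<close> for
  \<open>n > 0\<close>. The level \<open>n\<close> is crude, the number of base-\<open>a\<close>
  digits of \<open>n\<close> being the natural one, but membership in the union of the spaces is the
  aim.\<close>

lemma packet_in_V_space: "f n l \<in> V_space A \<phi> (int n)"
proof (induction n arbitrary: l rule: less_induct)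
  case (less n)
  show ?case
  proof (cases "n = 0")
    case True
    have "translates (l, 0) \<in> V_space A \<phi> 0" using frame unfolding frame_with_bounds_def by blast
    then show ?thesis using True by (simp add: zvec_0 f_0)
  next
    case False
    define r s where "r = n div a" and "s = n mod a"
    have n: "n = s + a * r" by (simp add: r_def s_def)
    have s: "s < a" using a_gt_1 by (simp add: s_def)
    have r: "r < n" unfolding r_def using False a_gt_1 by (intro div_less_dividend) auto
    have "(\<lambda>x. h s l i k * sqrt (real a) * f r i (A *v x - zvec k)) \<in> V_space A \<phi> (int (r + 1))" for i k
    proof -
      have "(\<lambda>x. f r i (x - zvec k)) \<in> V_space A \<phi> (int r)" by (rule V_space_shift[OF less[OF r]])
      from V_space_dilate[OF this, of 1] show ?thesis
        using matpow_Suc[of A 0] by (intro V_space_cmult) (simp add: matpow_0)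
    qed
    then have "f (s + a * r) l \<in> V_space A \<phi> (int (r + 1))"
      by (intro V_space_has_L2_sum[OF _ packet_has_L2_sum[OF bessel_packet s]]) auto
    then show ?thesis using V_space_mono[of "r + 1" n] r n by simp
  qed
qed

lemma atom_in_V_space: "atom n j q \<in> V_space A \<phi> (int (n + j))"
proof (cases q)
  case (Pair l k)
  then show ?thesis
    using V_space_cmult[OF V_space_dilate[OF V_space_shift[OF packet_in_V_space]]]
    by (simp add: atom_def)
qed

section \<open>Frames attached to a partition, and the plain translates as a special case\<close>

definition V_closure :: "(real^'d \<Rightarrow> complex) set" where
  "V_closure = L2_closure lebesgue (\<Union>j::nat. V_space A \<phi> (int j))"

abbreviation "dilated_packets \<equiv> (\<lambda>((n::nat, j::int), l::'l, k::int^'d) x.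
  complex_of_real (real a powr (real_of_int j / 2)) * f n l (matpow A j *v x - zvec k))"

context
  fixes S :: "(nat \<times> int) set"
  assumes partition: "partition_family (packet_block a) S"
begin

lemma index_nonneg:
  assumes "p \<in> S"
  shows "int (nat (snd p)) = snd p"
proof -
  have "packet_block a (fst p, snd p) \<noteq> {}" using partition assms by (simp add: partition_family_def)
  then show ?thesis using packet_block_negative[OF a_gt_1] by (metis int_nat_eq not_le)
qed

lemma dilated_packets_eq: "p \<in> S \<Longrightarrow> dilated_packets (p, q) = atom (fst p) (nat (snd p)) q"
proof -
  assume "p \<in> S"
  then obtain n j where "p = (n, int j)" using index_nonneg[of p] by (metis prod.collapse)
  then show ?thesis by (cases q) (simp add: atom_def)
qed

text \<open>Disjointness of the blocks turns a sum over members of the partition into a sum over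
  plain indices \<open>r\<close>, where different partitions can be compared.\<close>

lemma sum_energy:
  assumes T: "finite T" "T \<subseteq> S" and F: "F \<in> L2 lebesgue"
  shows "finite (\<Union>p\<in>T. packet_block a p)"
    and "(\<Sum>p\<in>T. energy (fst p) (nat (snd p)) F) = (\<Sum>r\<in>(\<Union>p\<in>T. packet_block a p). energy r 0 F)"
proof -
  have blk: "packet_block a p = {r. r div a ^ nat (snd p) = fst p}" if "p \<in> T" for p
    using packet_block_nat[of a "fst p" "nat (snd p)"] index_nonneg[of p] that T a_gt_1 by auto
  then show "finite (\<Union>p\<in>T. packet_block a p)"
    using T(1) finite_block by (intro finite_UN_I) simp_all
  have "(\<Sum>p\<in>T. energy (fst p) (nat (snd p)) F) = (\<Sum>p\<in>T. \<Sum>r\<in>packet_block a p. energy r 0 F)"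
  proof (rule sum.cong[OF refl])
    show "energy (fst p) (nat (snd p)) F = (\<Sum>r\<in>packet_block a p. energy r 0 F)" if "p \<in> T" for p
      unfolding blk[OF that] by (rule energy_block[OF F])
  qed
  also have "\<dots> = (\<Sum>r\<in>(\<Union>p\<in>T. packet_block a p). energy r 0 F)"
  proof (rule sum.UNION_disjoint[OF T(1), symmetric])
    show "\<forall>p\<in>T. finite (packet_block a p)" using blk finite_block by simp
    show "\<forall>p\<in>T. \<forall>p'\<in>T. p \<noteq> p' \<longrightarrow> packet_block a p \<inter> packet_block a p' = {}"
      using partition T(2) unfolding partition_family_def disjoint_family_on_def by blast
  qed
  finally show "(\<Sum>p\<in>T. energy (fst p) (nat (snd p)) F) = (\<Sum>r\<in>(\<Union>p\<in>T. packet_block a p). energy r 0 F)" .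
qed

lemma has_sum_block:
  assumes T: "finite T" "T \<subseteq> S" and F: "F \<in> L2 lebesgue"
  shows "((\<lambda>i. (cmod (L2_inner lebesgue F (dilated_packets i)))\<^sup>2) has_sum
    (\<Sum>p\<in>T. energy (fst p) (nat (snd p)) F)) (T \<times> UNIV)"
proof (rule has_sum_finite_Times[OF T(1)])
  fix p assume "p \<in> T"
  then have p: "p \<in> S" using T by auto
  show "((\<lambda>q. (cmod (L2_inner lebesgue F (dilated_packets (p, q))))\<^sup>2) has_sum energy (fst p) (nat (snd p)) F) UNIV"
    unfolding dilated_packets_eq[OF p] by (intro has_sum_infsum bessel_summable[OF bessel_atom F])
qed

text \<open>A finite subfamily touches finitely many blocks. They are finite and disjoint and fit
  into \<open>{..<a ^ J}\<close>, so its energy is at most that of index \<open>0\<close> at level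
  \<open>J\<close>, to which the bound \<open>C2\<close> applies.\<close>

lemma bessel_dilated_packets: "bessel lebesgue dilated_packets (S \<times> UNIV) C2"
  unfolding bessel_def
proof (intro conjI ballI allI impI)
  show "dilated_packets i \<in> L2 lebesgue" if "i \<in> S \<times> UNIV" for i
    using that dilated_packets_eq bessel_in_L2[OF bessel_atom] by (cases i) auto
  show "0 \<le> C2" using bounds_pos by simp
  fix F :: "real^'d \<Rightarrow> complex" and X :: "((nat \<times> int) \<times> 'l \<times> (int^'d)) set"
  assume F: "F \<in> L2 lebesgue" and X: "finite X" "X \<subseteq> S \<times> UNIV"
  define T where "T = fst ` X"
  have T: "finite T" "T \<subseteq> S" using X by (auto simp: T_def)
  obtain J where J: "\<And>r. r \<in> (\<Union>p\<in>T. packet_block a p) \<Longrightarrow> r < J"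
    using sum_energy(1)[OF T F] by (metis finite_nat_set_iff_bounded)
  \<comment> \<open>The bound \<open>J\<close> of the blocks doubles as the exponent.\<close>
  have "J < a ^ J" using a_gt_1 by (intro power_gt_expt) simp
  then have sub: "(\<Union>p\<in>T. packet_block a p) \<subseteq> {..<a ^ J}" using J by (auto dest: less_trans)
  have "(\<Sum>i\<in>X. (cmod (L2_inner lebesgue F (dilated_packets i)))\<^sup>2) \<le> (\<Sum>p\<in>T. energy (fst p) (nat (snd p)) F)"
  proof (rule finite_sum_le_has_sum[OF has_sum_block[OF T F]])
    show "X \<subseteq> T \<times> UNIV" by (force simp: T_def)
  qed (use X in auto)
  also have "\<dots> = (\<Sum>r\<in>(\<Union>p\<in>T. packet_block a p). energy r 0 F)" by (rule sum_energy(2)[OF T F])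
  also have "\<dots> \<le> (\<Sum>r<a ^ J. energy r 0 F)"
    using sub by (intro sum_mono2) (auto simp: energy_nonneg)
  also have "\<dots> = energy 0 J F" by (rule energy_0_block[OF F, symmetric])
  also have "\<dots> \<le> C2 * (L2_norm lebesgue F)\<^sup>2" by (rule bessel_summable(2)[OF bessel_atom F])
  finally show "(\<Sum>i\<in>X. (cmod (L2_inner lebesgue F (dilated_packets i)))\<^sup>2) \<le> C2 * (L2_norm lebesgue F)\<^sup>2" .
qed

text \<open>The counterpart to the Bessel bound: since the blocks cover everything, finitely many of
  them already cover \<open>{..<a ^ J}\<close>. This single inequality serves both the lower frame
  bound, with \<open>J = j\<close> on \<open>V_j\<close>, and the optimality of \<open>C2\<close>,
  with \<open>J = 0\<close>.\<close>

lemma energy_le_dilated_packets: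
  assumes F: "F \<in> L2 lebesgue"
  shows "energy 0 J F \<le> (\<Sum>\<^sub>\<infinity>i\<in>S \<times> UNIV. (cmod (L2_inner lebesgue F (dilated_packets i)))\<^sup>2)"
proof -
  have "\<forall>r. \<exists>p\<in>S. r \<in> packet_block a p" using partition unfolding partition_family_def by blast
  then obtain P where P: "\<And>r. P r \<in> S" "\<And>r. r \<in> packet_block a (P r)" by metis
  \<comment> \<open>One block is chosen for every index below \<open>a ^ J\<close>. The chosen
    blocks may reach beyond \<open>a ^ J\<close>, which only adds nonnegative energy.\<close>
  define T where "T = P ` {..<a ^ J}"
  have T: "finite T" "T \<subseteq> S" using P by (auto simp: T_def)
  have "energy 0 J F = (\<Sum>r<a ^ J. energy r 0 F)" by (rule energy_0_block[OF F])
  also have "\<dots> \<le> (\<Sum>r\<in>(\<Union>p\<in>T. packet_block a p). energy r 0 F)"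
    using P(2) by (intro sum_mono2 sum_energy(1)[OF T F]) (auto simp: T_def energy_nonneg)
  also have "\<dots> = (\<Sum>p\<in>T. energy (fst p) (nat (snd p)) F)" by (rule sum_energy(2)[OF T F, symmetric])
  also have "\<dots> = (\<Sum>\<^sub>\<infinity>i\<in>T \<times> UNIV. (cmod (L2_inner lebesgue F (dilated_packets i)))\<^sup>2)"
    by (rule infsumI[OF has_sum_block[OF T F], symmetric])
  also have "\<dots> \<le> (\<Sum>\<^sub>\<infinity>i\<in>S \<times> UNIV. (cmod (L2_inner lebesgue F (dilated_packets i)))\<^sup>2)"
    using T by (intro infsum_mono2 has_sum_imp_summable[OF has_sum_block[OF T F]] bessel_summable[OF bessel_dilated_packets F]) auto
  finally show ?thesis .
qed

lemma frame_dilated_packets: "frame_with_bounds lebesgue V_closure dilated_packets (S \<times> UNIV) C1 C2"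
  unfolding frame_with_bounds_def
proof (intro conjI ballI)
  have C: "0 < C1" "C1 \<le> C2" using frame by (auto simp: frame_with_bounds_def)
  then show "0 < C1" "C1 \<le> C2" by auto
  fix i :: "(nat \<times> int) \<times> 'l \<times> (int^'d)" assume "i \<in> S \<times> UNIV"
  then have "dilated_packets i = atom (fst (fst i)) (nat (snd (fst i))) (snd i)"
    using dilated_packets_eq[of "fst i" "snd i"] by auto
  then have "dilated_packets i \<in> (\<Union>j::nat. V_space A \<phi> (int j))"
    using atom_in_V_space[of "fst (fst i)" "nat (snd (fst i))" "snd i"] by (simp only: UN_iff) blast
  then show "dilated_packets i \<in> V_closure"
    unfolding V_closure_def by (auto intro!: L2_closure_superset V_space_L2)
next
  fix F assume "F \<in> V_closure"
  then have F: "F \<in> L2_closure lebesgue (\<Union>j::nat. V_space A \<phi> (int j))" by (simp add: V_closure_def)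
  note FL = L2_closure_in_L2[OF F]
  show "(\<lambda>i. (cmod (L2_inner lebesgue F (dilated_packets i)))\<^sup>2) summable_on S \<times> UNIV"
    "(\<Sum>\<^sub>\<infinity>i\<in>S \<times> UNIV. (cmod (L2_inner lebesgue F (dilated_packets i)))\<^sup>2) \<le> C2 * (L2_norm lebesgue F)\<^sup>2"
    by (rule bessel_summable[OF bessel_dilated_packets FL])+
  show "C1 * (L2_norm lebesgue F)\<^sup>2 \<le> (\<Sum>\<^sub>\<infinity>i\<in>S \<times> UNIV. (cmod (L2_inner lebesgue F (dilated_packets i)))\<^sup>2)"
  proof (rule bessel_lower_bound_closure[OF bessel_dilated_packets _ _ _ F])
    fix G assume "G \<in> (\<Union>j::nat. V_space A \<phi> (int j))"
    then obtain j where G: "G \<in> V_space A \<phi> (int j)" by blast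
    show "C1 * (L2_norm lebesgue G)\<^sup>2 \<le> (\<Sum>\<^sub>\<infinity>i\<in>S \<times> UNIV. (cmod (L2_inner lebesgue G (dilated_packets i)))\<^sup>2)"
      using energy_lower_bound[OF G] energy_le_dilated_packets[OF V_space_L2[OF G], of j] by linarith
  qed (use bounds_pos V_space_L2 in auto)
qed

text \<open>An upper bound \<open>C\<close> on the large space restricts to \<open>V_0\<close>, and
  there the energy of the translates is dominated by that of the new family. So \<open>C\<close> is
  admissible for the translates as well.\<close>

lemma least_upper_dilated_packets:
  assumes "least_upper_frame_bound lebesgue (V_space A \<phi> 0) translates UNIV C2"
  shows "least_upper_frame_bound lebesgue V_closure dilated_packets (S \<times> UNIV) C2"
  unfolding least_upper_frame_bound_def
proof (intro conjI allI impI)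
  show "upper_frame_bound lebesgue V_closure dilated_packets (S \<times> UNIV) C2"
    using frame_dilated_packets unfolding frame_with_bounds_def upper_frame_bound_def by blast
  fix C assume C: "upper_frame_bound lebesgue V_closure dilated_packets (S \<times> UNIV) C"
  have "upper_frame_bound lebesgue (V_space A \<phi> 0) translates UNIV C"
    unfolding upper_frame_bound_def
  proof (intro ballI conjI)
    fix F assume F: "F \<in> V_space A \<phi> 0"
    then have FL: "F \<in> L2 lebesgue" using V_space_L2[of F 0] by simp
    show "(\<lambda>i. (cmod (L2_inner lebesgue F (translates i)))\<^sup>2) summable_on UNIV"
      using bessel_summable(1)[OF bessel_translates FL] by (simp only: atom_0_0)
    have "F \<in> V_closure"
      unfolding V_closure_def using F FL by (intro L2_closure_superset UN_I[of 0]) auto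
    then have "(\<Sum>\<^sub>\<infinity>i\<in>S \<times> UNIV. (cmod (L2_inner lebesgue F (dilated_packets i)))\<^sup>2) \<le> C * (L2_norm lebesgue F)\<^sup>2"
      using C unfolding upper_frame_bound_def by blast
    then show "(\<Sum>\<^sub>\<infinity>i. (cmod (L2_inner lebesgue F (translates i)))\<^sup>2) \<le> C * (L2_norm lebesgue F)\<^sup>2"
      using energy_le_dilated_packets[OF FL, of 0] by (simp only: atom_0_0)
  qed
  then show "C2 \<le> C" using assms unfolding least_upper_frame_bound_def by blast
qed

end

text \<open>At level \<open>0\<close> the blocks are the singletons \<open>{n}\<close>. The claim
  about the undilated packets is thereby an instance of the claim about partitions.\<close>

lemma partition_level_0: "partition_family (packet_block a) (UNIV \<times> {0})"
proof -
  have "packet_block a (n, 0) = {n}" for n using packet_block_nat[of a n 0] a_gt_1 by auto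
  then show ?thesis by (auto simp: partition_family_def disjoint_family_on_def)
qed

abbreviation "packet_translates \<equiv> (\<lambda>(n::nat, l::'l, k::int^'d) x. f n l (x - zvec k))"

lemma packet_translates_eq: "packet_translates i = dilated_packets (case i of (n, q) \<Rightarrow> ((n, 0), q))"
  using a_pos by (cases i) (auto simp: matpow_0)

lemma bij_level_0: "bij_betw (\<lambda>(n, q). ((n, 0), q)) UNIV ((UNIV \<times> {0}) \<times> UNIV)"
  by (rule bij_betw_byWitness[where f' = "\<lambda>((n, j), q). (n, q)"]) auto

lemma frame_packet_translates: "frame_with_bounds lebesgue V_closure packet_translates UNIV C1 C2"
  using frame_dilated_packets[OF partition_level_0]
  unfolding packet_translates_eq[abs_def] frame_with_bounds_reindex[OF bij_level_0, of _ _ dilated_packets] .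

lemma least_upper_packet_translates:
  assumes "least_upper_frame_bound lebesgue (V_space A \<phi> 0) translates UNIV C2"
  shows "least_upper_frame_bound lebesgue V_closure packet_translates UNIV C2"
  using least_upper_dilated_packets[OF partition_level_0 assms]
  unfolding packet_translates_eq[abs_def] least_upper_frame_bound_def
    upper_frame_bound_reindex[OF bij_level_0, of _ _ dilated_packets] .

end

theorem theorem6p2:
  fixes A B :: "real^'d^'d"
    and a :: nat
    and K :: "(int^'d) set"
    and \<beta> :: "nat \<Rightarrow> int^'d"
    and h :: "nat \<Rightarrow> 'l::finite \<Rightarrow> 'l \<Rightarrow> int^'d \<Rightarrow> complex"
    and \<phi> :: "'l \<Rightarrow> real^'d \<Rightarrow> complex"
    and f :: "nat \<Rightarrow> 'l \<Rightarrow> real^'d \<Rightarrow> complex"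
    and C1 C2 :: real
  defines "W \<equiv> L2_closure lebesgue (\<Union>j::nat. V_space A \<phi> (int j))"
    and "translates \<equiv> (\<lambda>(l::'l, k::int^'d) x. \<phi> l (x - zvec k))"
    and "packets \<equiv> (\<lambda>(n::nat, l::'l, k::int^'d) x. f n l (x - zvec k))"
    and "dilated_packets \<equiv> (\<lambda>((n::nat, j::int), l::'l, k::int^'d) x.
           complex_of_real (real a powr (real_of_int j / 2)) * f n l (matpow A j *v x - zvec k))"
  assumes "dilation_matrix A"
    and "B = transpose A"
    and "real a = \<bar>det A\<bar>"
    and "digit_set B K"
    and "bij_betw \<beta> {..<a} K"
    and "\<And>r l j. r < a \<Longrightarrow> (\<lambda>k. (cmod (h r l j k))\<^sup>2) summable_on UNIV"
    and "\<And>l. \<phi> l \<in> L2 lebesgue"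
    and "refinable A a h \<phi>"
    and "frame_with_bounds lebesgue (V_space A \<phi> 0) translates UNIV C1 C2"
    and "V_space A \<phi> 0 \<subseteq> V_space A \<phi> 1"
    and "AE \<xi> in lebesgue. unitary_matrix_on ({..<a} \<times> UNIV) (filter_matrix B a \<beta> h \<xi>)"
    and "wavelet_frame_packets A a h \<phi> f"
  shows "frame_with_bounds lebesgue W packets UNIV C1 C2 \<and>
     (least_upper_frame_bound lebesgue (V_space A \<phi> 0) translates UNIV C2 \<longrightarrow>
        least_upper_frame_bound lebesgue W packets UNIV C2) \<and>
     (\<forall>S :: (nat \<times> int) set. partition_family (packet_block a) S \<longrightarrow>
        frame_with_bounds lebesgue W dilated_packets (S \<times> UNIV) C1 C2 \<and>
        (least_upper_frame_bound lebesgue (V_space A \<phi> 0) translates UNIV C2 \<longrightarrow>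
           least_upper_frame_bound lebesgue W dilated_packets (S \<times> UNIV) C2))"
proof -
  interpret P: frame_packets A a K \<beta> h \<phi> f C1 C2
    by unfold_locales (use assms in auto)
  show ?thesis
    unfolding W_def translates_def packets_def dilated_packets_def P.V_closure_def[symmetric]
    using P.frame_packet_translates P.least_upper_packet_translates
      P.frame_dilated_packets P.least_upper_dilated_packets
    by blast
qed

end
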